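(* For $N\ge 2$ let $D_N(s)=\sum_{n=1}^N n^{-1/2-s}$. For every $0<q<\infty$, $$\|D_N\|_q\gg_q(\log N)^{q/4},$$ and for every $1<q<\infty$, $$\|D_N\|_q\ll_q(\log N)^{q/4}.$$
   Context: For a Dirichlet polynomial $F(s)=\sum_{n=1}^N a_n n^{-s}$ and $0<q<\infty$, $$\|F\|_q:=\left(\lim_{T\to\infty}\frac1T\int_0^T|F(it)|^q\,dt\right)^{1/q}.$$ The notation $f\ll_q g$ (equivalently $g\gg_q f$) means $|f|\le K g$ for some constant $K>0$ depending only on $q$ (in particular not on $N$). *)

theory Defs
  imports "HOL-Analysis.Analysis"
begin

text \<open>
  The limit exists for every Dirichlet polynomial (by almost periodicity) when \<open>q > 0\<close>;
  for arbitrary \<open>F\<close>, where it may fail to exist, the value is unspecified.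
\<close>
definition dirichlet_norm :: "real \<Rightarrow> (complex \<Rightarrow> complex) \<Rightarrow> real" where
  "dirichlet_norm q F =
     (Lim at_top (\<lambda>T::real. 1 / T * integral {0..T} (\<lambda>t. norm (F (\<i> * of_real t)) powr q)))
       powr (1 / q)"

definition D :: "nat \<Rightarrow> complex \<Rightarrow> complex" where
  "D N s = (\<Sum>n=1..N. of_nat n powr (- 1 / 2 - s))"

end

theory Submission
  imports Defs
    "HOL-Computational_Algebra.Fundamental_Theorem_Algebra"
    "HOL-Probability.Infinite_Product_Measure"
    "HOL-Complex_Analysis.Complex_Analysis"
begin

text \<open>
  Write \<open>z\<^sub>p\<close> for independent points of the unit circle, one for each prime. By Bohr's correspondence
  \<open>p\<^bsup>-it\<^esup> \<mapsto> z\<^sub>p\<close>, the \<open>q\<close>-th mean of a Dirichlet polynomial along the imaginary axis is the integral of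
  \<open>|f|\<^sup>q\<close> over a torus, where \<open>f\<close> is a polynomial in the \<open>z\<^sub>p\<close> (\<open>torus_moment\<close>). It follows that the limit
  in the definition of the norm exists (\<open>dirichlet_norm_eq_torus\<close>). The size of \<open>D\<^sub>N\<close> is governed by its
  comparison with the Euler product over \<open>p \<le> N\<close>, whose factors are independent on the torus.

  Lower bound, every \<open>q > 0\<close>. On the polydisc,
  \<open>|f(r)|\<^sup>q \<Prod>(1 - r\<^sub>p\<^sup>2) \<le> \<integral>|f|\<^sup>q\<close> (\<open>torus_point_evaluation\<close>): in one variable the zeros inside the disc are
  reflected to the outside, after which \<open>f\<^bsup>q/2\<^esup>\<close> is holomorphic and the case \<open>q = 2\<close> applies; several
  variables follow by Fubini. Take \<open>r\<^sub>p = (q/2) p\<^bsup>-1/2\<^esup>\<close> for the primes in a range \<open>q\<^sup>2 < p \<le> Y\<close>, where \<open>Y\<close> is a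
  small power of \<open>N\<close>. Then \<open>f(r)\<close> is at least half of \<open>\<Prod>(1 + q/(2p))\<close>, which has order \<open>(log N)\<^bsup>q/2\<^esup>\<close>, because
  the truncation \<open>n \<le> N\<close> removes at most half of the product by Markov's inequality
  (\<open>truncated_subset_sum_ge\<close>). Since \<open>\<Prod>(1 - r\<^sub>p\<^sup>2)\<close> has order \<open>(log N)\<^bsup>-q\<^sup>2/4\<^esup>\<close>, the integral is at least of
  order \<open>(log N)\<^bsup>q\<^sup>2/2 - q\<^sup>2/4\<^esup>\<close>. The coefficient \<open>q/2\<close> is the \<open>c\<close> that maximises the exponent \<open>cq - c\<^sup>2\<close>.

  Upper bound, \<open>q > 1\<close>. Cutting a Dirichlet polynomial at \<open>n \<le> N\<close> is a projection on half of the
  frequencies, so a version of M. Riesz's theorem on conjugate functions bounds it on \<open>L\<^sup>q\<close>, uniformly in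
  \<open>N\<close> (\<open>partial_sum_bound\<close>). Applied to the Euler product, it reduces the claim to
  \<open>\<integral>|\<Sum>\<^sub>k p\<^bsup>-k/2\<^esup> z\<^sup>k|\<^sup>q \<le> 1 + q\<^sup>2/(4p) + O(p\<^bsup>-3/2\<^esup>)\<close> (\<open>local_factor_moment\<close>) and Mertens' estimate for \<open>\<Sum>1/p\<close>.
  Riesz's theorem is proved directly for generalised Dirichlet polynomials \<open>F(s) = \<Sum>a\<^sub>j e\<^bsup>-\<nu>\<^sub>j s\<^esup>\<close>
  with \<open>\<nu>\<^sub>j > 0\<close>: for a subharmonic \<open>\<Phi>\<close> the mean of \<open>\<Phi>(F)\<close> over the line \<open>Re s = \<sigma>\<close> is a bounded convex function of
  \<open>\<sigma>\<close>, so at \<open>\<sigma> = 0\<close> it is at least its limit \<open>\<Phi>(0)\<close> (\<open>subharmonic_mean_eventually_ge\<close>). It remains to find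
  \<open>\<Phi>\<close> that lie below \<open>C |Re w|\<^sup>q - c |w|\<^sup>q\<close> up to a bounded term
  (\<open>conjugate_function_bound_small\<close>, \<open>conjugate_function_bound_large\<close>).
\<close>

section \<open>Sums and products over primes\<close>

definition primes_upto :: "nat \<Rightarrow> nat set" where
  "primes_upto N = {p. prime p \<and> p \<le> N}"

lemma finite_primes_upto [simp, intro]: "finite (primes_upto N)"
  unfolding primes_upto_def by (rule finite_subset[of _ "{..N}"]) auto

lemma primes_uptoD: "p \<in> primes_upto N \<Longrightarrow> prime p" "p \<in> primes_upto N \<Longrightarrow> p \<le> N"
  "p \<in> primes_upto N \<Longrightarrow> 2 \<le> p"
  unfolding primes_upto_def by (auto dest: prime_ge_2_nat)

lemma sum_ln_prime_factors_le:
  assumes "n > 0"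
  shows "(\<Sum>p\<in>prime_factors n. ln (real p)) \<le> ln (real n)"
proof -
  have "(\<Prod>p\<in>prime_factors n. p) \<le> (\<Prod>p\<in>prime_factors n. p ^ multiplicity p n)"
  proof (rule prod_mono)
    fix p assume p: "p \<in> prime_factors n"
    then have "1 \<le> multiplicity p n"
      using prime_factors_multiplicity by (simp add: prime_factors_multiplicity Suc_leI)
    then have "p ^ 1 \<le> p ^ multiplicity p n"
      using p by (intro power_increasing) (auto dest: in_prime_factors_imp_prime prime_gt_0_nat intro: Suc_leI)
    then show "0 \<le> p \<and> p \<le> p ^ multiplicity p n" by simp
  qed
  then have le: "(\<Prod>p\<in>prime_factors n. p) \<le> n"
    using prime_factorization_nat[of n] assms by simp
  have pos: "p > 0" if "p \<in> prime_factors n" for p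
    using that by (auto dest: in_prime_factors_imp_prime prime_gt_0_nat)
  have "(\<Sum>p\<in>prime_factors n. ln (real p)) = ln (\<Prod>p\<in>prime_factors n. real p)"
    using pos by (subst ln_prod) auto
  also have "\<dots> = ln (real (\<Prod>p\<in>prime_factors n. p))" by simp
  also have "\<dots> \<le> ln (real n)"
    using le pos assms by (subst ln_le_cancel_iff) (auto simp del: of_nat_prod intro!: prod_pos)
  finally show ?thesis .
qed

text \<open>
  Summing \<open>\<Sum>\<^bsub>p dvd n\<^esub> ln p \<le> ln n\<close> over \<open>n \<le> N\<close> gives \<open>\<Sum> ln p \<lfloor>N/p\<rfloor> \<le> N ln N\<close>. Replacing
  \<open>\<lfloor>N/p\<rfloor>\<close> by \<open>N/(2p)\<close> costs the factor \<open>2\<close> but avoids any estimate of \<open>\<Sum> ln p\<close>.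
\<close>
lemma sum_ln_over_prime_le:
  assumes "N \<ge> 1"
  shows "(\<Sum>p\<in>primes_upto N. ln (real p) / real p) \<le> 2 * ln (real N)"
proof -
  let ?P = "primes_upto N"
  have half: "real N / (2 * real p) \<le> real (card {n\<in>{1..N}. p dvd n})" if p: "p \<in> ?P" for p
  proof -
    have p0: "p > 0" and pN: "p \<le> N" using primes_uptoD[OF p] by auto
    have "(\<lambda>k. k * p) ` {1..N div p} \<subseteq> {n\<in>{1..N}. p dvd n}"
    proof safe
      fix k assume k: "k \<in> {1..N div p}"
      then show "k * p \<in> {1..N}" using p0
        by (auto simp: Suc_le_eq) (metis div_times_less_eq_dividend le_trans mult_le_mono1)
    qed auto
    moreover have "inj_on (\<lambda>k. k * p) {1..N div p}" using p0 by (auto simp: inj_on_def)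
    ultimately have c: "N div p \<le> card {n\<in>{1..N}. p dvd n}"
      using card_mono[of "{n\<in>{1..N}. p dvd n}" "(\<lambda>k. k * p) ` {1..N div p}"]
      by (simp add: card_image)
    have 1: "1 \<le> N div p" using p0 pN by (simp add: Suc_le_eq div_greater_zero_iff)
    have "N < p * (N div p + 1)" using p0
      by (metis add.commute dividend_less_times_div mult.commute Suc_eq_plus1 mult_Suc_right)
    also have "\<dots> \<le> p * (2 * (N div p))" using 1 by (intro mult_le_mono2) auto
    finally have "real N < real (p * (2 * (N div p)))" using of_nat_less_iff by blast
    then have "real N / (2 * real p) \<le> real (N div p)"
      using p0 by (simp add: field_simps)
    with c show ?thesis by linarith
  qed
  have "(\<Sum>p\<in>?P. ln (real p) * (real N / (2 * real p)))
      \<le> (\<Sum>p\<in>?P. ln (real p) * real (card {n\<in>{1..N}. p dvd n}))"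
    using half by (intro sum_mono mult_left_mono) (auto dest: primes_uptoD(3))
  also have "\<dots> = (\<Sum>p\<in>?P. \<Sum>n=1..N. if p dvd n then ln (real p) else 0)"
    by (intro sum.cong refl) (simp add: sum.If_cases Int_def)
  also have "\<dots> = (\<Sum>n=1..N. \<Sum>p\<in>?P. if p dvd n then ln (real p) else 0)"
    by (rule sum.swap)
  also have "\<dots> \<le> (\<Sum>n=1..N. ln (real N))"
  proof (rule sum_mono)
    fix n assume n: "n \<in> {1..N}"
    have "{p\<in>?P. p dvd n} = prime_factors n"
      using n unfolding primes_upto_def
      by (auto simp: in_prime_factors_iff intro: order_trans[OF dvd_imp_le])
    then have "(\<Sum>p\<in>?P. if p dvd n then ln (real p) else 0) = (\<Sum>p\<in>prime_factors n. ln (real p))"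
      by (simp add: sum.If_cases Int_def)
    also have "\<dots> \<le> ln (real n)" using n by (intro sum_ln_prime_factors_le) auto
    also have "\<dots> \<le> ln (real N)" using n by auto
    finally show "(\<Sum>p\<in>?P. if p dvd n then ln (real p) else 0) \<le> ln (real N)" .
  qed
  also have "\<dots> = real N * ln (real N)" by simp
  finally have "(real N / 2) * (\<Sum>p\<in>?P. ln (real p) / real p) \<le> real N * ln (real N)"
    by (simp add: sum_distrib_left field_simps)
  then show ?thesis using assms by (simp add: field_simps)
qed

text \<open>
  The exponents are bounded by \<open>K\<close> to keep the set, and the Euler products that expand over it, finite.
\<close>
definition smooth_numbers :: "nat set \<Rightarrow> nat \<Rightarrow> nat set" where
  "smooth_numbers P K = (\<lambda>e. \<Prod>p\<in>P. p ^ e p) ` (P \<rightarrow>\<^sub>E {..K})"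

lemma finite_smooth_numbers [simp, intro]: "finite P \<Longrightarrow> finite (smooth_numbers P K)"
  unfolding smooth_numbers_def by (intro finite_imageI finite_PiE) auto

lemma smooth_numbers_pos: "\<lbrakk>\<And>p. p \<in> P \<Longrightarrow> prime p; n \<in> smooth_numbers P K\<rbrakk> \<Longrightarrow> n > 0"
  unfolding smooth_numbers_def by (auto intro!: prod_pos zero_less_power intro: prime_gt_0_nat)

lemma inj_on_prime_powers:
  assumes "finite P" "\<And>p. p \<in> P \<Longrightarrow> prime (p :: nat)"
  shows "inj_on (\<lambda>e. \<Prod>p\<in>P. p ^ e p) (P \<rightarrow>\<^sub>E (A :: nat set))"
proof (rule inj_onI)
  fix e e' assume e: "e \<in> P \<rightarrow>\<^sub>E A" "e' \<in> P \<rightarrow>\<^sub>E A" and eq: "(\<Prod>p\<in>P. p ^ e p) = (\<Prod>p\<in>P. p ^ e' p)"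
  show "e = e'"
  proof (rule PiE_ext[OF e])
    fix p assume p: "p \<in> P"
    show "e p = e' p"
      using multiplicity_prod_prime_powers[of P p e]
        multiplicity_prod_prime_powers[of P p e'] eq p assms by simp
  qed
qed

lemma prod_geometric_eq_sum_smooth:
  fixes f :: "nat \<Rightarrow> 'a::comm_semiring_1"
  assumes P: "finite P" "\<And>p. p \<in> P \<Longrightarrow> prime p"
    and f: "f 1 = 1" "\<And>a b. a > 0 \<Longrightarrow> b > 0 \<Longrightarrow> f (a * b) = f a * f b"
  shows "(\<Prod>p\<in>P. \<Sum>k\<le>K. f p ^ k) = (\<Sum>n\<in>smooth_numbers P K. f n)"
proof -
  have pw: "f (p ^ k) = f p ^ k" if "p > 0" for p k
    using that by (induction k) (auto simp: f(1)[simplified] f(2))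
  have pr: "f (\<Prod>p\<in>Q. p ^ e p) = (\<Prod>p\<in>Q. f p ^ e p)" if "Q \<subseteq> P" for Q and e :: "nat \<Rightarrow> nat"
    using finite_subset[OF that P(1)] that
  proof (induction Q rule: finite_induct)
    case empty then show ?case using f(1) by simp
  next
    case (insert x F)
    have "x > 0" using insert.prems P(2) prime_gt_0_nat by auto
    moreover have "(\<Prod>p\<in>F. p ^ e p) > 0"
      using insert.prems P(2) by (intro prod_pos) (auto dest!: subsetD intro!: prime_gt_0_nat)
    ultimately show ?case using insert by (simp add: f(2) pw)
  qed
  have "(\<Prod>p\<in>P. \<Sum>k\<le>K. f p ^ k) = (\<Sum>e\<in>P \<rightarrow>\<^sub>E {..K}. \<Prod>p\<in>P. f p ^ e p)"
    using P(1) by (subst prod_sum_PiE) auto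
  also have "\<dots> = (\<Sum>e\<in>P \<rightarrow>\<^sub>E {..K}. f (\<Prod>p\<in>P. p ^ e p))"
    by (simp add: pr)
  also have "\<dots> = (\<Sum>n\<in>smooth_numbers P K. f n)"
    unfolding smooth_numbers_def by (subst sum.reindex[OF inj_on_prime_powers[OF P]]) auto
  finally show ?thesis .
qed

lemma prod_primes_upto_multiplicity:
  assumes "n > 0" "n \<le> N"
  shows "(\<Prod>p\<in>primes_upto N. p ^ multiplicity p n) = n"
proof -
  have "prime_factors n \<subseteq> primes_upto N"
    using assms dvd_imp_le[of _ n] unfolding primes_upto_def by (auto simp: prime_factors_dvd intro: le_trans)
  then have "(\<Prod>p\<in>prime_factors n. p ^ multiplicity p n) = (\<Prod>p\<in>primes_upto N. p ^ multiplicity p n)"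
    by (intro prod.mono_neutral_left)
       (auto simp: prime_factors_multiplicity primes_upto_def)
  then show ?thesis using prime_factorization_nat[of n] assms by simp
qed

lemma interval_subset_smooth_numbers: "{1..N} \<subseteq> smooth_numbers (primes_upto N) N"
proof
  fix n assume n: "n \<in> {1..N}"
  let ?e = "\<lambda>p\<in>primes_upto N. multiplicity p n"
  have "multiplicity p n \<le> N" if "p \<in> primes_upto N" for p
  proof -
    have "multiplicity p n < p ^ multiplicity p n"
      using primes_uptoD(3)[OF that] by (intro less_exp[THEN less_le_trans] power_mono) auto
    also have "\<dots> \<le> n" using n by (intro dvd_imp_le multiplicity_dvd) auto
    finally show ?thesis using n by simp
  qed
  then have "?e \<in> primes_upto N \<rightarrow>\<^sub>E {..N}" by auto
  moreover have "(\<Prod>p\<in>primes_upto N. p ^ ?e p) = n"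
    using prod_primes_upto_multiplicity[of n N] n by simp
  ultimately show "n \<in> smooth_numbers (primes_upto N) N"
    unfolding smooth_numbers_def by (intro image_eqI[of _ _ ?e]) simp_all
qed

text \<open>
  The terms telescope: \<open>\<epsilon> n\<^bsup>-1-\<epsilon>\<^esup> \<le> (n-1)\<^bsup>-\<epsilon>\<^esup> - n\<^bsup>-\<epsilon>\<^esup>\<close>.
\<close>
lemma sum_powr_le:
  fixes \<epsilon> :: real
  assumes "\<epsilon> > 0"
  shows "(\<Sum>n=1..M. real n powr (- 1 - \<epsilon>)) \<le> 1 + 1 / \<epsilon>"
proof -
  have *: "(\<Sum>n=1..Suc m. real n powr (- 1 - \<epsilon>)) \<le> 1 + 1 / \<epsilon> - real (Suc m) powr (- \<epsilon>) / \<epsilon>" for m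
  proof (induction m)
    case 0 then show ?case by simp
  next
    case (Suc m)
    let ?x = "real (Suc (Suc m))"
    have x: "?x > 0" "?x - 1 > 0" by auto
    have u: "1 + 1 / ?x * \<epsilon> \<le> (1 - 1 / ?x) powr (- \<epsilon>)"
    proof -
      have "1 + 1 / ?x * \<epsilon> \<le> 1 - \<epsilon> * ln (1 - 1 / ?x)"
      proof -
      have "ln (1 - 1 / ?x) \<le> (1 - 1 / ?x) - 1" by (rule ln_le_minus_one) simp
      then have "\<epsilon> * ln (1 - 1 / ?x) \<le> \<epsilon> * (- (1 / ?x))" using assms by (intro mult_left_mono) auto
      then show ?thesis by simp
    qed
      also have "\<dots> \<le> exp (- \<epsilon> * ln (1 - 1 / ?x))" using exp_ge_add_one_self[of "- \<epsilon> * ln (1 - 1 / ?x)"] by simp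
      also have "\<dots> = (1 - 1 / ?x) powr (- \<epsilon>)" by (simp add: powr_def)
      finally show ?thesis .
    qed
    have "real (Suc m) = ?x * (1 - 1 / ?x)" by (simp add: field_simps)
    then have "real (Suc m) powr (- \<epsilon>) = ?x powr (- \<epsilon>) * (1 - 1 / ?x) powr (- \<epsilon>)"
      by (simp only: ) (subst powr_mult, auto)
    also have "\<dots> \<ge> ?x powr (- \<epsilon>) * (1 + 1 / ?x * \<epsilon>)" using u by (intro mult_left_mono) auto
    finally have "?x powr (- \<epsilon>) + ?x powr (- \<epsilon>) * (\<epsilon> / ?x) \<le> real (Suc m) powr (- \<epsilon>)"
      by (simp only: distrib_left mult_1_right mult_1_left times_divide_eq_left)
    moreover have "?x powr (- \<epsilon>) * (\<epsilon> / ?x) = \<epsilon> * ?x powr (- 1 - \<epsilon>)"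
      using x by (simp add: powr_diff powr_minus field_simps)
    ultimately have "?x powr (- \<epsilon>) + \<epsilon> * (?x powr (- 1 - \<epsilon>)) \<le> real (Suc m) powr (- \<epsilon>)"
      by simp
    then have "?x powr (- 1 - \<epsilon>) \<le> real (Suc m) powr (- \<epsilon>) / \<epsilon> - ?x powr (- \<epsilon>) / \<epsilon>"
      using assms by (simp add: field_simps)
    then show ?case using Suc.IH by simp
  qed
  show ?thesis
  proof (cases M)
    case 0 then show ?thesis using assms by simp
  next
    case (Suc m)
    have "0 \<le> real (Suc m) powr (- \<epsilon>) / \<epsilon>" using assms by simp
    with *[of m] show ?thesis unfolding Suc by linarith
  qed
qed

lemma sum_inverse_prime_squares_le: "(\<Sum>p\<in>primes_upto N. 1 / real p ^ 2) \<le> 2"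
proof -
  have "(\<Sum>p\<in>primes_upto N. 1 / real p ^ 2) \<le> (\<Sum>n=1..N. 1 / real n ^ 2)"
    by (rule sum_mono2) (auto simp: primes_upto_def Suc_le_eq prime_gt_0_nat)
  also have "\<dots> = (\<Sum>n=1..N. real n powr (- 1 - 1))"
    by (intro sum.cong refl) (simp add: powr_minus powr_numeral field_simps)
  also have "\<dots> \<le> 2" using sum_powr_le[of 1 N] by simp
  finally show ?thesis .
qed

text \<open>
  With \<open>\<epsilon> = 1 / ln N\<close>, the Euler product of \<open>\<Sum> n\<^bsup>-1-\<epsilon>\<^esup> \<le> 1 + ln N\<close> bounds \<open>\<Sum> p\<^bsup>-1-\<epsilon>\<^esup>\<close>. Passing from
  \<open>p\<^bsup>-1-\<epsilon>\<^esup>\<close> to \<open>1/p\<close> costs at most \<open>\<epsilon> \<Sum> ln p / p \<le> 2\<close>.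
\<close>
lemma mertens_upper:
  obtains C :: real where "C \<ge> 0" "\<And>N. N \<ge> 2 \<Longrightarrow> (\<Sum>p\<in>primes_upto N. 1 / real p) \<le> ln (ln (real N)) + C"
proof -
  have bound: "(\<Sum>p\<in>primes_upto N. 1 / real p) \<le> ln (ln (real N)) + (ln (1 + 1 / ln 2) + 4)" if N: "N \<ge> 2" for N
  proof -
    let ?P = "primes_upto N"
    define L where "L = ln (real N)"
    have L: "L \<ge> ln 2" "L > 0" using N by (auto simp: L_def)
    define \<epsilon> where "\<epsilon> = 1 / L"
    have e: "\<epsilon> > 0" using L by (simp add: \<epsilon>_def)
    define f where "f = (\<lambda>n. real n powr (- 1 - \<epsilon>))"
    have fpos: "f p > 0" if "p > 0" for p using that by (simp add: f_def)
    have fle: "f p \<le> 1 / real p" if "p > 0" for p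
    proof -
      have "real p powr (- 1 - \<epsilon>) \<le> real p powr (- 1)" using that e by (intro powr_mono) auto
      then show ?thesis using that by (simp add: f_def powr_minus field_simps)
    qed
    have "(\<Prod>p\<in>?P. 1 + f p) = (\<Prod>p\<in>?P. \<Sum>k\<le>1. f p ^ k)" by simp
    also have "\<dots> = (\<Sum>n\<in>smooth_numbers ?P 1. f n)"
      by (rule prod_geometric_eq_sum_smooth) (auto dest: primes_uptoD simp: f_def powr_mult)
    also have "\<dots> \<le> (\<Sum>n=1..Max (smooth_numbers ?P 1). f n)"
      using smooth_numbers_pos[of ?P _ 1] primes_uptoD(1)
      by (intro sum_mono2) (force simp: f_def Suc_le_eq)+
    also have "\<dots> \<le> 1 + L" unfolding f_def using sum_powr_le[OF e] by (simp add: \<epsilon>_def)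
    finally have "ln (\<Prod>p\<in>?P. 1 + f p) \<le> ln (1 + L)"
      using fpos by (subst ln_le_cancel_iff) (auto intro!: prod_pos add_pos_pos dest: primes_uptoD simp: prime_gt_0_nat L add_pos_pos)
    also have "ln (\<Prod>p\<in>?P. 1 + f p) = (\<Sum>p\<in>?P. ln (1 + f p))"
    proof (rule ln_prod)
      fix p assume "p \<in> ?P"
      then have "p > 0" using primes_uptoD(3) by fastforce
      then have "f p > 0" by (rule fpos)
      then show "1 + f p \<noteq> 0" by linarith
    qed simp
    also have "\<dots> \<ge> (\<Sum>p\<in>?P. f p - 1 / real p ^ 2)"
    proof (rule sum_mono)
      fix p assume p: "p \<in> ?P"
      then have p2: "p \<ge> 2" by (rule primes_uptoD)
      have le1: "f p \<le> 1 / real p" using fle p2 by simp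
      have "1 / real p \<le> 1" using p2 by simp
      then have "f p - f p ^ 2 \<le> ln (1 + f p)"
        using fpos[of p] p2 le1 by (intro ln_one_plus_pos_lower_bound) linarith+
      moreover have "f p ^ 2 \<le> (1 / real p) ^ 2" using le1 fpos[of p] p2 by (intro power_mono) auto
      ultimately show "f p - 1 / real p ^ 2 \<le> ln (1 + f p)" by (simp add: power_divide)
    qed
    finally have 1: "(\<Sum>p\<in>?P. f p) \<le> ln (1 + L) + 2"
      using sum_inverse_prime_squares_le[of N] by (simp add: sum_subtractf)
    have "(\<Sum>p\<in>?P. 1 / real p - f p) \<le> (\<Sum>p\<in>?P. \<epsilon> * (ln (real p) / real p))"
    proof (rule sum_mono)
      fix p assume p: "p \<in> ?P"
      then have p2: "p \<ge> 2" by (rule primes_uptoD)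
      have "1 - \<epsilon> * ln (real p) \<le> real p powr (- \<epsilon>)"
        using exp_ge_add_one_self[of "- \<epsilon> * ln (real p)"] p2 by (simp add: powr_def)
      then have "1 / real p * (1 - \<epsilon> * ln (real p)) \<le> 1 / real p * real p powr (- \<epsilon>)"
        by (intro mult_left_mono) auto
      moreover have "1 / real p * real p powr (- \<epsilon>) = f p"
        using p2 by (simp add: f_def powr_diff powr_minus field_simps)
      ultimately show "1 / real p - f p \<le> \<epsilon> * (ln (real p) / real p)"
        by (simp add: algebra_simps)
    qed
    also have "\<dots> = \<epsilon> * (\<Sum>p\<in>?P. ln (real p) / real p)" by (simp add: sum_distrib_left)
    also have "\<dots> \<le> \<epsilon> * (2 * L)"
      using sum_ln_over_prime_le[of N] N e by (intro mult_left_mono) (auto simp: L_def)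
    also have "\<dots> = 2" using L by (simp add: \<epsilon>_def)
    finally have 2: "(\<Sum>p\<in>?P. 1 / real p) \<le> ln (1 + L) + 4" using 1 by (simp add: sum_subtractf)
    have "1 + L \<le> L * (1 + 1 / ln 2)" using L by (simp add: field_simps)
    then have "ln (1 + L) \<le> ln (L * (1 + 1 / ln 2))" using L by (subst ln_le_cancel_iff) (auto intro!: mult_pos_pos add_pos_pos)
    also have "\<dots> = ln L + ln (1 + 1 / ln 2)" using L by (intro ln_mult_pos) (auto intro!: add_pos_pos)
    finally show ?thesis using 2 by (simp add: L_def)
  qed
  have "ln (1 + 1 / ln 2) \<ge> (0::real)" by (intro ln_ge_zero) auto
  with that[of "ln (1 + 1 / ln 2) + 4"] bound show ?thesis by force
qed

text \<open>
  Euler's argument: the product of the geometric series dominates the harmonic sum.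
\<close>
lemma mertens_lower:
  assumes N: "N \<ge> 2"
  shows "ln (ln (real N)) - 4 \<le> (\<Sum>p\<in>primes_upto N. 1 / real p)"
proof -
  let ?P = "primes_upto N"
  have "ln (real N) \<le> (\<Sum>n=1..N. 1 / real n)"
  proof -
    have "ln (real N) \<le> ln (real N + 1)" using N by simp
    also have "\<dots> \<le> harm N" using ln_le_harm[of N] by (simp add: add.commute)
    finally show ?thesis by (simp add: harm_def field_simps)
  qed
  also have "\<dots> \<le> (\<Sum>n\<in>smooth_numbers ?P N. 1 / real n)"
    by (rule sum_mono2) (use interval_subset_smooth_numbers in auto)
  also have "\<dots> = (\<Prod>p\<in>?P. \<Sum>k\<le>N. (1 / real p) ^ k)"
    by (rule prod_geometric_eq_sum_smooth[symmetric]) (auto dest: primes_uptoD)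
  also have "\<dots> \<le> (\<Prod>p\<in>?P. exp (1 / real p + 2 / real p ^ 2))"
  proof (intro prod_mono conjI)
    fix p assume p: "p \<in> ?P"
    then have p2: "p \<ge> 2" by (rule primes_uptoD)
    define x where "x = 1 / real p"
    have x: "0 < x" "x \<le> 1 / 2" using p2 by (auto simp: x_def)
    show "0 \<le> (\<Sum>k\<le>N. (1 / real p) ^ k)" by (intro sum_nonneg) auto
    have "(\<Sum>k\<le>N. x ^ k) = (1 - x ^ Suc N) / (1 - x)"
      using x sum_gp0[of x N] by auto
    also have "\<dots> \<le> 1 / (1 - x)" using x by (intro divide_right_mono) auto
    also have "\<dots> = exp (- ln (1 - x))" using x by (simp add: exp_minus field_simps)
    also have "\<dots> \<le> exp (x + 2 * x ^ 2)"
      using ln_one_minus_pos_lower_bound[of x] x by simp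
    finally show "(\<Sum>k\<le>N. (1 / real p) ^ k) \<le> exp (1 / real p + 2 / real p ^ 2)"
      by (simp add: x_def power_divide)
  qed
  also have "\<dots> = exp (\<Sum>p\<in>?P. 1 / real p + 2 / real p ^ 2)" by (simp add: exp_sum)
  also have "\<dots> \<le> exp ((\<Sum>p\<in>?P. 1 / real p) + 4)"
    using sum_inverse_prime_squares_le[of N] sum_distrib_left[of 2 "\<lambda>p. 1 / real p ^ 2" ?P]
    by (simp add: sum.distrib)
  finally have "ln (ln (real N)) \<le> ln (exp ((\<Sum>p\<in>?P. 1 / real p) + 4))"
    using N by (subst ln_le_cancel_iff) auto
  then show ?thesis by simp
qed

section \<open>Contractive point evaluation on the polydisc\<close>

text \<open>
  Cauchy's formula on the unit circle: since \<open>1/e = cnj e\<close> there, \<open>du/(u - s)\<close> becomes the Szego kernel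
  \<open>1 / (1 - s cnj e)\<close>. Taking the conjugate of this kernel for \<open>G\<close> gives its square norm.
\<close>
lemma cauchy_kernel_mean:
  assumes G: "continuous_on (cball 0 1) G" "G holomorphic_on ball 0 1" and s: "norm s < 1"
  shows "((\<lambda>\<theta>. G (cis (2 * pi * \<theta>)) / (1 - s * cnj (cis (2 * pi * \<theta>)))) has_integral G s) {0..1}"
proof -
  have "((\<lambda>u. G u / (u - s)) has_contour_integral (2 * of_real pi * \<i> * G s)) (circlepath 0 1)"
    using Cauchy_integral_circlepath[OF G, of s] s by (simp add: dist_norm)
  then have "((\<lambda>x. G (circlepath 0 1 x) / (circlepath 0 1 x - s) * vector_derivative (circlepath 0 1) (at x within {0..1}))
      has_integral 2 * of_real pi * \<i> * G s) {0..1}"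
    unfolding has_contour_integral_def .
  then have "((\<lambda>\<theta>. 2 * of_real pi * \<i> * (G (cis (2 * pi * \<theta>)) / (1 - s * cnj (cis (2 * pi * \<theta>)))))
      has_integral 2 * of_real pi * \<i> * G s) {0..1}"
  proof (rule has_integral_eq[rotated])
    fix x :: real assume x: "x \<in> {0..1}"
    define e where "e = cis (2 * pi * x)"
    have e: "e * cnj e = 1" "norm e = 1" by (simp_all add: e_def complex_mult_cnj)
    have ex: "exp (2 * of_real pi * \<i> * of_real x) = e"
      by (simp add: e_def cis_conv_exp mult_ac)
    have c: "circlepath 0 1 x = e" by (simp add: circlepath ex)
    have v: "vector_derivative (circlepath 0 1) (at x within {0..1}) = 2 * of_real pi * \<i> * e"
      using x vector_derivative_circlepath01[of x 0 1] by (simp add: ex)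
    have ne: "e - s \<noteq> 0" "1 - s * cnj e \<noteq> 0"
      using e(2) s by (auto simp: eq_iff_diff_eq_0[symmetric]) (metis complex_mod_cnj mult.right_neutral norm_mult norm_one less_irrefl)
    have "e / (e - s) = 1 / (1 - s * cnj e)"
      using ne e(1) by (simp add: divide_simps) (simp add: algebra_simps)
    then show "G (circlepath 0 1 x) / (circlepath 0 1 x - s) * vector_derivative (circlepath 0 1) (at x within {0..1}) =
        2 * of_real pi * \<i> * (G (cis (2 * pi * x)) / (1 - s * cnj (cis (2 * pi * x))))"
      unfolding c v e_def[symmetric] by (metis (no_types, opaque_lifting) mult.commute mult.left_commute times_divide_eq_right mult_1_right)
  qed
  from has_integral_mult_right[OF this, of "1 / (2 * of_real pi * \<i>)"] show ?thesis
    by (simp add: field_simps)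
qed

text \<open>
  The function \<open>c / (1 - s u)\<close> with \<open>c = (1 - s\<^sup>2) G(s)\<close> is the orthogonal projection of \<open>G\<close> on the span of the
  reproducing kernel at \<open>s\<close>. Expanding the square norm of the difference gives the inequality.
\<close>
lemma hardy_square_point_evaluation:
  fixes s :: real
  assumes G: "continuous_on (cball 0 1) G" "G holomorphic_on ball 0 1" and s: "0 \<le> s" "s < 1"
  shows "(1 - s\<^sup>2) * (norm (G s))\<^sup>2 \<le> integral {0..1} (\<lambda>\<theta>. (norm (G (cis (2 * pi * \<theta>))))\<^sup>2)"
proof -
  define e where "e = (\<lambda>\<theta> :: real. cis (2 * pi * \<theta>))"
  define k where "k = (\<lambda>\<theta>. 1 / (1 - of_real s * cnj (e \<theta>)))"
  define c where "c = G s * of_real (1 - s\<^sup>2)"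
  have ns: "norm (complex_of_real s) < 1" using s by simp
  have s2: "s\<^sup>2 < 1" using s by (simp add: abs_square_less_1)
  have ne: "1 - of_real s * u \<noteq> 0" if "norm u \<le> 1" for u :: complex
  proof
    assume "1 - of_real s * u = 0"
    then have "norm (of_real s * u) = 1" by (metis eq_iff_diff_eq_0 norm_one)
    then show False using mult_mono[of s s "norm u" 1] that s by (simp add: norm_mult)
  qed
  have I1: "((\<lambda>\<theta>. G (e \<theta>) * k \<theta>) has_integral G s) {0..1}"
    using cauchy_kernel_mean[OF G ns] by (simp add: e_def k_def)
  have "((\<lambda>\<theta>. 1 / (1 - of_real s * e \<theta>) / (1 - of_real s * cnj (e \<theta>))) has_integral (1 / (1 - of_real s * of_real s))) {0..1}"
    unfolding e_def
    by (rule cauchy_kernel_mean[of "\<lambda>u. 1 / (1 - of_real s * u)", OF _ _ ns])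
       (use ne in \<open>force intro!: continuous_intros holomorphic_intros\<close>)+
  moreover have "1 / (1 - of_real s * e \<theta>) / (1 - of_real s * cnj (e \<theta>)) = of_real ((norm (k \<theta>))\<^sup>2)" for \<theta>
    unfolding k_def by (simp only: complex_norm_square) simp
  ultimately have "((\<lambda>\<theta>. complex_of_real ((norm (k \<theta>))\<^sup>2)) has_integral (1 / (1 - of_real s * of_real s))) {0..1}"
    by simp
  from has_integral_Re[OF this] have I2: "((\<lambda>\<theta>. (norm (k \<theta>))\<^sup>2) has_integral 1 / (1 - s\<^sup>2)) {0..1}"
    by (simp add: power2_eq_square flip: of_real_mult of_real_diff of_real_divide)
  have ce: "continuous_on {0..1} (\<lambda>\<theta>. G (e \<theta>))"
    unfolding e_def by (rule continuous_on_compose2[OF G(1)]) (auto intro!: continuous_intros)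
  define A where "A = integral {0..1} (\<lambda>\<theta>. (norm (G (e \<theta>)))\<^sup>2)"
  have I0: "((\<lambda>\<theta>. (norm (G (e \<theta>)))\<^sup>2) has_integral A) {0..1}"
    unfolding A_def by (intro integrable_integral integrable_continuous_real continuous_intros ce)
  have ex: "(norm (G (e \<theta>) - c * cnj (k \<theta>)))\<^sup>2
      = (norm (G (e \<theta>)))\<^sup>2 - 2 * Re (cnj c * (G (e \<theta>) * k \<theta>)) + (norm c)\<^sup>2 * (norm (k \<theta>))\<^sup>2" for \<theta>
  proof -
    have "(norm (a - b))\<^sup>2 = (norm a)\<^sup>2 - 2 * Re (cnj b * a) + (norm b)\<^sup>2" for a b :: complex
      unfolding cmod_power2 by (simp add: power2_eq_square algebra_simps)
    from this[of "G (e \<theta>)" "c * cnj (k \<theta>)"] show ?thesis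
      by (simp add: norm_mult power_mult_distrib mult_ac)
  qed
  have "((\<lambda>\<theta>. (norm (G (e \<theta>) - c * cnj (k \<theta>)))\<^sup>2) has_integral
       A - 2 * Re (cnj c * G s) + (norm c)\<^sup>2 * (1 / (1 - s\<^sup>2))) {0..1}"
    unfolding ex
    by (intro has_integral_add has_integral_diff has_integral_mult_right I0 I2 has_integral_Re I1)
  then have "0 \<le> A - 2 * Re (cnj c * G s) + (norm c)\<^sup>2 * (1 / (1 - s\<^sup>2))"
    by (rule has_integral_nonneg) auto
  moreover have "Re (cnj c * G s) = (1 - s\<^sup>2) * (norm (G s))\<^sup>2"
    unfolding c_def cmod_power2 by (simp add: power2_eq_square algebra_simps)
  moreover have "(norm c)\<^sup>2 * (1 / (1 - s\<^sup>2)) = (1 - s\<^sup>2) * (norm (G s))\<^sup>2"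
    unfolding c_def using s2 by (simp add: norm_mult power2_eq_square field_simps abs_if del: of_real_diff of_real_power)
  ultimately show ?thesis unfolding A_def e_def by simp
qed

text \<open>
  A zero-free \<open>p\<close> has a holomorphic power \<open>F = p\<^bsup>q/2\<^esup>\<close>, and \<open>|F|\<^sup>2 = |p|\<^sup>q\<close>. Zeros on the unit circle are
  allowed, so the square case is used on circles of radius \<open>\<rho> < 1\<close>, followed by \<open>\<rho> \<rightarrow> 1\<close>.
\<close>
lemma zero_free_point_evaluation:
  fixes r q :: real
  assumes p: "\<And>z. norm z < 1 \<Longrightarrow> poly p z \<noteq> 0" and q: "q > 0" and r: "0 \<le> r" "r < 1"
  shows "(1 - r\<^sup>2) * norm (poly p (of_real r)) powr q \<le> integral {0..1} (\<lambda>\<theta>. norm (poly p (cis (2 * pi * \<theta>))) powr q)"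
proof -
  obtain L where L: "L holomorphic_on ball 0 1" "\<And>z. z \<in> ball 0 1 \<Longrightarrow> exp (L z) = poly p z"
    by (rule holomorphic_logarithm_exists[of "ball 0 1" "poly p" 0]) (use p in \<open>auto intro!: holomorphic_intros\<close>)
  define F where "F = (\<lambda>z. exp (of_real (q / 2) * L z))"
  have F: "F holomorphic_on ball 0 1" unfolding F_def by (intro holomorphic_intros L)
  have nF: "(norm (F z))\<^sup>2 = norm (poly p z) powr q" if "norm z < 1" for z
  proof -
    have "norm (poly p z) = exp (Re (L z))" using L(2)[of z] that by (metis mem_ball_0 norm_exp_eq_Re)
    then have "norm (poly p z) powr q = exp (q * Re (L z))" by (simp add: powr_def)
    also have "\<dots> = (norm (F z))\<^sup>2" by (simp add: F_def power2_eq_square flip: exp_add)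
    finally show ?thesis ..
  qed
  define J where "J = (\<lambda>\<rho> :: real. integral {0..1} (\<lambda>\<theta>. norm (poly p (of_real \<rho> * cis (2 * pi * \<theta>))) powr q))"
  have "continuous_on UNIV J"
    unfolding J_def box_real[symmetric]
    by (rule integral_continuous_on_param) (use q in \<open>auto simp: split_beta intro!: continuous_intros continuous_on_powr'\<close>)
  then have "(J \<longlongrightarrow> J 1) (at 1)" by (simp add: continuous_on_def)
  then have J: "(J \<longlongrightarrow> J 1) (at_left 1)" by (rule filterlim_mono) (auto simp: at_within_le_at)
  have "((\<lambda>\<rho>. (1 - (r / \<rho>)\<^sup>2) * norm (poly p (of_real r)) powr q) \<longlongrightarrow> (1 - (r / 1)\<^sup>2) * norm (poly p (of_real r)) powr q) (at_left 1)"
    by (intro tendsto_intros) auto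
  moreover have "\<forall>\<^sub>F \<rho> in at_left 1. (1 - (r / \<rho>)\<^sup>2) * norm (poly p (of_real r)) powr q \<le> J \<rho>"
    using eventually_at_left_real[OF r(2)]
  proof eventually_elim
    case (elim \<rho>)
    then have \<rho>: "r < \<rho>" "\<rho> < 1" "0 < \<rho>" using r by auto
    define G where "G = (\<lambda>w. F (of_real \<rho> * w))"
    have le1: "norm (of_real \<rho> * w) < 1" if "norm w \<le> 1" for w :: complex
    proof -
      have "\<rho> * norm w \<le> \<rho> * 1" using that \<rho> by (intro mult_left_mono) auto
      then have "\<rho> * norm w < 1" using \<rho> by linarith
      then show ?thesis using \<rho> by (simp add: norm_mult)
    qed
    have "G holomorphic_on cball 0 1"
      unfolding G_def by (rule holomorphic_on_compose_gen[OF _ F, unfolded o_def])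
         (use le1 in \<open>auto intro!: holomorphic_intros\<close>)
    then have "continuous_on (cball 0 1) G" "G holomorphic_on ball 0 1"
      by (auto intro: holomorphic_on_imp_continuous_on holomorphic_on_subset)
    from hardy_square_point_evaluation[OF this, of "r / \<rho>"] r \<rho>
    have "(1 - (r / \<rho>)\<^sup>2) * (norm (G (of_real (r / \<rho>))))\<^sup>2 \<le> integral {0..1} (\<lambda>\<theta>. (norm (G (cis (2 * pi * \<theta>))))\<^sup>2)"
      by simp
    also have "G (of_real (r / \<rho>)) = F (of_real r)" using \<rho> by (simp add: G_def)
    also have "(norm (F (of_real r)))\<^sup>2 = norm (poly p (of_real r)) powr q" using r by (intro nF) auto
    also have "integral {0..1} (\<lambda>\<theta>. (norm (G (cis (2 * pi * \<theta>))))\<^sup>2) = J \<rho>"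
      unfolding J_def G_def by (intro integral_cong nF le1) auto
    finally show ?case .
  qed
  ultimately have "(1 - (r / 1)\<^sup>2) * norm (poly p (of_real r)) powr q \<le> J 1"
    using J by (intro tendsto_le[of "at_left (1 :: real)"]) auto
  then show ?thesis by (simp add: J_def)
qed

text \<open>
  Replacing a factor \<open>z - a\<close> with \<open>|a| < 1\<close> by \<open>1 - cnj a z\<close> divides by a Blaschke factor: this changes nothing on the
  circle and increases the modulus inside.
\<close>
lemma reflect_zeros:
  fixes A :: "complex multiset"
  assumes r: "norm r < 1"
  shows "\<exists>g. (\<forall>z. norm z < 1 \<longrightarrow> poly g z \<noteq> 0) \<and>
      (\<forall>z. norm z = 1 \<longrightarrow> norm (poly g z) = norm (poly (\<Prod>x\<in>#A. [:-x, 1:]) z)) \<and>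
      norm (poly (\<Prod>x\<in>#A. [:-x, 1:]) r) \<le> norm (poly g r)"
proof (induction A)
  case empty
  show ?case by (intro exI[of _ 1]) auto
next
  case (add a A)
  then obtain g where g: "\<And>z. norm z < 1 \<Longrightarrow> poly g z \<noteq> 0"
    "\<And>z. norm z = 1 \<Longrightarrow> norm (poly g z) = norm (poly (\<Prod>x\<in>#A. [:-x, 1:]) z)"
    "norm (poly (\<Prod>x\<in>#A. [:-x, 1:]) r) \<le> norm (poly g r)" by blast
  show ?case
  proof (cases "norm a < 1")
    case False
    have "z \<noteq> a" if "norm z < 1" for z using that False by auto
    moreover have "poly ([:-a, 1:] * h) z = (z - a) * poly h z" for z h by (simp add: algebra_simps)
    ultimately show ?thesis using g
      by (intro exI[of _ "[:-a, 1:] * g"])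
         (auto simp: norm_mult simp del: mult_pCons_left poly_mult poly_pCons intro!: mult_left_mono)
  next
    case True
    have id: "(norm (1 - cnj a * z))\<^sup>2 - (norm (z - a))\<^sup>2 = (1 - (norm a)\<^sup>2) * (1 - (norm z)\<^sup>2)" for z
      unfolding cmod_power2 by (simp add: power2_eq_square algebra_simps)
    have a2: "(norm a)\<^sup>2 < 1" using True by (simp add: abs_square_less_1)
    have 1: "norm (1 - cnj a * z) = norm (z - a)" if "norm z = 1" for z
      using id[of z] that by simp
    have "(norm (r - a))\<^sup>2 \<le> (norm (1 - cnj a * r))\<^sup>2"
    proof -
      have "0 \<le> (1 - (norm a)\<^sup>2) * (1 - (norm r)\<^sup>2)" using True r by (intro mult_nonneg_nonneg) (auto simp: abs_square_le_1)
      then show ?thesis using id[of r] by linarith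
    qed
    then have 2: "norm (r - a) \<le> norm (1 - cnj a * r)" by (rule power2_le_imp_le) simp
    have 3: "1 - cnj a * z \<noteq> 0" if "norm z < 1" for z
    proof
      assume "1 - cnj a * z = 0"
      then have "norm (cnj a * z) = 1" by (metis eq_iff_diff_eq_0 norm_one)
      moreover have "norm a * norm z < 1" using True that by (metis mult_strict_mono' norm_ge_zero mult_1)
      ultimately show False by (simp add: norm_mult)
    qed
    have e: "poly ([:1, - cnj a:] * g) z = (1 - cnj a * z) * poly g z" for z by (simp add: algebra_simps)
    have e': "poly (\<Prod>x\<in>#add_mset a A. [:-x, 1:]) z = (z - a) * poly (\<Prod>x\<in>#A. [:-x, 1:]) z" for z by (simp add: algebra_simps)
    show ?thesis
    proof (intro exI[of _ "[:1, - cnj a:] * g"] conjI allI impI)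
      show "poly ([:1, - cnj a:] * g) z \<noteq> 0" if "norm z < 1" for z unfolding e using 3[OF that] g(1)[OF that] by simp
      show "norm (poly ([:1, - cnj a:] * g) z) = norm (poly (\<Prod>x\<in>#add_mset a A. [:-x, 1:]) z)" if "norm z = 1" for z
        unfolding e e' norm_mult using 1[OF that] g(2)[OF that] by simp
      show "norm (poly (\<Prod>x\<in>#add_mset a A. [:-x, 1:]) r) \<le> norm (poly ([:1, - cnj a:] * g) r)"
        unfolding e e' norm_mult using 2 g(3) by (intro mult_mono) auto
    qed
  qed
qed

lemma poly_point_evaluation:
  fixes r q :: real
  assumes q: "q > 0" and r: "0 \<le> r" "r < 1"
  shows "(1 - r\<^sup>2) * norm (poly p (of_real r)) powr q \<le> integral {0..1} (\<lambda>\<theta>. norm (poly p (cis (2 * pi * \<theta>))) powr q)"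
proof (cases "p = 0")
  case True
  then show ?thesis using q by simp
next
  case False
  obtain A where A: "p = smult (lead_coeff p) (\<Prod>x\<in>#A. [:-x, 1:])"
    using alg_closed_imp_factorization[OF False] by blast
  obtain g where g: "\<And>z. norm z < 1 \<Longrightarrow> poly g z \<noteq> 0"
      "\<And>z. norm z = 1 \<Longrightarrow> norm (poly g z) = norm (poly (\<Prod>x\<in>#A. [:-x, 1:]) z)"
      "norm (poly (\<Prod>x\<in>#A. [:-x, 1:]) (of_real r)) \<le> norm (poly g (of_real r))"
    using reflect_zeros[of "of_real r" A] r by auto
  define h where "h = smult (lead_coeff p) g"
  have 1: "norm (poly h z) = norm (poly p z)" if "norm z = 1" for z
    using g(2)[OF that] by (subst A) (simp add: h_def norm_mult)
  have 2: "norm (poly p (of_real r)) \<le> norm (poly h (of_real r))"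
    using g(3) by (subst A) (simp add: h_def norm_mult mult_left_mono)
  have s2: "r\<^sup>2 < 1" using r by (simp add: abs_square_less_1)
  have "(1 - r\<^sup>2) * norm (poly p (of_real r)) powr q \<le> (1 - r\<^sup>2) * norm (poly h (of_real r)) powr q"
    using 2 q s2 by (intro mult_left_mono powr_mono2) auto
  also have "\<dots> \<le> integral {0..1} (\<lambda>\<theta>. norm (poly h (cis (2 * pi * \<theta>))) powr q)"
    by (rule zero_free_point_evaluation[OF _ q r]) (use g(1) False in \<open>auto simp: h_def\<close>)
  also have "\<dots> = integral {0..1} (\<lambda>\<theta>. norm (poly p (cis (2 * pi * \<theta>))) powr q)"
    by (simp add: 1)
  finally show ?thesis .
qed

section \<open>The Bohr correspondence\<close>

text \<open>
  Moments are handled as functions of \<open>|f|\<^sup>2\<close>, which, unlike \<open>|f|\<close>, is again a trigonometric polynomial.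
\<close>
lemma square_powr_half:
  fixes w :: real
  assumes "w \<ge> 0"
  shows "(w\<^sup>2) powr (q / 2) = w powr q"
proof (cases "w = 0")
  case False
  then have "w\<^sup>2 = w powr 2" using assms by (simp add: powr_numeral)
  then show ?thesis by (simp add: powr_powr)
qed simp

text \<open>
  The circle is parametrised by angles in \<open>[0, 1]\<close>, so that every point of the product space, and not only almost
  every one, gives coordinates of modulus one.
\<close>
definition circle_measure :: "real measure" where
  "circle_measure = density lborel (\<lambda>x. ennreal (indicator {0..1} x))"

definition torus :: "nat set \<Rightarrow> (nat \<Rightarrow> real) measure" where
  "torus P = Pi\<^sub>M P (\<lambda>_. circle_measure)"

definition unit_point :: "(nat \<Rightarrow> real) \<Rightarrow> nat \<Rightarrow> complex" where
  "unit_point \<omega> = (\<lambda>p. cis (2 * pi * \<omega> p))"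

definition kronecker_flow :: "real \<Rightarrow> nat \<Rightarrow> complex" where
  "kronecker_flow t = (\<lambda>p. cis (- (t * ln (real p))))"

lemma sets_circle_measure [measurable_cong, simp]: "sets circle_measure = sets borel"
  by (simp add: circle_measure_def)

lemma space_circle_measure [simp]: "space circle_measure = UNIV"
  by (simp add: circle_measure_def)

lemma prob_space_circle_measure: "prob_space circle_measure"
proof (rule prob_spaceI)
  have "emeasure circle_measure UNIV = (\<integral>\<^sup>+ x. indicator {0..1::real} x \<partial>lborel)"
    unfolding circle_measure_def by (subst emeasure_density) (simp_all add: ennreal_indicator)
  then show "emeasure circle_measure (space circle_measure) = 1" by simp
qed

lemma circle_integral:
  fixes f :: "real \<Rightarrow> 'b::euclidean_space"
  assumes f: "continuous_on UNIV f"
  shows "integrable circle_measure f" "integral\<^sup>L circle_measure f = integral {0..1} f"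
proof -
  have m: "f \<in> borel_measurable lborel" using f by (simp add: borel_measurable_continuous_onI)
  have s: "set_integrable lborel {0..1} f"
    using f by (intro borel_integrable_atLeastAtMost') (auto intro: continuous_on_subset)
  show "integrable circle_measure f"
    unfolding circle_measure_def using m s by (subst integrable_density) (auto simp: set_integrable_def)
  have "integral\<^sup>L circle_measure f = (LINT x:{0..1}|lborel. f x)"
    unfolding circle_measure_def set_lebesgue_integral_def using m by (subst integral_density) auto
  then show "integral\<^sup>L circle_measure f = integral {0..1} f"
    using set_borel_integral_eq_integral(2)[OF s] by simp
qed

lemma product_prob_space_circle: "product_prob_space (\<lambda>_ :: nat. circle_measure)"
proof -
  interpret prob_space circle_measure by (rule prob_space_circle_measure)
  show ?thesis by unfold_locales
qed

lemma prob_space_torus: "prob_space (torus P)"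
  unfolding torus_def by (intro prob_space_PiM prob_space_circle_measure)

lemma has_integral_cis:
  fixes \<mu> T :: real
  assumes "\<mu> \<noteq> 0" "T \<ge> 0"
  shows "((\<lambda>t. cis (\<mu> * t)) has_integral (cis (\<mu> * T) - 1) / (\<i> * of_real \<mu>)) {0..T}"
proof -
  have "((\<lambda>t. cis (\<mu> * t) / (\<i> * of_real \<mu>)) has_vector_derivative cis (\<mu> * t)) (at t within {0..T})" for t
  proof -
    have "((\<lambda>z. exp (\<i> * of_real \<mu> * z) / (\<i> * of_real \<mu>)) has_field_derivative exp (\<i> * of_real \<mu> * of_real t)) (at (of_real t))"
      using assms by (auto intro!: derivative_eq_intros)
    then have "((\<lambda>t. exp (\<i> * of_real \<mu> * of_real t) / (\<i> * of_real \<mu>)) has_vector_derivative exp (\<i> * of_real \<mu> * of_real t)) (at t)"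
      by (rule has_vector_derivative_real_field)
    then show ?thesis
      by (auto simp: cis_conv_exp mult_ac intro: has_vector_derivative_at_within)
  qed
  from fundamental_theorem_of_calculus[OF assms(2) this]
  show ?thesis by (simp add: diff_divide_distrib)
qed

lemma cis_mean_tendsto_0:
  fixes \<mu> :: real
  assumes "\<mu> \<noteq> 0"
  shows "((\<lambda>T. integral {0..T} (\<lambda>t. cis (\<mu> * t)) / of_real T) \<longlongrightarrow> 0) at_top"
proof (rule Lim_null_comparison)
  show "\<forall>\<^sub>F T in at_top. norm (integral {0..T} (\<lambda>t. cis (\<mu> * t)) / of_real T) \<le> 2 / \<bar>\<mu>\<bar> / T"
    using eventually_gt_at_top[of 0]
  proof eventually_elim
    case (elim T)
    have "norm (cis (\<mu> * T) - 1) \<le> 2" using norm_triangle_ineq4[of "cis (\<mu> * T)" 1] by simp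
    then show ?case using elim integral_unique[OF has_integral_cis[OF assms, of T]] assms
      by (simp add: norm_divide norm_mult divide_right_mono)
  qed
  show "((\<lambda>T. 2 / \<bar>\<mu>\<bar> / T) \<longlongrightarrow> 0) at_top"
    by (intro tendsto_divide_0[OF tendsto_const] filterlim_at_top_imp_at_infinity filterlim_ident)
qed

lemma circle_integral_monomial:
  "integral\<^sup>L circle_measure (\<lambda>\<theta>. cis (2 * pi * \<theta>) ^ u * cnj (cis (2 * pi * \<theta>)) ^ v) = (if u = v then 1 else 0)"
proof -
  have e: "cis (2 * pi * \<theta>) ^ u * cnj (cis (2 * pi * \<theta>)) ^ v = cis (2 * pi * (real u - real v) * \<theta>)" for \<theta>
    unfolding cis_cnj Complex.DeMoivre cis_mult by (simp add: algebra_simps)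
  have "integral\<^sup>L circle_measure (\<lambda>\<theta>. cis (2 * pi * (real u - real v) * \<theta>))
     = integral {0..1} (\<lambda>\<theta>. cis (2 * pi * (real u - real v) * \<theta>))"
    by (rule circle_integral) (auto intro!: continuous_intros)
  also have "\<dots> = (if u = v then 1 else 0)"
  proof (cases "u = v")
    case False
    then have "integral {0..1} (\<lambda>\<theta>. cis (2 * pi * (real u - real v) * \<theta>))
       = (cis (2 * pi * (real u - real v) * 1) - 1) / (\<i> * of_real (2 * pi * (real u - real v)))"
      by (intro integral_unique has_integral_cis) auto
    moreover have "cis (2 * pi * (real u - real v)) = 1"
      using cis_multiple_2pi[of "real u - real v"] by (auto simp: mult_ac)
    ultimately show ?thesis using False by simp
  qed simp
  finally show ?thesis by (simp add: e)
qed

text \<open>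
  The conjugates are kept as separate factors instead of negative powers, which makes the span of the monomials
  closed under products and conjugation for arbitrary arguments.
\<close>
inductive trig_poly :: "nat set \<Rightarrow> ((nat \<Rightarrow> complex) \<Rightarrow> complex) \<Rightarrow> bool" for P where
  monomial: "trig_poly P (\<lambda>z. c * (\<Prod>p\<in>P. z p ^ u p * cnj (z p) ^ v p))"
| add: "trig_poly P f \<Longrightarrow> trig_poly P g \<Longrightarrow> trig_poly P (\<lambda>z. f z + g z)"

lemma trig_poly_const: "trig_poly P (\<lambda>z. c)"
  using trig_poly.monomial[of P c "\<lambda>_. 0" "\<lambda>_. 0"] by simp

lemma trig_poly_coordinate:
  assumes "finite P" "p \<in> P"
  shows "trig_poly P (\<lambda>z. z p)"
proof -
  have "(\<Prod>p'\<in>P. z p' ^ (if p' = p then 1 else 0)) = z p" for z :: "nat \<Rightarrow> complex"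
    using assms by (simp add: if_distrib[of "(^) _"] prod.delta cong: if_cong)
  then show ?thesis
    using trig_poly.monomial[of P 1 "\<lambda>p'. if p' = p then 1 else 0" "\<lambda>_. 0"] by simp
qed

lemma trig_poly_mult:
  assumes "trig_poly P f" "trig_poly P g"
  shows "trig_poly P (\<lambda>z. f z * g z)"
  using assms(1)
proof induction
  case (monomial c u v)
  from assms(2) show ?case
  proof induction
    case (monomial c' u' v')
    have "(\<lambda>z :: nat \<Rightarrow> complex. c * (\<Prod>p\<in>P. z p ^ u p * cnj (z p) ^ v p) * (c' * (\<Prod>p\<in>P. z p ^ u' p * cnj (z p) ^ v' p)))
      = (\<lambda>z. (c * c') * (\<Prod>p\<in>P. z p ^ (u p + u' p) * cnj (z p) ^ (v p + v' p)))"
      by (simp add: power_add prod.distrib mult_ac)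
    then show ?case using trig_poly.monomial[of P "c * c'" "\<lambda>p. u p + u' p" "\<lambda>p. v p + v' p"] by simp
  next
    case (add f g)
    then show ?case using trig_poly.add[OF add.IH] by (simp add: distrib_left)
  qed
next
  case (add f g)
  then show ?case using trig_poly.add[OF add.IH] by (simp add: distrib_right)
qed

lemma trig_poly_cnj:
  assumes "trig_poly P f"
  shows "trig_poly P (\<lambda>z. cnj (f z))"
  using assms
proof induction
  case (monomial c u v)
  have "(\<lambda>z :: nat \<Rightarrow> complex. cnj (c * (\<Prod>p\<in>P. z p ^ u p * cnj (z p) ^ v p)))
      = (\<lambda>z. cnj c * (\<Prod>p\<in>P. z p ^ v p * cnj (z p) ^ u p))"
    by (simp add: mult_ac)
  then show ?case using trig_poly.monomial[of P "cnj c" v u] by simp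
next
  case (add f g)
  then show ?case using trig_poly.add[OF add.IH] by simp
qed

lemma trig_poly_sum: "(\<And>i. i \<in> I \<Longrightarrow> trig_poly P (f i)) \<Longrightarrow> trig_poly P (\<lambda>z. \<Sum>i\<in>I. f i z)"
  by (induction I rule: infinite_finite_induct) (auto intro: trig_poly_const trig_poly.add)

lemma trig_poly_power: "trig_poly P f \<Longrightarrow> trig_poly P (\<lambda>z. f z ^ k)"
  by (induction k) (auto intro: trig_poly_const trig_poly_mult)

lemma trig_poly_prod: "(\<And>i. i \<in> I \<Longrightarrow> trig_poly P (f i)) \<Longrightarrow> trig_poly P (\<lambda>z. \<Prod>i\<in>I. f i z)"
  by (induction I rule: infinite_finite_induct) (auto intro: trig_poly_const trig_poly_mult)

lemma trig_poly_bounded: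
  assumes "trig_poly P f"
  shows "\<exists>R\<ge>0. \<forall>z. (\<forall>p. norm (z p) = 1) \<longrightarrow> norm (f z) \<le> R"
  using assms
proof induction
  case (monomial c u v)
  have "norm (c * (\<Prod>p\<in>P. z p ^ u p * cnj (z p) ^ v p)) = norm c" if "\<forall>p. norm (z p) = 1" for z :: "nat \<Rightarrow> complex"
    using that by (simp add: norm_mult norm_power prod_norm[symmetric])
  then show ?case by (intro exI[of _ "norm c"]) auto
next
  case (add f g)
  then obtain R R' where R: "R \<ge> 0" "R' \<ge> 0" "\<And>z. (\<forall>p. norm (z p) = 1) \<Longrightarrow> norm (f z) \<le> R"
    "\<And>z. (\<forall>p. norm (z p) = 1) \<Longrightarrow> norm (g z) \<le> R'" by blast
  have "norm (f z + g z) \<le> R + R'" if "\<forall>p. norm (z p) = 1" for z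
    using R(3)[OF that] R(4)[OF that] by (rule norm_triangle_mono)
  then show ?case using R by (intro exI[of _ "R + R'"]) auto
qed

lemma trig_poly_flow_continuous: "trig_poly P f \<Longrightarrow> continuous_on S (\<lambda>t. f (kronecker_flow t))"
  by (induction rule: trig_poly.induct) (auto simp: kronecker_flow_def intro!: continuous_intros)

lemma trig_poly_integrable:
  assumes "finite P" "trig_poly P f"
  shows "integrable (torus P) (\<lambda>\<omega>. f (unit_point \<omega>))"
  using assms(2)
proof induction
  case (monomial c u v)
  interpret product_prob_space "\<lambda>_ :: nat. circle_measure" by (rule product_prob_space_circle)
  have "integrable (torus P) (\<lambda>\<omega>. \<Prod>p\<in>P. cis (2 * pi * \<omega> p) ^ u p * cnj (cis (2 * pi * \<omega> p)) ^ v p)"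
    unfolding torus_def
    by (rule product_integrable_prod[OF assms(1), of "\<lambda>p \<theta>. cis (2 * pi * \<theta>) ^ u p * cnj (cis (2 * pi * \<theta>)) ^ v p"])
       (auto intro!: circle_integral continuous_intros)
  then show ?case unfolding unit_point_def by (rule integrable_mult_right)
qed auto

text \<open>
  The logarithms of the primes are linearly independent over the rationals, by unique factorisation. This is why the
  flow equidistributes on the torus.
\<close>
lemma sum_ln_eq_imp_exponents_eq:
  fixes u v :: "nat \<Rightarrow> nat"
  assumes P: "finite P" "\<And>p. p \<in> P \<Longrightarrow> prime p"
    and eq: "(\<Sum>p\<in>P. real (u p) * ln (real p)) = (\<Sum>p\<in>P. real (v p) * ln (real p))" and p: "p \<in> P"
  shows "u p = v p"
proof -
  have l: "ln (real (\<Prod>p\<in>P. p ^ w p)) = (\<Sum>p\<in>P. real (w p) * ln (real p))" for w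
  proof -
    have nz: "real p \<noteq> 0" "real p > 0" if "p \<in> P" for p using P(2)[OF that] prime_gt_0_nat[of p] by auto
    have "ln (real (\<Prod>p\<in>P. p ^ w p)) = ln (\<Prod>p\<in>P. real p ^ w p)" by simp
    also have "\<dots> = (\<Sum>p\<in>P. ln (real p ^ w p))" using P(1) nz by (intro ln_prod) auto
    also have "\<dots> = (\<Sum>p\<in>P. real (w p) * ln (real p))" using nz by (simp add: ln_realpow)
    finally show ?thesis .
  qed
  have pos: "real (\<Prod>p\<in>P. p ^ w p) > 0" for w :: "nat \<Rightarrow> nat"
    using P(2) by (simp only: of_nat_0_less_iff) (intro prod_pos zero_less_power prime_gt_0_nat)
  have "ln (real (\<Prod>p\<in>P. p ^ u p)) = ln (real (\<Prod>p\<in>P. p ^ v p))" unfolding l eq ..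
  then have "real (\<Prod>p\<in>P. p ^ u p) = real (\<Prod>p\<in>P. p ^ v p)" using pos by (simp only: ln_inj_iff)
  then have "(\<Prod>p\<in>P. p ^ u p) = (\<Prod>p\<in>P. p ^ v p)" by (simp only: of_nat_eq_iff)
  then show ?thesis
    using multiplicity_prod_prime_powers[of P p u] multiplicity_prod_prime_powers[of P p v] P p by simp
qed

text \<open>
  On a monomial the flow is \<open>cis (\<mu> t)\<close>, whose mean is \<open>0\<close> unless \<open>\<mu> = 0\<close>; by independence of the logarithms
  \<open>\<mu>\<close> vanishes only when the exponents agree, which is also when the torus integral does not vanish.
\<close>
lemma trig_poly_mean:
  assumes P: "finite P" "\<And>p. p \<in> P \<Longrightarrow> prime p" and f: "trig_poly P f"
  shows "((\<lambda>T. integral {0..T} (\<lambda>t. f (kronecker_flow t)) / of_real T) \<longlongrightarrow> (\<integral>\<omega>. f (unit_point \<omega>) \<partial>torus P)) at_top"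
  using f
proof induction
  case (monomial c u v)
  note finP = P(1) and primeP = P(2)
  interpret product_prob_space "\<lambda>_ :: nat. circle_measure" by (rule product_prob_space_circle)
  define \<mu> where "\<mu> = (\<Sum>p\<in>P. real (v p) * ln (real p)) - (\<Sum>p\<in>P. real (u p) * ln (real p))"
  have "(\<Prod>p\<in>Q. cis (- (t * ln (real p))) ^ u p * cnj (cis (- (t * ln (real p)))) ^ v p)
     = cis (((\<Sum>p\<in>Q. real (v p) * ln (real p)) - (\<Sum>p\<in>Q. real (u p) * ln (real p))) * t)" if "finite Q" for Q t
    using that
  proof induction
    case (insert x F)
    have "cis (- (t * ln (real x))) ^ u x * cnj (cis (- (t * ln (real x)))) ^ v x
        = cis ((real (v x) * ln (real x) - real (u x) * ln (real x)) * t)"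
      unfolding cis_cnj Complex.DeMoivre cis_mult by (simp add: algebra_simps)
    then show ?case using insert by (simp add: cis_mult algebra_simps)
  qed simp
  from this[OF finP] have fl: "(\<Prod>p\<in>P. kronecker_flow t p ^ u p * cnj (kronecker_flow t p) ^ v p) = cis (\<mu> * t)" for t
    by (simp add: kronecker_flow_def \<mu>_def)
  have "(\<integral>\<omega>. (\<Prod>p\<in>P. unit_point \<omega> p ^ u p * cnj (unit_point \<omega> p) ^ v p) \<partial>torus P)
    = (\<Prod>p\<in>P. integral\<^sup>L circle_measure (\<lambda>\<theta>. cis (2 * pi * \<theta>) ^ u p * cnj (cis (2 * pi * \<theta>)) ^ v p))"
    unfolding torus_def unit_point_def
    by (rule product_integral_prod[OF finP, of "\<lambda>p \<theta>. cis (2 * pi * \<theta>) ^ u p * cnj (cis (2 * pi * \<theta>)) ^ v p"])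
       (auto intro!: circle_integral continuous_intros)
  also have "\<dots> = (if \<forall>p\<in>P. u p = v p then 1 else 0)"
    unfolding circle_integral_monomial using finP by (auto simp: prod_zero_iff)
  also have "(\<forall>p\<in>P. u p = v p) \<longleftrightarrow> \<mu> = 0"
    using sum_ln_eq_imp_exponents_eq[OF finP primeP, of u v] by (auto simp: \<mu>_def)
  finally have I: "(\<integral>\<omega>. c * (\<Prod>p\<in>P. unit_point \<omega> p ^ u p * cnj (unit_point \<omega> p) ^ v p) \<partial>torus P) = c * (if \<mu> = 0 then 1 else 0)"
    by simp
  have "((\<lambda>T. c * (integral {0..T} (\<lambda>t. cis (\<mu> * t)) / of_real T)) \<longlongrightarrow> c * (if \<mu> = 0 then 1 else 0)) at_top"
  proof (intro tendsto_mult tendsto_const)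
    show "((\<lambda>T. integral {0..T} (\<lambda>t. cis (\<mu> * t)) / of_real T) \<longlongrightarrow> (if \<mu> = 0 then 1 else 0)) at_top"
    proof (cases "\<mu> = 0")
      case True
      have "\<forall>\<^sub>F T in at_top. integral {0..T} (\<lambda>t. cis (\<mu> * t)) / of_real T = 1"
        using eventually_gt_at_top[of 0] by eventually_elim (simp add: True scaleR_conv_of_real)
      then show ?thesis using True by (simp add: tendsto_eventually)
    qed (use cis_mean_tendsto_0 in auto)
  qed
  then show ?case unfolding I fl by simp
next
  case (add f g)
  have "((\<lambda>T. integral {0..T} (\<lambda>t. f (kronecker_flow t)) / of_real T + integral {0..T} (\<lambda>t. g (kronecker_flow t)) / of_real T)
     \<longlongrightarrow> (\<integral>\<omega>. f (unit_point \<omega>) \<partial>torus P) + (\<integral>\<omega>. g (unit_point \<omega>) \<partial>torus P)) at_top"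
    by (intro tendsto_add add.IH)
  also have "(\<integral>\<omega>. f (unit_point \<omega>) \<partial>torus P) + (\<integral>\<omega>. g (unit_point \<omega>) \<partial>torus P) = (\<integral>\<omega>. f (unit_point \<omega>) + g (unit_point \<omega>) \<partial>torus P)"
    using add.hyps trig_poly_integrable[OF P(1)] by simp
  also have "(\<lambda>T. integral {0..T} (\<lambda>t. f (kronecker_flow t)) / of_real T + integral {0..T} (\<lambda>t. g (kronecker_flow t)) / of_real T)
     = (\<lambda>T. integral {0..T} (\<lambda>t. f (kronecker_flow t) + g (kronecker_flow t)) / of_real T)"
    using add.hyps by (simp add: integral_add integrable_continuous_real trig_poly_flow_continuous add_divide_distrib)
  finally show ?case .
qed

lemma norm_kronecker_flow [simp]: "norm (kronecker_flow t p) = 1"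
  by (simp add: kronecker_flow_def)

lemma norm_unit_point [simp]: "norm (unit_point \<omega> p) = 1"
  by (simp add: unit_point_def)

text \<open>
  Equidistribution passes from polynomials in \<open>|f|\<^sup>2\<close> to continuous functions of it by uniform approximation
  (Weierstrass) on the range of \<open>|f|\<^sup>2\<close>. This needs even moments only.
\<close>
lemma continuous_mean:
  fixes g :: "real \<Rightarrow> real"
  assumes P: "finite P" "\<And>p. p \<in> P \<Longrightarrow> prime p" and f: "trig_poly P f" and g: "continuous_on {0..} g"
  shows "integrable (torus P) (\<lambda>\<omega>. g ((norm (f (unit_point \<omega>)))\<^sup>2))"
    and "((\<lambda>T. integral {0..T} (\<lambda>t. g ((norm (f (kronecker_flow t)))\<^sup>2)) / T)
        \<longlongrightarrow> (\<integral>\<omega>. g ((norm (f (unit_point \<omega>)))\<^sup>2) \<partial>torus P)) at_top"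
proof -
  let ?gk = "\<lambda>t. g ((norm (f (kronecker_flow t)))\<^sup>2)" and ?gu = "\<lambda>\<omega>. g ((norm (f (unit_point \<omega>)))\<^sup>2)"
  interpret prob_space "torus P" by (rule prob_space_torus)
  obtain R where R: "R \<ge> 0" "\<And>z. (\<forall>p. norm (z p) = 1) \<Longrightarrow> norm (f z) \<le> R" using trig_poly_bounded[OF f] by blast
  have sq: "(norm (f z))\<^sup>2 \<in> {0..R\<^sup>2}" if "\<forall>p. norm (z p) = 1" for z
    using R(2)[OF that] by (auto intro: power_mono)
  have cg: "continuous_on {0..R\<^sup>2} g" using g by (rule continuous_on_subset) auto
  have cF: "continuous_on S (\<lambda>t. f (kronecker_flow t))" for S by (rule trig_poly_flow_continuous[OF f])
  have cFg: "continuous_on S ?gk" for S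
    by (rule continuous_on_compose2[OF g]) (auto intro!: continuous_intros cF)
  have mf: "(\<lambda>\<omega>. f (unit_point \<omega>)) \<in> borel_measurable (torus P)"
    using trig_poly_integrable[OF P(1) f] by auto
  have bdd: "bounded (g ` {0..R\<^sup>2})" by (intro compact_imp_bounded compact_continuous_image cg) auto
  then obtain B where "\<forall>y\<in>g ` {0..R\<^sup>2}. norm y \<le> B" unfolding bounded_iff by blast
  then have B: "\<And>x. x \<in> {0..R\<^sup>2} \<Longrightarrow> \<bar>g x\<bar> \<le> B" by auto
  have mg: "?gu \<in> borel_measurable (torus P)"
  proof -
    have "(\<lambda>x. indicator {0..} x *\<^sub>R g x) \<in> borel_measurable borel"
      by (rule borel_measurable_continuous_on_indicator[OF _ g]) auto
    then have "(\<lambda>\<omega>. indicator {0..} ((norm (f (unit_point \<omega>)))\<^sup>2) *\<^sub>R g ((norm (f (unit_point \<omega>)))\<^sup>2)) \<in> borel_measurable (torus P)"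
      by (rule measurable_compose[rotated]) (use mf in measurable)
    then show ?thesis by simp
  qed
  show int: "integrable (torus P) ?gu"
    by (rule integrable_const_bound[of _ B]) (use mg B sq in \<open>auto intro!: AE_I2\<close>)
  show "((\<lambda>T. integral {0..T} ?gk / T)
        \<longlongrightarrow> (integral\<^sup>L (torus P) ?gu)) at_top"
  proof (rule tendstoI)
    fix \<epsilon> :: real assume e: "\<epsilon> > 0"
    obtain h where h: "real_polynomial_function h" "\<And>x. x \<in> {0..R\<^sup>2} \<Longrightarrow> \<bar>g x - h x\<bar> < \<epsilon> / 4"
      using Stone_Weierstrass_real_polynomial_function[of "{0..R\<^sup>2}" g "\<epsilon> / 4"] cg e by auto
    let ?hk = "\<lambda>t. h ((norm (f (kronecker_flow t)))\<^sup>2)" and ?hu = "\<lambda>\<omega>. h ((norm (f (unit_point \<omega>)))\<^sup>2)"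
    obtain a n where an: "h = (\<lambda>x. \<Sum>i\<le>n. a i * x ^ i)"
      using h(1) real_polynomial_function_iff_sum by blast
    define H where "H = (\<lambda>z. complex_of_real (h ((norm (f z))\<^sup>2)))"
    have "H = (\<lambda>z. \<Sum>i\<le>n. of_real (a i) * (f z * cnj (f z)) ^ i)"
      unfolding H_def an complex_norm_square[symmetric] by simp
    then have H: "trig_poly P H"
      using f by (auto intro!: trig_poly_sum trig_poly_mult trig_poly_power trig_poly_const trig_poly_cnj)
    have Hi: "(\<integral>\<omega>. H (unit_point \<omega>) \<partial>torus P) = of_real (integral\<^sup>L (torus P) ?hu)"
      unfolding H_def by simp
    have hint: "integrable (torus P) ?hu"
      using integrable_Re[OF trig_poly_integrable[OF P(1) H]] by (simp add: H_def)
    have ch: "continuous_on S ?hk" for S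
      unfolding an by (intro continuous_intros cF)
    have "((\<lambda>T. integral {0..T} (\<lambda>t. H (kronecker_flow t)) / of_real T) \<longlongrightarrow> of_real (integral\<^sup>L (torus P) ?hu)) at_top"
      using trig_poly_mean[OF P H] unfolding Hi .
    moreover have "integral {0..T} (\<lambda>t. H (kronecker_flow t)) = of_real (integral {0..T} ?hk)" for T
      unfolding H_def
      by (intro integral_unique has_integral_linear[OF _ bounded_linear_of_real, unfolded o_def]
          integrable_integral integrable_continuous_real ch)
    ultimately have "((\<lambda>T. complex_of_real (integral {0..T} ?hk / T)) \<longlongrightarrow> of_real (integral\<^sup>L (torus P) ?hu)) at_top"
      by simp
    then have "((\<lambda>T. integral {0..T} ?hk / T) \<longlongrightarrow> (integral\<^sup>L (torus P) ?hu)) at_top"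
      by (simp only: tendsto_of_real_iff)
    then have "\<forall>\<^sub>F T in at_top. dist (integral {0..T} ?hk / T) (integral\<^sup>L (torus P) ?hu) < \<epsilon> / 4"
      using e by (intro tendstoD) auto
    moreover have "\<forall>\<^sub>F T in at_top. (0 :: real) < T" by (rule eventually_gt_at_top)
    ultimately show "\<forall>\<^sub>F T in at_top. dist (integral {0..T} ?gk / T)
         (integral\<^sup>L (torus P) ?gu) < \<epsilon>"
    proof eventually_elim
      case (elim T)
      have d: "norm (g ((norm (f z))\<^sup>2) - h ((norm (f z))\<^sup>2)) \<le> \<epsilon> / 4" if "\<forall>p. norm (z p) = 1" for z
        using h(2)[OF sq[OF that]] by simp
      have "norm (integral {0..T} (\<lambda>t. g ((norm (f (kronecker_flow t)))\<^sup>2) - h ((norm (f (kronecker_flow t)))\<^sup>2))) \<le> \<epsilon> / 4 * (T - 0)"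
        using elim(2) by (intro integral_bound d continuous_intros cFg ch) auto
      then have "\<bar>(integral {0..T} ?gk - integral {0..T} ?hk) / T\<bar> \<le> \<epsilon> / 4"
        using elim(2) by (simp add: integral_diff integrable_continuous_real cFg ch divide_le_eq)
      moreover have "norm (\<integral>\<omega>. (g ((norm (f (unit_point \<omega>)))\<^sup>2) - h ((norm (f (unit_point \<omega>)))\<^sup>2)) \<partial>torus P) \<le> (\<integral>\<omega>. \<epsilon> / 4 \<partial>torus P)"
        by (intro order_trans[OF Bochner_Integration.integral_norm_bound Bochner_Integration.integral_mono]
            integrable_norm Bochner_Integration.integrable_diff int hint d) auto
      then have "\<bar>(integral\<^sup>L (torus P) ?gu) - (integral\<^sup>L (torus P) ?hu)\<bar> \<le> \<epsilon> / 4"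
        using int hint by (simp add: prob_space)
      ultimately show ?case using elim(1) e unfolding dist_real_def diff_divide_distrib by linarith
    qed
  qed
qed

lemma torus_moment:
  fixes q :: real
  assumes P: "finite P" "\<And>p. p \<in> P \<Longrightarrow> prime p" and f: "trig_poly P f" and q: "q > 0"
  shows "integrable (torus P) (\<lambda>\<omega>. norm (f (unit_point \<omega>)) powr q)"
    and "((\<lambda>T. integral {0..T} (\<lambda>t. norm (f (kronecker_flow t)) powr q) / T)
        \<longlongrightarrow> (\<integral>\<omega>. norm (f (unit_point \<omega>)) powr q \<partial>torus P)) at_top"
proof -
  have "continuous_on {0..} (\<lambda>x :: real. x powr (q / 2))" using q by (intro continuous_on_powr' continuous_intros) auto
  from continuous_mean[OF P f this] show "integrable (torus P) (\<lambda>\<omega>. norm (f (unit_point \<omega>)) powr q)"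
    and "((\<lambda>T. integral {0..T} (\<lambda>t. norm (f (kronecker_flow t)) powr q) / T)
        \<longlongrightarrow> (\<integral>\<omega>. norm (f (unit_point \<omega>)) powr q \<partial>torus P)) at_top"
    by (simp_all add: square_powr_half)
qed

section \<open>Point evaluation on the torus\<close>

definition coordinate_poly :: "((nat \<Rightarrow> complex) \<Rightarrow> complex) \<Rightarrow> bool" where
  "coordinate_poly f \<longleftrightarrow> (\<forall>z p. \<exists>\<pi>. \<forall>w. f (z(p := w)) = poly \<pi> w)"

lemma coordinate_poly_const: "coordinate_poly (\<lambda>z. c)"
  unfolding coordinate_poly_def by (auto intro!: exI[of _ "[:c:]"])

lemma coordinate_poly_coordinate: "coordinate_poly (\<lambda>z. z p)"
  unfolding coordinate_poly_def
proof (intro allI)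
  fix z :: "nat \<Rightarrow> complex" and p'
  show "\<exists>\<pi>. \<forall>w. (z(p' := w)) p = poly \<pi> w"
    by (cases "p' = p") (auto intro: exI[of _ "[:0, 1:]"] exI[of _ "[:z p:]"])
qed

lemma coordinate_poly_add: "coordinate_poly f \<Longrightarrow> coordinate_poly g \<Longrightarrow> coordinate_poly (\<lambda>z. f z + g z)"
  unfolding coordinate_poly_def by (metis poly_add)

lemma coordinate_poly_mult: "coordinate_poly f \<Longrightarrow> coordinate_poly g \<Longrightarrow> coordinate_poly (\<lambda>z. f z * g z)"
  unfolding coordinate_poly_def by (metis poly_mult)

lemma coordinate_poly_sum: "(\<And>i. i \<in> I \<Longrightarrow> coordinate_poly (f i)) \<Longrightarrow> coordinate_poly (\<lambda>z. \<Sum>i\<in>I. f i z)"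
  by (induction I rule: infinite_finite_induct) (auto intro: coordinate_poly_const coordinate_poly_add)

lemma coordinate_poly_power: "coordinate_poly f \<Longrightarrow> coordinate_poly (\<lambda>z. f z ^ k)"
  by (induction k) (auto intro: coordinate_poly_const coordinate_poly_mult)

lemma coordinate_poly_prod: "(\<And>i. i \<in> I \<Longrightarrow> coordinate_poly (f i)) \<Longrightarrow> coordinate_poly (\<lambda>z. \<Prod>i\<in>I. f i z)"
  by (induction I rule: infinite_finite_induct) (auto intro: coordinate_poly_const coordinate_poly_mult)

text \<open>
  The variables are integrated one at a time. A variable outside \<open>Q\<close> sits at its evaluation point, so adding
  it to \<open>Q\<close> is one application of the one-variable inequality inside Fubini's theorem.
\<close>
lemma torus_point_evaluation_nn:
  fixes q :: real and r :: "nat \<Rightarrow> real"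
  assumes "finite Q" and q: "q > 0" and r: "\<And>p. 0 \<le> r p \<and> r p < 1" and f: "coordinate_poly f"
    and meas: "\<And>Q. (\<lambda>\<omega>. f (\<lambda>p. if p \<in> Q then cis (2 * pi * \<omega> p) else of_real (r p))) \<in> borel_measurable (torus Q)"
  shows "ennreal ((\<Prod>p\<in>Q. 1 - (r p)\<^sup>2) * norm (f (\<lambda>p. of_real (r p))) powr q)
    \<le> (\<integral>\<^sup>+ \<omega>. ennreal (norm (f (\<lambda>p. if p \<in> Q then cis (2 * pi * \<omega> p) else of_real (r p))) powr q) \<partial>torus Q)"
  using assms(1)
proof induction
  case empty
  interpret prob_space "torus {}" by (rule prob_space_torus)
  show ?case by (simp add: emeasure_space_1)
next
  case (insert x Q)
  interpret product_prob_space "\<lambda>_ :: nat. circle_measure" by (rule product_prob_space_circle)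
  define Z where "Z = (\<lambda>\<omega> p. if p \<in> Q then cis (2 * pi * \<omega> p) else complex_of_real (r p))"
  have s: "0 \<le> 1 - (r p)\<^sup>2" for p using r[of p] by (simp add: abs_square_le_1)
  have inner: "ennreal (1 - (r x)\<^sup>2) * ennreal (norm (f (Z \<omega>)) powr q)
     \<le> (\<integral>\<^sup>+ y. ennreal (norm (f ((Z \<omega>)(x := cis (2 * pi * y)))) powr q) \<partial>circle_measure)" for \<omega>
  proof -
    obtain \<pi> where \<pi>: "\<And>w. f ((Z \<omega>)(x := w)) = poly \<pi> w" using f unfolding coordinate_poly_def by blast
    have "f (Z \<omega>) = f ((Z \<omega>)(x := of_real (r x)))" using insert.hyps by (intro arg_cong[of _ _ f]) (auto simp: Z_def)
    then have v: "f (Z \<omega>) = poly \<pi> (of_real (r x))" by (simp add: \<pi>)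
    have c: "continuous_on UNIV (\<lambda>y. norm (poly \<pi> (cis (2 * pi * y))) powr q)"
      using q by (intro continuous_on_powr' continuous_intros) auto
    have "(1 - (r x)\<^sup>2) * norm (poly \<pi> (of_real (r x))) powr q \<le> integral {0..1} (\<lambda>y. norm (poly \<pi> (cis (2 * pi * y))) powr q)"
      using r[of x] by (intro poly_point_evaluation q) auto
    also have "\<dots> = (\<integral>y. norm (poly \<pi> (cis (2 * pi * y))) powr q \<partial>circle_measure)"
      using circle_integral(2)[OF c] by simp
    finally have "ennreal ((1 - (r x)\<^sup>2) * norm (poly \<pi> (of_real (r x))) powr q)
        \<le> ennreal (\<integral>y. norm (poly \<pi> (cis (2 * pi * y))) powr q \<partial>circle_measure)" by (rule ennreal_leI)
    also have "\<dots> = (\<integral>\<^sup>+ y. ennreal (norm (poly \<pi> (cis (2 * pi * y))) powr q) \<partial>circle_measure)"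
      using circle_integral(1)[OF c] by (intro nn_integral_eq_integral[symmetric]) auto
    finally show ?thesis using s[of x] by (simp add: \<pi> v ennreal_mult)
  qed
  have meas': "(\<lambda>\<omega>. ennreal (norm (f (\<lambda>p. if p \<in> Q' then cis (2 * pi * \<omega> p) else of_real (r p))) powr q)) \<in> borel_measurable (torus Q')" for Q'
    using meas[of Q'] by measurable
  have "ennreal ((\<Prod>p\<in>insert x Q. 1 - (r p)\<^sup>2) * norm (f (\<lambda>p. of_real (r p))) powr q)
     = ennreal (1 - (r x)\<^sup>2) * ennreal ((\<Prod>p\<in>Q. 1 - (r p)\<^sup>2) * norm (f (\<lambda>p. of_real (r p))) powr q)"
    using insert.hyps s by (subst ennreal_mult[symmetric]) (auto simp: mult.assoc intro!: mult_nonneg_nonneg prod_nonneg)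
  also have "\<dots> \<le> ennreal (1 - (r x)\<^sup>2) * (\<integral>\<^sup>+ \<omega>. ennreal (norm (f (Z \<omega>)) powr q) \<partial>torus Q)"
    using insert.IH unfolding Z_def by (rule mult_left_mono) simp
  also have "\<dots> = (\<integral>\<^sup>+ \<omega>. ennreal (1 - (r x)\<^sup>2) * ennreal (norm (f (Z \<omega>)) powr q) \<partial>torus Q)"
    using meas'[of Q] unfolding Z_def by (intro nn_integral_cmult[symmetric]) auto
  also have "\<dots> \<le> (\<integral>\<^sup>+ \<omega>. \<integral>\<^sup>+ y. ennreal (norm (f ((Z \<omega>)(x := cis (2 * pi * y)))) powr q) \<partial>circle_measure \<partial>torus Q)"
    by (intro nn_integral_mono inner)
  also have "\<dots> = (\<integral>\<^sup>+ \<omega>. ennreal (norm (f (\<lambda>p. if p \<in> insert x Q then cis (2 * pi * \<omega> p) else of_real (r p))) powr q) \<partial>torus (insert x Q))"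
  proof -
    have e: "(\<lambda>p. if p \<in> insert x Q then cis (2 * pi * fun_upd \<omega> x y p) else of_real (r p)) = fun_upd (Z \<omega>) x (cis (2 * pi * y))" for \<omega> y
      using insert.hyps by (auto simp: Z_def fun_eq_iff)
    show ?thesis
      using meas'[of "insert x Q"] unfolding torus_def
      by (subst product_nn_integral_insert[OF insert.hyps]) (auto simp: e[symmetric])
  qed
  finally show ?case .
qed

lemma torus_point_evaluation:
  fixes q :: real and r :: "nat \<Rightarrow> real" and a :: "nat \<Rightarrow> complex" and e :: "nat \<Rightarrow> nat \<Rightarrow> nat" and A :: "nat set"
  assumes P: "finite P" "\<And>p. p \<in> P \<Longrightarrow> prime p" and q: "q > 0" and r: "\<And>p. 0 \<le> r p \<and> r p < 1"
  defines "f \<equiv> \<lambda>z. \<Sum>n\<in>A. a n * (\<Prod>p\<in>P. z p ^ e n p)"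
  shows "(\<Prod>p\<in>P. 1 - (r p)\<^sup>2) * norm (f (\<lambda>p. of_real (r p))) powr q \<le> (\<integral>\<omega>. norm (f (unit_point \<omega>)) powr q \<partial>torus P)"
proof -
  have cp: "coordinate_poly f"
    unfolding f_def
    by (intro coordinate_poly_sum coordinate_poly_mult coordinate_poly_const coordinate_poly_prod
        coordinate_poly_power coordinate_poly_coordinate)
  have comp: "(\<lambda>\<omega>. if p \<in> Q then cis (2 * pi * \<omega> p) else of_real (r p)) \<in> borel_measurable (torus Q)" for p Q
  proof (cases "p \<in> Q")
    case True
    have "(\<lambda>\<omega>. \<omega> p) \<in> measurable (torus Q) circle_measure"
      unfolding torus_def by (rule measurable_component_singleton[OF True])
    then have "(\<lambda>\<omega>. \<omega> p) \<in> measurable (torus Q) borel" by (simp cong: measurable_cong_sets)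
    then have "(\<lambda>\<omega>. cis (2 * pi * \<omega> p)) \<in> borel_measurable (torus Q)"
      by (rule measurable_compose) (auto intro!: borel_measurable_continuous_onI continuous_intros)
    then show ?thesis using True by simp
  qed simp
  have meas: "(\<lambda>\<omega>. f (\<lambda>p. if p \<in> Q then cis (2 * pi * \<omega> p) else of_real (r p))) \<in> borel_measurable (torus Q)" for Q
    unfolding f_def
    by (intro borel_measurable_sum borel_measurable_times borel_measurable_const borel_measurable_prod borel_measurable_power comp)
  have tp: "trig_poly P f"
    unfolding f_def using P(1)
    by (intro trig_poly_sum trig_poly_mult trig_poly_const trig_poly_prod trig_poly_power trig_poly_coordinate)
  have "ennreal ((\<Prod>p\<in>P. 1 - (r p)\<^sup>2) * norm (f (\<lambda>p. of_real (r p))) powr q)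
    \<le> (\<integral>\<^sup>+ \<omega>. ennreal (norm (f (\<lambda>p. if p \<in> P then cis (2 * pi * \<omega> p) else of_real (r p))) powr q) \<partial>torus P)"
    by (rule torus_point_evaluation_nn[OF P(1) q r cp meas])
  also have "\<dots> = (\<integral>\<^sup>+ \<omega>. ennreal (norm (f (unit_point \<omega>)) powr q) \<partial>torus P)"
    by (simp add: f_def unit_point_def cong: prod.cong)
  also have "\<dots> = ennreal (\<integral>\<omega>. norm (f (unit_point \<omega>)) powr q \<partial>torus P)"
    using torus_moment(1)[OF P tp q] by (intro nn_integral_eq_integral) auto
  finally show ?thesis by (subst (asm) ennreal_le_iff) (auto intro!: integral_nonneg_AE)
qed

section \<open>The lift of the Dirichlet polynomial\<close>

definition dirichlet_lift :: "nat \<Rightarrow> (nat \<Rightarrow> complex) \<Rightarrow> complex" where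
  "dirichlet_lift N z = (\<Sum>n=1..N. of_real (real n powr (- 1 / 2)) * (\<Prod>p\<in>primes_upto N. z p ^ multiplicity p n))"

lemma nat_powr_half_line:
  assumes "n > 0"
  shows "of_nat n powr (- 1 / 2 - \<i> * of_real t) = of_real (real n powr (- 1 / 2)) * cis (- (t * ln (real n)))"
proof -
  have "of_nat n powr (- 1 / 2 - \<i> * of_real t) = exp ((- 1 / 2 - \<i> * of_real t) * of_real (ln (real n)))"
    using assms by (simp add: powr_def Ln_of_nat)
  also have "\<dots> = exp (of_real (- 1 / 2 * ln (real n)) + \<i> * of_real (- (t * ln (real n))))"
    by (simp add: algebra_simps)
  also have "\<dots> = of_real (exp (- 1 / 2 * ln (real n))) * cis (- (t * ln (real n)))"
    by (simp only: exp_add cis_conv_exp exp_of_real)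
  finally show ?thesis using assms by (simp add: powr_def)
qed

lemma cis_flow_prod:
  assumes "finite Q" "\<And>p. p \<in> Q \<Longrightarrow> p > 0"
  shows "(\<Prod>p\<in>Q. kronecker_flow t p ^ e p) = cis (- (t * ln (real (\<Prod>p\<in>Q. p ^ e p))))"
  using assms
proof induction
  case (insert x F)
  have x: "real x > 0" using insert.prems by auto
  have F: "(\<Prod>p\<in>F. real p ^ e p) > 0" using insert.prems by (intro prod_pos) auto
  have "ln (real x ^ e x * (\<Prod>p\<in>F. real p ^ e p)) = real (e x) * ln (real x) + ln (\<Prod>p\<in>F. real p ^ e p)"
    using x F by (simp add: ln_mult_pos ln_realpow)
  moreover have "kronecker_flow t x ^ e x = cis (- (t * (real (e x) * ln (real x))))"
    unfolding kronecker_flow_def Complex.DeMoivre by (simp add: algebra_simps)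
  ultimately show ?case using insert by (simp add: cis_mult algebra_simps)
qed simp

lemma dirichlet_lift_flow: "dirichlet_lift N (kronecker_flow t) = D N (\<i> * of_real t)"
  unfolding dirichlet_lift_def D_def
proof (rule sum.cong)
  fix n assume n: "n \<in> {1..N}"
  have "(\<Prod>p\<in>primes_upto N. kronecker_flow t p ^ multiplicity p n) = cis (- (t * ln (real n)))"
    using cis_flow_prod[of "primes_upto N" t "\<lambda>p. multiplicity p n"] prod_primes_upto_multiplicity[of n N] n
      primes_uptoD(3) by fastforce
  then show "of_real (real n powr (- 1 / 2)) * (\<Prod>p\<in>primes_upto N. kronecker_flow t p ^ multiplicity p n)
      = of_nat n powr (- 1 / 2 - \<i> * of_real t)"
    using nat_powr_half_line[of n t] n by simp
qed simp

lemma trig_poly_dirichlet_lift: "trig_poly (primes_upto N) (dirichlet_lift N)"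
  unfolding dirichlet_lift_def
  by (intro trig_poly_sum trig_poly_mult trig_poly_const trig_poly_prod trig_poly_power trig_poly_coordinate) auto

abbreviation lift_moment :: "real \<Rightarrow> nat \<Rightarrow> ((nat \<Rightarrow> complex) \<Rightarrow> complex) \<Rightarrow> real" where
  "lift_moment q N f \<equiv> \<integral>\<omega>. norm (f (unit_point \<omega>)) powr q \<partial>torus (primes_upto N)"

lemma dirichlet_norm_eq_torus:
  assumes q: "q > 0"
  shows "dirichlet_norm q (D N) = lift_moment q N (dirichlet_lift N) powr (1 / q)"
proof -
  have "((\<lambda>T. 1 / T * integral {0..T} (\<lambda>t. norm (D N (\<i> * of_real t)) powr q))
     \<longlongrightarrow> lift_moment q N (dirichlet_lift N)) at_top"
    using torus_moment(2)[OF _ _ trig_poly_dirichlet_lift q, of N] by (simp add: primes_uptoD dirichlet_lift_flow)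
  then show ?thesis
    unfolding dirichlet_norm_def by (subst tendsto_Lim) auto
qed

section \<open>The lower bound\<close>

lemma powr_minus_half_square:
  fixes x :: real
  assumes "x > 0"
  shows "(x powr (- 1 / 2))\<^sup>2 = 1 / x"
proof -
  have "(x powr (- 1 / 2))\<^sup>2 = x powr (- 1 / 2 + - 1 / 2)" by (simp only: power2_eq_square powr_add)
  also have "\<dots> = 1 / x" using assms by (simp add: powr_minus_divide)
  finally show ?thesis .
qed

text \<open>
  The weights \<open>\<Prod>\<^bsub>p \<in> S\<^esub> x p\<close>, normalised, describe a random set that contains each \<open>p\<close> independently with probability
  \<open>x p / (1 + x p) \<le> x p\<close>; the second statement bounds the expectation of the total height.
\<close>
lemma weighted_subset_sums:
  fixes x h :: "nat \<Rightarrow> real"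
  assumes "finite Q" "\<And>p. p \<in> Q \<Longrightarrow> x p \<ge> 0" "\<And>p. p \<in> Q \<Longrightarrow> h p \<ge> 0"
  shows "(\<Sum>S\<in>Pow Q. \<Prod>p\<in>S. x p) = (\<Prod>p\<in>Q. 1 + x p) \<and>
    (\<Sum>S\<in>Pow Q. (\<Prod>p\<in>S. x p) * (\<Sum>p\<in>S. h p)) \<le> (\<Sum>p\<in>Q. h p * x p) * (\<Prod>p\<in>Q. 1 + x p)"
  using assms
proof induction
  case (insert a Q)
  have split: "(\<Sum>S\<in>Pow (insert a Q). F S) = (\<Sum>S\<in>Pow Q. F S) + (\<Sum>S\<in>Pow Q. F (insert a S))" for F :: "nat set \<Rightarrow> real"
  proof -
    have "inj_on (insert a) (Pow Q)" using insert.hyps(2) by (auto simp: inj_on_def)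
    moreover have "Pow Q \<inter> insert a ` Pow Q = {}" using insert.hyps(2) by auto
    ultimately show ?thesis
      using insert.hyps(1) by (simp add: Pow_insert sum.union_disjoint sum.reindex)
  qed
  have ins: "(\<Prod>p\<in>insert a S. x p) = x a * (\<Prod>p\<in>S. x p)" "(\<Sum>p\<in>insert a S. h p) = h a + (\<Sum>p\<in>S. h p)"
    if "S \<in> Pow Q" for S
    using that insert.hyps by (auto simp: finite_subset intro!: prod.insert sum.insert)
  define W where "W = (\<Prod>p\<in>Q. 1 + x p)"
  define U where "U = (\<Sum>p\<in>Q. h p * x p)"
  have W: "W \<ge> 0" unfolding W_def using insert.prems by (intro prod_nonneg) (auto simp: add_nonneg_nonneg)
  have xa: "x a \<ge> 0" "h a \<ge> 0" using insert.prems by auto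
  have IH: "(\<Sum>S\<in>Pow Q. \<Prod>p\<in>S. x p) = W" "(\<Sum>S\<in>Pow Q. (\<Prod>p\<in>S. x p) * (\<Sum>p\<in>S. h p)) \<le> U * W"
    unfolding W_def U_def using insert by auto
  have "(\<Sum>S\<in>Pow (insert a Q). \<Prod>p\<in>S. x p) = W + (\<Sum>S\<in>Pow Q. x a * (\<Prod>p\<in>S. x p))"
    unfolding split IH(1) using ins by (auto intro!: sum.cong)
  also have "\<dots> = (1 + x a) * W" by (simp add: IH(1) algebra_simps flip: sum_distrib_left)
  finally have 1: "(\<Sum>S\<in>Pow (insert a Q). \<Prod>p\<in>S. x p) = (1 + x a) * W" .
  define V where "V = (\<Sum>S\<in>Pow Q. (\<Prod>p\<in>S. x p) * (\<Sum>p\<in>S. h p))"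
  have "(\<Sum>S\<in>Pow (insert a Q). (\<Prod>p\<in>S. x p) * (\<Sum>p\<in>S. h p))
     = V + (\<Sum>S\<in>Pow Q. x a * h a * (\<Prod>p\<in>S. x p) + x a * ((\<Prod>p\<in>S. x p) * (\<Sum>p\<in>S. h p)))"
    unfolding split V_def using ins by (auto intro!: sum.cong simp: algebra_simps)
  also have "\<dots> = V + (x a * h a * W + x a * V)"
    by (simp add: sum.distrib IH(1) V_def flip: sum_distrib_left)
  also have "\<dots> = (1 + x a) * V + x a * h a * W" by (simp add: algebra_simps)
  also have "\<dots> \<le> (1 + x a) * (U * W) + (1 + x a) * (x a * h a * W)"
    using IH(2) xa W unfolding V_def[symmetric]
    by (intro add_mono mult_left_mono) (auto simp: distrib_right)
  also have "\<dots> = (h a * x a + U) * ((1 + x a) * W)" by (simp add: algebra_simps)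
  finally show ?case using 1 insert.hyps by (simp add: W_def U_def)
qed auto

text \<open>
  Markov's inequality: the expected height is at most \<open>B / 2\<close>.
\<close>
lemma truncated_subset_sum_ge:
  fixes x h :: "nat \<Rightarrow> real"
  assumes Q: "finite Q" "\<And>p. p \<in> Q \<Longrightarrow> x p \<ge> 0" "\<And>p. p \<in> Q \<Longrightarrow> h p \<ge> 0"
    and B: "B > 0" "2 * (\<Sum>p\<in>Q. h p * x p) \<le> B"
  shows "(\<Prod>p\<in>Q. 1 + x p) / 2 \<le> (\<Sum>S | S \<subseteq> Q \<and> (\<Sum>p\<in>S. h p) \<le> B. \<Prod>p\<in>S. x p)"
proof -
  define w where "w = (\<lambda>S. \<Prod>p\<in>S. x p)"
  define H where "H = (\<lambda>S. \<Sum>p\<in>S. h p)"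
  define W where "W = (\<Prod>p\<in>Q. 1 + x p)"
  have W: "W \<ge> 0" unfolding W_def using Q by (intro prod_nonneg) (auto simp: add_nonneg_nonneg)
  have w: "w S \<ge> 0" "H S \<ge> 0" if "S \<subseteq> Q" for S
    unfolding w_def H_def using that Q by (auto intro!: prod_nonneg sum_nonneg)
  note * = weighted_subset_sums[of Q x h, OF Q]
  let ?G = "{S. S \<subseteq> Q \<and> H S \<le> B}" and ?L = "{S. S \<subseteq> Q \<and> B < H S}"
  have fin: "finite ?G" "finite ?L" using Q(1) by auto
  have "Pow Q = ?G \<union> ?L" by auto
  then have "W = sum w ?G + sum w ?L"
    using * fin unfolding W_def w_def by (subst sum.union_disjoint[symmetric]) auto
  moreover have "B * sum w ?L \<le> B * (W / 2)"
  proof -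
    have "B * sum w ?L = (\<Sum>S\<in>?L. w S * B)" by (simp add: sum_distrib_left mult.commute)
    also have "\<dots> \<le> (\<Sum>S\<in>?L. w S * H S)" using w by (intro sum_mono mult_left_mono) auto
    also have "\<dots> \<le> (\<Sum>S\<in>Pow Q. w S * H S)" using w Q(1) by (intro sum_mono2) auto
    also have "\<dots> \<le> (\<Sum>p\<in>Q. h p * x p) * W" using * unfolding w_def H_def W_def by blast
    also have "\<dots> \<le> B / 2 * W" using B(2) W by (intro mult_right_mono) auto
    finally show ?thesis by simp
  qed
  then have "sum w ?L \<le> W / 2" using B(1) by simp
  ultimately have "W / 2 \<le> sum w ?G" by linarith
  then show ?thesis unfolding W_def w_def H_def .
qed

text \<open>
  At a point with nonnegative coordinates all terms are nonnegative, so the squarefree \<open>n\<close> with prime factors in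
  \<open>Q\<close> may be singled out. They correspond to the subsets \<open>S\<close> of \<open>Q\<close>, and \<open>n \<le> N\<close> says that the sum of the logarithms is at
  most \<open>ln N\<close>.
\<close>
lemma dirichlet_lift_ge_subset_sum:
  fixes r :: "nat \<Rightarrow> real"
  assumes N: "N > 0" and Q: "Q \<subseteq> primes_upto N" and r: "\<And>p. r p \<ge> 0"
  shows "(\<Sum>S | S \<subseteq> Q \<and> (\<Sum>p\<in>S. ln (real p)) \<le> ln (real N). \<Prod>p\<in>S. r p * real p powr (- 1 / 2))
    \<le> norm (dirichlet_lift N (\<lambda>p. of_real (r p)))"
proof -
  let ?P = "primes_upto N"
  define R where "R = (\<lambda>n. real n powr (- 1 / 2) * (\<Prod>p\<in>?P. r p ^ multiplicity p n))"
  have R0: "R n \<ge> 0" for n unfolding R_def using r by (intro mult_nonneg_nonneg prod_nonneg) auto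
  have "dirichlet_lift N (\<lambda>p. of_real (r p)) = of_real (\<Sum>n=1..N. R n)"
    unfolding dirichlet_lift_def R_def by simp
  moreover have "(\<Sum>n=1..N. R n) \<ge> 0" using R0 by (intro sum_nonneg)
  ultimately have n: "norm (dirichlet_lift N (\<lambda>p. of_real (r p))) = (\<Sum>n=1..N. R n)"
    by (simp only: norm_of_real abs_of_nonneg)
  let ?G = "{S. S \<subseteq> Q \<and> (\<Sum>p\<in>S. ln (real p)) \<le> ln (real N)}"
  have finQ: "finite Q" using Q by (rule finite_subset) simp
  have pr: "prime p" if "S \<in> ?G" "p \<in> S" for S p
  proof -
    have "p \<in> primes_upto N" using that Q by auto
    then show ?thesis by (rule primes_uptoD)
  qed
  have finS: "finite S" if "S \<in> ?G" for S using that finQ finite_subset by blast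
  have mult: "multiplicity p (\<Prod>S) = (if p \<in> S then 1 else 0)" if "S \<in> ?G" "prime p" for S p
    using multiplicity_prod_prime_powers[OF finS[OF that(1)] pr[OF that(1)] that(2), of "\<lambda>_. 1"] by simp
  have inj: "inj_on (\<lambda>S. \<Prod>S) ?G"
  proof (rule inj_onI)
    fix S S' assume S: "S \<in> ?G" "S' \<in> ?G" and e: "\<Prod>S = \<Prod>S'"
    have "p \<in> S \<longleftrightarrow> p \<in> S'" if "prime p" for p
      using trans[OF mult[OF S(1) that, symmetric] trans[OF arg_cong[OF e, of "multiplicity p"] mult[OF S(2) that]]]
      by (simp split: if_splits)
    moreover have "p \<notin> S \<and> p \<notin> S'" if "\<not> prime p" for p using pr[OF S(1)] pr[OF S(2)] that by blast
    ultimately show "S = S'" by blast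
  qed
  have pos: "\<Prod>S > 0" if "S \<in> ?G" for S using pr[OF that] by (intro prod_pos) (simp add: prime_gt_0_nat)
  have sub: "(\<lambda>S. \<Prod>S) ` ?G \<subseteq> {1..N}"
  proof safe
    fix S assume S: "S \<subseteq> Q" "(\<Sum>p\<in>S. ln (real p)) \<le> ln (real N)"
    then have SG: "S \<in> ?G" by simp
    have p0: "real p > 0" if "p \<in> S" for p using pr[OF SG that] by (simp add: prime_gt_0_nat)
    show "\<Prod>S \<in> {1..N}"
    proof -
      have "ln (real (\<Prod>S)) = (\<Sum>p\<in>S. ln (real p))"
        using finS[OF SG] p0 by (simp add: ln_prod less_imp_neq[symmetric])
      then have "ln (real (\<Prod>S)) \<le> ln (real N)" using S(2) by simp
      moreover have "0 < real (\<Prod>S)" using pos[OF SG] by (simp only: of_nat_0_less_iff)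
      ultimately have "real (\<Prod>S) \<le> real N" using N by (simp only: ln_le_cancel_iff of_nat_0_less_iff)
      then have "\<Prod>S \<le> N" by (simp only: of_nat_le_iff)
      then show ?thesis using pos[OF SG] by (simp add: Suc_le_eq)
    qed
  qed
  have "(\<Sum>S\<in>?G. \<Prod>p\<in>S. r p * real p powr (- 1 / 2)) = (\<Sum>S\<in>?G. R (\<Prod>S))"
  proof (rule sum.cong)
    fix S assume S: "S \<in> ?G"
    have SP: "S \<subseteq> ?P" using S Q by auto
    have "(\<Prod>p\<in>?P. r p ^ multiplicity p (\<Prod>S)) = (\<Prod>p\<in>S. r p)"
    proof -
      have "(\<Prod>p\<in>?P. r p ^ multiplicity p (\<Prod>S)) = (\<Prod>p\<in>?P. if p \<in> S then r p else 1)"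
        using mult[OF S] primes_uptoD(1) by (intro prod.cong) auto
      also have "\<dots> = (\<Prod>p\<in>S. r p)" using SP by (simp add: prod.If_cases Int_absorb1)
      finally show ?thesis .
    qed
    moreover have "real (\<Prod>S) powr (- 1 / 2) = (\<Prod>p\<in>S. real p powr (- 1 / 2))"
      by (simp add: prod_powr_distrib)
    ultimately show "(\<Prod>p\<in>S. r p * real p powr (- 1 / 2)) = R (\<Prod>S)"
      unfolding R_def by (simp add: prod.distrib)
  qed simp
  also have "\<dots> = (\<Sum>n\<in>(\<lambda>S. \<Prod>S) ` ?G. R n)" by (simp add: sum.reindex[OF inj])
  also have "\<dots> \<le> (\<Sum>n=1..N. R n)" using sub R0 by (intro sum_mono2) auto
  finally show ?thesis unfolding n .
qed

lemma dirichlet_lift_moment_ge: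
  fixes r :: "nat \<Rightarrow> real"
  assumes q: "q > 0" and r: "\<And>p. 0 \<le> r p \<and> r p < 1"
  shows "(\<Prod>p\<in>primes_upto N. 1 - (r p)\<^sup>2) * norm (dirichlet_lift N (\<lambda>p. of_real (r p))) powr q
    \<le> lift_moment q N (dirichlet_lift N)"
  unfolding dirichlet_lift_def
  by (rule torus_point_evaluation) (auto simp: primes_uptoD q r)

text \<open>
  \<open>Y\<close> is the integer part of \<open>N\<^bsup>1/k\<^esup>\<close>. Rounding down costs at most a factor \<open>2\<close> in the logarithm, as
  \<open>Y + 1 \<le> Y\<^sup>2\<close>.
\<close>
lemma large_root_exists:
  fixes k N :: nat
  assumes k: "k \<ge> 1" and N: "2 ^ k \<le> N"
  obtains Y where "Y \<ge> 2" "Y \<le> N" "real k * ln (real Y) \<le> ln (real N)" "ln (real N) \<le> 2 * real k * ln (real Y)"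
proof -
  define Y where "Y = Max {y. y ^ k \<le> N}"
  have sub: "{y. y ^ k \<le> N} \<subseteq> {..N}"
  proof
    fix y assume "y \<in> {y. y ^ k \<le> N}"
    moreover have "y \<le> y ^ k" using k by (cases "y = 0") (auto intro: self_le_power)
    ultimately show "y \<in> {..N}" by auto
  qed
  then have fin: "finite {y. y ^ k \<le> N}" by (rule finite_subset) simp
  have "Y \<in> {y. y ^ k \<le> N}" unfolding Y_def by (rule Max_in[OF fin]) (use N in auto)
  then have Yk: "Y ^ k \<le> N" and YN: "Y \<le> N" using sub by auto
  have Y2: "Y \<ge> 2" unfolding Y_def by (rule Max_ge[OF fin]) (use N in simp)
  have "\<not> (Y + 1) ^ k \<le> N"
  proof
    assume "(Y + 1) ^ k \<le> N"
    then have "Y + 1 \<le> Y" unfolding Y_def using Max_ge[OF fin] by auto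
    then show False by simp
  qed
  then have "N \<le> (Y + 1) ^ k" by simp
  also have "\<dots> \<le> (Y ^ 2) ^ k"
  proof (rule power_mono)
    have "Y + 1 \<le> 2 * Y" using Y2 by simp
    also have "\<dots> \<le> Y * Y" using Y2 by (rule mult_right_mono) simp
    finally show "Y + 1 \<le> Y ^ 2" by (simp add: power2_eq_square)
  qed simp
  finally have "real N \<le> real ((Y ^ 2) ^ k)" by (simp only: of_nat_le_iff)
  then have "ln (real N) \<le> ln (real ((Y ^ 2) ^ k))"
    using Y2 YN by (subst ln_le_cancel_iff) auto
  also have "real ((Y ^ 2) ^ k) = real Y ^ (2 * k)" by (simp add: power_mult)
  also have "ln (real Y ^ (2 * k)) = 2 * real k * ln (real Y)" using Y2 by (simp add: ln_realpow)
  finally have 1: "ln (real N) \<le> 2 * real k * ln (real Y)" .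
  have "ln (real Y ^ k) \<le> ln (real N)"
    using Yk Y2 YN by (subst ln_le_cancel_iff) (auto simp flip: of_nat_power)
  then have 2: "real k * ln (real Y) \<le> ln (real N)" using Y2 by (simp add: ln_realpow)
  show ?thesis by (rule that[OF Y2 YN 2 1])
qed

text \<open>
  With \<open>L = ln ln Y\<close>, the factor \<open>\<Prod>(1 - r\<^sub>p\<^sup>2)\<close> is at least a constant times \<open>exp (- q\<^sup>2 L / 4)\<close> and the value of the
  lift at least a constant times \<open>exp (q L / 2)\<close>. The condition on \<open>Y\<close> is what Markov's inequality needs
  to absorb the truncation at \<open>N\<close>.
\<close>
lemma euler_point_lower:
  fixes q :: real
  assumes q: "q > 0"
  obtains c where "c > 0"
    "\<And>N Y. \<lbrakk>2 \<le> Y; Y \<le> N; 2 * q * ln (real Y) \<le> ln (real N)\<rbrakk> \<Longrightarrow>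
      c * ln (real Y) powr (q\<^sup>2 / 4) \<le> lift_moment q N (dirichlet_lift N)"
proof -
  obtain C0 where C0: "C0 \<ge> 0" "\<And>N. N \<ge> 2 \<Longrightarrow> (\<Sum>p\<in>primes_upto N. 1 / real p) \<le> ln (ln (real N)) + C0"
    using mertens_upper by blast
  define M where "M = nat \<lceil>q\<^sup>2\<rceil>"
  define cq where "cq = (\<Sum>p\<in>primes_upto M. 1 / real p)"
  define c1 where "c1 = q\<^sup>2 / 4 * C0 + q ^ 4 / 4"
  define c2 where "c2 = q / 2 * (4 + cq) + q\<^sup>2 / 2"
  define c where "c = exp (- c1) * (exp (- c2) / 2) powr q"
  have c: "c > 0" by (simp add: c_def)
  have main: "c * ln (real Y) powr (q\<^sup>2 / 4) \<le> lift_moment q N (dirichlet_lift N)"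
    if Y: "2 \<le> Y" "Y \<le> N" "2 * q * ln (real Y) \<le> ln (real N)" for N Y
  proof -
    define Q where "Q = primes_upto Y - primes_upto M"
    \<comment> \<open>Primes below \<open>q\<^sup>2\<close> are left out to keep \<open>r p \<le> 1 / 2\<close>; they only affect the constant.\<close>
    define r where "r = (\<lambda>p. if p \<in> Q then q / 2 * real p powr (- 1 / 2) else 0)"
    have finQ: "finite Q" by (simp add: Q_def)
    have QY: "Q \<subseteq> primes_upto Y" by (auto simp: Q_def)
    have QN: "Q \<subseteq> primes_upto N" using Y(2) by (auto simp: Q_def primes_upto_def)
    have Qp: "real p > q\<^sup>2" "real p \<ge> 2" if "p \<in> Q" for p
    proof -
      have pY: "p \<in> primes_upto Y" "p \<notin> primes_upto M" using that by (auto simp: Q_def)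
      have "\<not> p \<le> M" using pY(2) primes_uptoD(1)[OF pY(1)] by (simp add: primes_upto_def)
      moreover have "p \<ge> 2" using pY(1) by (rule primes_uptoD)
      ultimately show "real p > q\<^sup>2" "real p \<ge> 2" unfolding M_def by linarith+
    qed
    have sq: "(real p powr (- 1 / 2))\<^sup>2 = 1 / real p" if "p \<in> Q" for p
      using Qp[OF that] by (intro powr_minus_half_square) simp
    have r2: "(r p)\<^sup>2 = q\<^sup>2 / 4 / real p" if "p \<in> Q" for p
      using that sq[OF that] by (simp add: r_def power_mult_distrib power_divide)
    have r2le: "(r p)\<^sup>2 \<le> 1 / 4" for p
    proof (cases "p \<in> Q")
      case True
      have "q\<^sup>2 / real p \<le> 1" using Qp[OF True] by simp
      then show ?thesis using r2[OF True] by (simp add: field_simps)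
    qed (simp add: r_def)
    have r: "0 \<le> r p \<and> r p < 1" for p
    proof
      show "0 \<le> r p" using q by (simp add: r_def)
      have "(r p)\<^sup>2 < 1\<^sup>2" using r2le[of p] by simp
      then show "r p < 1" by (rule power2_less_imp_less) simp
    qed
    have x: "r p * real p powr (- 1 / 2) = q / 2 / real p" if "p \<in> Q" for p
      using that sq[OF that] by (simp add: r_def power2_eq_square mult.assoc)
    define L where "L = ln (ln (real Y))"
    have lnY: "ln (real Y) > 0" using Y by simp
    have "(\<Prod>p\<in>primes_upto N. 1 - (r p)\<^sup>2) = (\<Prod>p\<in>Q. 1 - (r p)\<^sup>2)"
      using QN by (intro prod.mono_neutral_right) (auto simp: r_def)
    also have "\<dots> \<ge> (\<Prod>p\<in>Q. exp (- (q\<^sup>2 / 4 * (1 / real p) + q ^ 4 / 8 * (1 / real p ^ 2))))"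
    proof (intro prod_mono conjI)
      fix p assume p: "p \<in> Q"
      have "- (r p)\<^sup>2 - 2 * ((r p)\<^sup>2)\<^sup>2 \<le> ln (1 - (r p)\<^sup>2)"
        using r2le[of p] by (intro ln_one_minus_pos_lower_bound) auto
      then have "exp (- (r p)\<^sup>2 - 2 * ((r p)\<^sup>2)\<^sup>2) \<le> exp (ln (1 - (r p)\<^sup>2))" by (simp only: exp_le_cancel_iff)
      also have "\<dots> = 1 - (r p)\<^sup>2" using r2le[of p] by (intro exp_ln) linarith
      also have "- (r p)\<^sup>2 - 2 * ((r p)\<^sup>2)\<^sup>2 = - (q\<^sup>2 / 4 * (1 / real p) + q ^ 4 / 8 * (1 / real p ^ 2))"
      proof -
        have "(q\<^sup>2)\<^sup>2 = q ^ 4" by (simp flip: power_mult)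
        then show ?thesis unfolding r2[OF p] power_divide by simp
      qed
      finally show "exp (- (q\<^sup>2 / 4 * (1 / real p) + q ^ 4 / 8 * (1 / real p ^ 2))) \<le> 1 - (r p)\<^sup>2" .
    qed simp
    also have "(\<Prod>p\<in>Q. exp (- (q\<^sup>2 / 4 * (1 / real p) + q ^ 4 / 8 * (1 / real p ^ 2))))
       = exp (- (q\<^sup>2 / 4 * (\<Sum>p\<in>Q. 1 / real p) + q ^ 4 / 8 * (\<Sum>p\<in>Q. 1 / real p ^ 2)))"
      using finQ by (simp add: exp_sum[symmetric] sum_negf sum_subtractf sum.distrib sum_distrib_left)
    also have "\<dots> \<ge> exp (- (q\<^sup>2 / 4 * (L + C0) + q ^ 4 / 8 * 2))"
    proof -
      have "(\<Sum>p\<in>Q. 1 / real p) \<le> (\<Sum>p\<in>primes_upto Y. 1 / real p)" using QY by (intro sum_mono2) auto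
      then have "(\<Sum>p\<in>Q. 1 / real p) \<le> L + C0" using C0(2)[OF Y(1)] by (simp add: L_def)
      moreover have "(\<Sum>p\<in>Q. 1 / real p ^ 2) \<le> (\<Sum>p\<in>primes_upto Y. 1 / real p ^ 2)" using QY by (intro sum_mono2) auto
      then have "(\<Sum>p\<in>Q. 1 / real p ^ 2) \<le> 2" using sum_inverse_prime_squares_le[of Y] by linarith
      ultimately have "q\<^sup>2 / 4 * (\<Sum>p\<in>Q. 1 / real p) + q ^ 4 / 8 * (\<Sum>p\<in>Q. 1 / real p ^ 2) \<le> q\<^sup>2 / 4 * (L + C0) + q ^ 4 / 8 * 2"
        using q by (intro add_mono mult_left_mono) auto
      then show ?thesis by simp
    qed
    finally have A: "exp (- c1) * exp (- (q\<^sup>2 / 4 * L)) \<le> (\<Prod>p\<in>primes_upto N. 1 - (r p)\<^sup>2)"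
      by (simp add: c1_def algebra_simps add_divide_distrib flip: exp_add)
    have "(\<Prod>p\<in>Q. 1 + q / 2 / real p) / 2
        \<le> (\<Sum>S | S \<subseteq> Q \<and> (\<Sum>p\<in>S. ln (real p)) \<le> ln (real N). \<Prod>p\<in>S. q / 2 / real p)"
    proof (rule truncated_subset_sum_ge[OF finQ])
      show "0 \<le> q / 2 / real p" for p using q by simp
      show "0 \<le> ln (real p)" if "p \<in> Q" for p using Qp[OF that] by simp
      show "0 < ln (real N)" using Y by simp
      have "2 * (\<Sum>p\<in>Q. ln (real p) * (q / 2 / real p)) = q * (\<Sum>p\<in>Q. ln (real p) / real p)"
        by (simp add: sum_distrib_left mult_ac)
      also have "\<dots> \<le> q * (\<Sum>p\<in>primes_upto Y. ln (real p) / real p)"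
        using q QY by (intro mult_left_mono sum_mono2) (auto dest: primes_uptoD(3))
      also have "\<dots> \<le> q * (2 * ln (real Y))"
        using q Y(1) sum_ln_over_prime_le[of Y] by (intro mult_left_mono) auto
      also have "\<dots> \<le> ln (real N)" using Y(3) by (simp add: mult_ac)
      finally show "2 * (\<Sum>p\<in>Q. ln (real p) * (q / 2 / real p)) \<le> ln (real N)" .
    qed
    also have "\<dots> = (\<Sum>S | S \<subseteq> Q \<and> (\<Sum>p\<in>S. ln (real p)) \<le> ln (real N). \<Prod>p\<in>S. r p * real p powr (- 1 / 2))"
      using x by (intro sum.cong prod.cong refl) (auto dest!: subsetD)
    also have "\<dots> \<le> norm (dirichlet_lift N (\<lambda>p. of_real (r p)))"
      using r Y by (intro dirichlet_lift_ge_subset_sum QN) auto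
    finally have lower: "(\<Prod>p\<in>Q. 1 + q / 2 / real p) / 2 \<le> norm (dirichlet_lift N (\<lambda>p. of_real (r p)))" .
    have "(\<Prod>p\<in>Q. 1 + q / 2 / real p) \<ge> (\<Prod>p\<in>Q. exp (q / 2 * (1 / real p) - q\<^sup>2 / 4 * (1 / real p ^ 2)))"
    proof (intro prod_mono conjI)
      fix p assume p: "p \<in> Q"
      have "q / 2 / real p \<le> 1"
      proof (cases "q \<le> 1")
        case False
        then have "q * 1 \<le> q * q" by (intro mult_left_mono) auto
        then have "q \<le> 2 * real p" using Qp[OF p] by (simp add: power2_eq_square)
        then show ?thesis using Qp[OF p] by (simp add: field_simps)
      qed (use Qp[OF p] in \<open>simp add: field_simps\<close>)
      then have "q / 2 / real p - (q / 2 / real p)\<^sup>2 \<le> ln (1 + q / 2 / real p)"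
        using q by (intro ln_one_plus_pos_lower_bound) auto
      then have "exp (q / 2 / real p - (q / 2 / real p)\<^sup>2) \<le> exp (ln (1 + q / 2 / real p))" by (simp only: exp_le_cancel_iff)
      also have "\<dots> = 1 + q / 2 / real p" using q by (intro exp_ln add_pos_nonneg) auto
      finally show "exp (q / 2 * (1 / real p) - q\<^sup>2 / 4 * (1 / real p ^ 2)) \<le> 1 + q / 2 / real p"
        by (simp add: power_divide)
    qed simp
    moreover have "(\<Prod>p\<in>Q. exp (q / 2 * (1 / real p) - q\<^sup>2 / 4 * (1 / real p ^ 2)))
       = exp (q / 2 * (\<Sum>p\<in>Q. 1 / real p) - q\<^sup>2 / 4 * (\<Sum>p\<in>Q. 1 / real p ^ 2))"
      using finQ by (simp add: exp_sum[symmetric] sum_subtractf sum_distrib_left)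
    moreover have "exp (q / 2 * L - c2) \<le> exp (q / 2 * (\<Sum>p\<in>Q. 1 / real p) - q\<^sup>2 / 4 * (\<Sum>p\<in>Q. 1 / real p ^ 2))"
    proof -
      have "(\<Sum>p\<in>primes_upto Y. 1 / real p) \<le> (\<Sum>p\<in>Q \<union> primes_upto M. 1 / real p)"
        by (intro sum_mono2) (auto simp: Q_def)
      also have "\<dots> = (\<Sum>p\<in>Q. 1 / real p) + cq"
        unfolding cq_def by (rule sum.union_disjoint) (auto simp: Q_def)
      finally have "L - 4 - cq \<le> (\<Sum>p\<in>Q. 1 / real p)" using mertens_lower[OF Y(1)] by (simp add: L_def)
      then have "q / 2 * (L - 4 - cq) \<le> q / 2 * (\<Sum>p\<in>Q. 1 / real p)" using q by (intro mult_left_mono) auto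
      moreover have "(\<Sum>p\<in>Q. 1 / real p ^ 2) \<le> (\<Sum>p\<in>primes_upto Y. 1 / real p ^ 2)" using QY by (intro sum_mono2) auto
      then have "(\<Sum>p\<in>Q. 1 / real p ^ 2) \<le> 2" using sum_inverse_prime_squares_le[of Y] by linarith
      then have "q\<^sup>2 / 4 * (\<Sum>p\<in>Q. 1 / real p ^ 2) \<le> q\<^sup>2 / 4 * 2" by (intro mult_left_mono) auto
      ultimately show ?thesis by (simp add: c2_def algebra_simps)
    qed
    ultimately have "exp (q / 2 * L - c2) / 2 \<le> norm (dirichlet_lift N (\<lambda>p. of_real (r p)))"
      using lower by linarith
    then have Bq: "(exp (q / 2 * L - c2) / 2) powr q \<le> norm (dirichlet_lift N (\<lambda>p. of_real (r p))) powr q"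
      using q by (intro powr_mono2) auto
    have "exp (q / 2 * L - c2) / 2 = exp (q / 2 * L) * (exp (- c2) / 2)" by (simp flip: exp_add)
    then have "(exp (q / 2 * L - c2) / 2) powr q = exp (q / 2 * L) powr q * (exp (- c2) / 2) powr q"
      by (simp only: powr_mult)
    also have "exp (q / 2 * L) powr q = exp (q\<^sup>2 / 2 * L)" by (simp add: powr_def power2_eq_square mult_ac)
    finally have e: "(exp (q / 2 * L - c2) / 2) powr q = exp (q\<^sup>2 / 2 * L) * (exp (- c2) / 2) powr q" .
    have "c * ln (real Y) powr (q\<^sup>2 / 4) = c * exp (q\<^sup>2 / 4 * L)" using lnY by (simp add: powr_def L_def)
    also have "exp (q\<^sup>2 / 4 * L) = exp (- (q\<^sup>2 / 4 * L)) * exp (q\<^sup>2 / 2 * L)" by (simp flip: exp_add)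
    also have "c * (exp (- (q\<^sup>2 / 4 * L)) * exp (q\<^sup>2 / 2 * L))
       = exp (- c1) * exp (- (q\<^sup>2 / 4 * L)) * (exp (q / 2 * L - c2) / 2) powr q"
      unfolding c_def e by (simp add: mult_ac)
    also have "\<dots> \<le> (\<Prod>p\<in>primes_upto N. 1 - (r p)\<^sup>2) * norm (dirichlet_lift N (\<lambda>p. of_real (r p))) powr q"
    proof (rule mult_mono[OF A Bq])
      have "1 - (r p)\<^sup>2 \<ge> 0" for p using r2le[of p] by linarith
      then show "0 \<le> (\<Prod>p\<in>primes_upto N. 1 - (r p)\<^sup>2)" by (intro prod_nonneg) auto
    qed simp
    also have "\<dots> \<le> lift_moment q N (dirichlet_lift N)"
      by (rule dirichlet_lift_moment_ge[OF q r])
    finally show ?thesis .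
  qed
  show ?thesis by (rule that[OF c main])
qed

lemma dirichlet_norm_lower_bound:
  fixes q :: real
  assumes q: "q > 0"
  shows "\<exists>K>0. \<forall>N\<ge>2. ln (real N) powr (q / 4) \<le> K * dirichlet_norm q (D N)"
proof -
  obtain c where c: "c > 0"
    "\<And>N Y. \<lbrakk>2 \<le> Y; Y \<le> N; 2 * q * ln (real Y) \<le> ln (real N)\<rbrakk> \<Longrightarrow>
      c * ln (real Y) powr (q\<^sup>2 / 4) \<le> lift_moment q N (dirichlet_lift N)"
    using euler_point_lower[OF q] by blast
  \<comment> \<open>\<open>Y \<le> N\<^bsup>1/k\<^esup>\<close> with \<open>k \<ge> 2 q\<close> is the range allowed by the truncation. For \<open>N < 2\<^sup>k\<close> there is no such
    \<open>Y \<ge> 2\<close>, but then \<open>ln N\<close> is bounded and evaluation at the origin suffices.\<close>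
  define k where "k = nat \<lceil>2 * q\<rceil>"
  have k: "k \<ge> 1" "real k \<ge> 2 * q" using q unfolding k_def by (auto simp: Suc_le_eq)
  define K1 where "K1 = (2 * real k) powr (q / 4) / c powr (1 / q)"
  define K2 where "K2 = (real k * ln 2) powr (q / 4)"
  have K: "K1 > 0" "K2 > 0" using k c by (auto simp: K1_def K2_def)
  show ?thesis
  proof (intro exI[of _ "K1 + K2"] conjI allI impI)
    show "K1 + K2 > 0" using K by simp
    fix N :: nat assume N: "N \<ge> 2"
    define I where "I = lift_moment q N (dirichlet_lift N)"
    have dn: "dirichlet_norm q (D N) = I powr (1 / q)" unfolding I_def by (rule dirichlet_norm_eq_torus[OF q])
    have "ln (real N) powr (q / 4) \<le> K1 * I powr (1 / q) \<or> ln (real N) powr (q / 4) \<le> K2 * I powr (1 / q)"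
    proof (cases "2 ^ k \<le> N")
      case True
      obtain Y where Y: "Y \<ge> 2" "Y \<le> N" "real k * ln (real Y) \<le> ln (real N)" "ln (real N) \<le> 2 * real k * ln (real Y)"
        using large_root_exists[OF k(1) True] by blast
      have lnY: "ln (real Y) > 0" using Y(1) by simp
      have "2 * q * ln (real Y) \<le> real k * ln (real Y)" using k(2) lnY by (intro mult_right_mono) auto
      then have "2 * q * ln (real Y) \<le> ln (real N)" using Y(3) by linarith
      then have "c * ln (real Y) powr (q\<^sup>2 / 4) \<le> I" unfolding I_def by (rule c(2)[OF Y(1,2)])
      then have "(c * ln (real Y) powr (q\<^sup>2 / 4)) powr (1 / q) \<le> I powr (1 / q)"
        using q c by (intro powr_mono2) auto
      also have "(c * ln (real Y) powr (q\<^sup>2 / 4)) powr (1 / q) = c powr (1 / q) * ln (real Y) powr (q / 4)"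
        using q by (simp add: powr_mult powr_powr power2_eq_square)
      finally have 1: "ln (real Y) powr (q / 4) \<le> I powr (1 / q) / c powr (1 / q)"
        using c by (simp add: field_simps)
      have "ln (real N) powr (q / 4) \<le> (2 * real k * ln (real Y)) powr (q / 4)"
        using Y(4) N q by (intro powr_mono2) auto
      also have "\<dots> = (2 * real k) powr (q / 4) * ln (real Y) powr (q / 4)" by (rule powr_mult)
      also have "\<dots> \<le> (2 * real k) powr (q / 4) * (I powr (1 / q) / c powr (1 / q))"
        using 1 by (intro mult_left_mono) auto
      finally show ?thesis by (simp add: K1_def)
    next
      case False
      have "real N \<le> 2 ^ k" using False by (metis not_le less_imp_le of_nat_le_iff of_nat_numeral of_nat_power)
      then have "ln (real N) \<le> ln (2 ^ k)" using N by (subst ln_le_cancel_iff) auto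
      then have "ln (real N) \<le> real k * ln 2" by (simp add: ln_realpow)
      then have "ln (real N) powr (q / 4) \<le> K2" unfolding K2_def using N q by (intro powr_mono2) auto
      moreover have "1 \<le> I"
      proof -
        have "(\<Sum>S | S \<subseteq> {} \<and> (\<Sum>p\<in>S. ln (real p)) \<le> ln (real N). \<Prod>p\<in>S. (0 :: real) * real p powr (- 1 / 2))
           \<le> norm (dirichlet_lift N (\<lambda>p. of_real 0))"
          by (rule dirichlet_lift_ge_subset_sum) (use N in auto)
        moreover have "{S. S \<subseteq> {} \<and> (\<Sum>p\<in>S. ln (real p)) \<le> ln (real N)} = {{}}" using N by auto
        ultimately have "1 \<le> norm (dirichlet_lift N (\<lambda>p. of_real 0))" by simp
        then have "1 \<le> norm (dirichlet_lift N (\<lambda>p. of_real 0)) powr q" using q by (intro ge_one_powr_ge_zero) auto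
        also have "\<dots> \<le> I" unfolding I_def using dirichlet_lift_moment_ge[OF q, of "\<lambda>_. 0" N] by simp
        finally show ?thesis .
      qed
      then have "1 \<le> I powr (1 / q)" using q by (intro ge_one_powr_ge_zero) auto
      then have "K2 * 1 \<le> K2 * I powr (1 / q)" using K by (intro mult_left_mono) auto
      ultimately show ?thesis by linarith
    qed
    moreover have "0 \<le> K1 * I powr (1 / q)" "0 \<le> K2 * I powr (1 / q)" using K by auto
    ultimately show "ln (real N) powr (q / 4) \<le> (K1 + K2) * dirichlet_norm q (D N)"
      unfolding dn distrib_right by linarith
  qed
qed

section \<open>Conjugate functions of Dirichlet polynomials\<close>

text \<open>
  The partial derivatives are named explicitly because the Laplacian of the composition with a holomorphic function is
  computed from them by the chain rule.
\<close>
definition C2_partials :: "(real \<Rightarrow> real \<Rightarrow> real) \<Rightarrow> (real \<Rightarrow> real \<Rightarrow> real) \<Rightarrow> (real \<Rightarrow> real \<Rightarrow> real) \<Rightarrow>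
    (real \<Rightarrow> real \<Rightarrow> real) \<Rightarrow> (real \<Rightarrow> real \<Rightarrow> real) \<Rightarrow> (real \<Rightarrow> real \<Rightarrow> real) \<Rightarrow> bool" where
  "C2_partials \<Phi> \<Phi>x \<Phi>y \<Phi>xx \<Phi>xy \<Phi>yy \<longleftrightarrow>
     (\<forall>x y. ((\<lambda>z. \<Phi> (fst z) (snd z)) has_derivative (\<lambda>h. \<Phi>x x y * fst h + \<Phi>y x y * snd h)) (at (x, y))) \<and>
     (\<forall>x y. ((\<lambda>z. \<Phi>x (fst z) (snd z)) has_derivative (\<lambda>h. \<Phi>xx x y * fst h + \<Phi>xy x y * snd h)) (at (x, y))) \<and>
     (\<forall>x y. ((\<lambda>z. \<Phi>y (fst z) (snd z)) has_derivative (\<lambda>h. \<Phi>xy x y * fst h + \<Phi>yy x y * snd h)) (at (x, y))) \<and>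
     continuous_on UNIV (\<lambda>z. \<Phi>xx (fst z) (snd z)) \<and>
     continuous_on UNIV (\<lambda>z. \<Phi>xy (fst z) (snd z)) \<and>
     continuous_on UNIV (\<lambda>z. \<Phi>yy (fst z) (snd z))"

lemma has_derivative_along_curve:
  fixes \<Phi> :: "real \<Rightarrow> real \<Rightarrow> real"
  assumes "((\<lambda>z. \<Phi> (fst z) (snd z)) has_derivative (\<lambda>h. A * fst h + B * snd h)) (at (u s, v s))"
    and "(u has_real_derivative u') (at s)" "(v has_real_derivative v') (at s)"
  shows "((\<lambda>s. \<Phi> (u s) (v s)) has_real_derivative A * u' + B * v') (at s)"
proof -
  have "((\<lambda>s. (u s, v s)) has_derivative (\<lambda>h. (h * u', h * v'))) (at s)"
    using assms(2,3) by (intro has_derivative_Pair) (auto simp: has_field_derivative_def mult.commute[of _ u'] mult.commute[of _ v'])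
  from has_derivative_compose[OF this assms(1)]
  have "((\<lambda>s. \<Phi> (u s) (v s)) has_derivative (\<lambda>h. A * (h * u') + B * (h * v'))) (at s)" by simp
  then show ?thesis
    unfolding has_field_derivative_def by (rule has_derivative_eq_rhs) (auto simp: algebra_simps)
qed

lemma has_derivative_imp_continuous_on_pair:
  fixes f :: "real \<times> real \<Rightarrow> real"
  assumes "\<And>x y. (f has_derivative f' x y) (at (x, y))"
  shows "continuous_on UNIV f"
  using assms by (auto intro!: continuous_at_imp_continuous_on has_derivative_continuous)

abbreviation frequency_sum :: "(nat \<Rightarrow> complex) \<Rightarrow> (nat \<Rightarrow> real) \<Rightarrow> nat set \<Rightarrow> real \<Rightarrow> complex" where
  "frequency_sum a \<nu> J t \<equiv> \<Sum>j\<in>J. a j * exp (- of_real (\<nu> j) * (\<i> * of_real t))"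

abbreviation conjugate_bound :: "real \<Rightarrow> real \<Rightarrow> bool" where
  "conjugate_bound q C \<equiv> \<forall>a \<nu> J. finite J \<longrightarrow> (\<forall>j\<in>J. \<nu> j > 0) \<longrightarrow>
    (\<forall>\<^sub>F T in at_top. integral {0..T} (\<lambda>t. norm (frequency_sum a \<nu> J t) powr q)
       \<le> C * (integral {0..T} (\<lambda>t. \<bar>Re (frequency_sum a \<nu> J t)\<bar> powr q) + T))"

text \<open>
  Put \<open>\<phi>(\<sigma>, t) = \<Phi>(F(\<sigma> + it))\<close> and \<open>g(\<sigma>) = \<integral>\<^sub>0\<^sup>T \<phi>(\<sigma>, t) dt\<close>. As \<open>\<phi>\<close> is subharmonic,
  \<open>g'' \<ge> - \<integral> \<phi>\<^sub>t\<^sub>t\<close>, and this integral is a boundary term that does not grow with \<open>T\<close>. So \<open>g\<close> is convex up to \<open>O(1)\<close> and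
  \<open>g(0) \<ge> 2 g(L) - g(2L) - O(L\<^sup>2)\<close>. For large \<open>L\<close> both \<open>g(L)\<close> and \<open>g(2L)\<close> are close to \<open>T \<Phi>(0)\<close>, because
  \<open>F\<close> tends to \<open>0\<close>. Working with finite \<open>T\<close> avoids the question whether these means converge.
\<close>
lemma subharmonic_mean_eventually_ge:
  fixes a :: "nat \<Rightarrow> complex" and \<nu> :: "nat \<Rightarrow> real"
  assumes C2: "C2_partials \<Phi> \<Phi>x \<Phi>y \<Phi>xx \<Phi>xy \<Phi>yy"
    and sub: "\<And>x y. \<Phi>xx x y + \<Phi>yy x y \<ge> 0"
    and J: "finite J" "\<And>j. j \<in> J \<Longrightarrow> \<nu> j > 0"
    and "\<epsilon> > 0"
  defines "F \<equiv> \<lambda>t. \<Sum>j\<in>J. a j * exp (- of_real (\<nu> j) * (\<i> * of_real t))"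
  shows "\<forall>\<^sub>F T in at_top. T * (\<Phi> 0 0 - \<epsilon>) \<le> integral {0..T} (\<lambda>t. \<Phi> (Re (F t)) (Im (F t)))"
proof -
  define E where "E = (\<lambda>k s t. \<Sum>j\<in>J. (- of_real (\<nu> j)) ^ k * a j * exp (- of_real (\<nu> j) * (of_real s + \<i> * of_real t)))"
  define B where "B = (\<lambda>k. \<Sum>j\<in>J. \<nu> j ^ k * norm (a j))"
  note d = C2[unfolded C2_partials_def]
  have d0: "((\<lambda>z. \<Phi> (fst z) (snd z)) has_derivative (\<lambda>h. \<Phi>x x y * fst h + \<Phi>y x y * snd h)) (at (x, y))"
   and dx: "((\<lambda>z. \<Phi>x (fst z) (snd z)) has_derivative (\<lambda>h. \<Phi>xx x y * fst h + \<Phi>xy x y * snd h)) (at (x, y))"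
   and dy: "((\<lambda>z. \<Phi>y (fst z) (snd z)) has_derivative (\<lambda>h. \<Phi>xy x y * fst h + \<Phi>yy x y * snd h)) (at (x, y))" for x y
    using d by auto
  have cont: "continuous_on UNIV (\<lambda>z. \<Phi> (fst z) (snd z))" "continuous_on UNIV (\<lambda>z. \<Phi>x (fst z) (snd z))"
    "continuous_on UNIV (\<lambda>z. \<Phi>y (fst z) (snd z))" "continuous_on UNIV (\<lambda>z. \<Phi>xx (fst z) (snd z))"
    "continuous_on UNIV (\<lambda>z. \<Phi>xy (fst z) (snd z))" "continuous_on UNIV (\<lambda>z. \<Phi>yy (fst z) (snd z))"
    using has_derivative_imp_continuous_on_pair[OF d0] has_derivative_imp_continuous_on_pair[OF dx]
      has_derivative_imp_continuous_on_pair[OF dy] d by auto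
  have dE: "((\<lambda>z. \<Sum>j\<in>J. (- of_real (\<nu> j)) ^ k * a j * exp (- of_real (\<nu> j) * z)) has_field_derivative
      E (Suc k) s t) (at (of_real s + \<i> * of_real t))" for k s t
    unfolding E_def by (auto intro!: derivative_eq_intros sum.cong simp: mult_ac)
  have Es: "((\<lambda>s. E k s t) has_vector_derivative E (Suc k) s t) (at s)" for k s t
  proof -
    have "((\<lambda>s. of_real s + \<i> * of_real t) has_vector_derivative 1) (at s)"
      by (auto intro!: derivative_eq_intros simp: has_vector_derivative_def scaleR_conv_of_real)
    from field_vector_diff_chain_at[OF this dE] show ?thesis by (simp add: E_def o_def)
  qed
  have Et: "((\<lambda>t. E k s t) has_vector_derivative \<i> * E (Suc k) s t) (at t)" for k s t
  proof -
    have "((\<lambda>t. of_real s + \<i> * of_real t) has_vector_derivative \<i>) (at t)"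
      by (auto intro!: derivative_eq_intros simp: has_vector_derivative_def scaleR_conv_of_real)
    from field_vector_diff_chain_at[OF this dE] show ?thesis by (simp add: E_def o_def)
  qed
  define X Y P Q R S where "X = (\<lambda>s t. Re (E 0 s t))" and "Y = (\<lambda>s t. Im (E 0 s t))"
    and "P = (\<lambda>s t. Re (E 1 s t))" and "Q = (\<lambda>s t. Im (E 1 s t))"
    and "R = (\<lambda>s t. Re (E 2 s t))" and "S = (\<lambda>s t. Im (E 2 s t))"
  have Re_d: "((\<lambda>s. Re (f s)) has_real_derivative Re f') (at s)"
   and Im_d: "((\<lambda>s. Im (f s)) has_real_derivative Im f') (at s)"
    if "(f has_vector_derivative f') (at s)" for f :: "real \<Rightarrow> complex" and f' s
    using bounded_linear.has_vector_derivative[OF bounded_linear_Re that]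
      bounded_linear.has_vector_derivative[OF bounded_linear_Im that]
    by (auto simp: has_real_derivative_iff_has_vector_derivative)
  have ds: "((\<lambda>s. X s t) has_real_derivative P s t) (at s)" "((\<lambda>s. Y s t) has_real_derivative Q s t) (at s)"
    "((\<lambda>s. P s t) has_real_derivative R s t) (at s)" "((\<lambda>s. Q s t) has_real_derivative S s t) (at s)" for s t
    unfolding X_def Y_def P_def Q_def R_def S_def
    using Re_d[OF Es[of 0]] Im_d[OF Es[of 0]] Re_d[OF Es[of 1]] Im_d[OF Es[of 1]] by (simp_all add: numeral_2_eq_2)
  have dt: "((\<lambda>t. X s t) has_real_derivative - Q s t) (at t)" "((\<lambda>t. Y s t) has_real_derivative P s t) (at t)"
    "((\<lambda>t. P s t) has_real_derivative - S s t) (at t)" "((\<lambda>t. Q s t) has_real_derivative R s t) (at t)" for s t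
    unfolding X_def Y_def P_def Q_def R_def S_def
    using Re_d[OF Et[of 0]] Im_d[OF Et[of 0]] Re_d[OF Et[of 1]] Im_d[OF Et[of 1]] by (simp_all add: numeral_2_eq_2)
  define \<phi> where "\<phi> = (\<lambda>s t. \<Phi> (X s t) (Y s t))"
  define \<phi>s where "\<phi>s = (\<lambda>s t. \<Phi>x (X s t) (Y s t) * P s t + \<Phi>y (X s t) (Y s t) * Q s t)"
  define \<phi>t where "\<phi>t = (\<lambda>s t. \<Phi>x (X s t) (Y s t) * - Q s t + \<Phi>y (X s t) (Y s t) * P s t)"
  define \<phi>ss where "\<phi>ss = (\<lambda>s t.
     (\<Phi>xx (X s t) (Y s t) * P s t + \<Phi>xy (X s t) (Y s t) * Q s t) * P s t + R s t * \<Phi>x (X s t) (Y s t)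
   + ((\<Phi>xy (X s t) (Y s t) * P s t + \<Phi>yy (X s t) (Y s t) * Q s t) * Q s t + S s t * \<Phi>y (X s t) (Y s t)))"
  define \<phi>tt where "\<phi>tt = (\<lambda>s t.
     (\<Phi>xx (X s t) (Y s t) * - Q s t + \<Phi>xy (X s t) (Y s t) * P s t) * - Q s t + - R s t * \<Phi>x (X s t) (Y s t)
   + ((\<Phi>xy (X s t) (Y s t) * - Q s t + \<Phi>yy (X s t) (Y s t) * P s t) * P s t + - S s t * \<Phi>y (X s t) (Y s t)))"
  have d\<phi>: "((\<lambda>s. \<phi> s t) has_real_derivative \<phi>s s t) (at s)" for s t
    unfolding \<phi>_def \<phi>s_def by (rule has_derivative_along_curve[OF d0 ds(1,2)])
  have d\<phi>s: "((\<lambda>s. \<phi>s s t) has_real_derivative \<phi>ss s t) (at s)" for s t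
    unfolding \<phi>s_def \<phi>ss_def
    by (rule DERIV_add[OF DERIV_mult[OF has_derivative_along_curve[OF dx ds(1,2)] ds(3)]
          DERIV_mult[OF has_derivative_along_curve[OF dy ds(1,2)] ds(4)]])
  have d\<phi>t: "((\<lambda>t. \<phi>t s t) has_real_derivative \<phi>tt s t) (at t)" for s t
    unfolding \<phi>t_def \<phi>tt_def
    using DERIV_add[OF DERIV_mult[OF has_derivative_along_curve[OF dx dt(1,2)] DERIV_minus[OF dt(4)]]
          DERIV_mult[OF has_derivative_along_curve[OF dy dt(1,2)] dt(3)]] .
  have lap: "\<phi>ss s t + \<phi>tt s t \<ge> 0" for s t
  proof -
    have "\<phi>ss s t + \<phi>tt s t = (\<Phi>xx (X s t) (Y s t) + \<Phi>yy (X s t) (Y s t)) * (P s t ^ 2 + Q s t ^ 2)"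
      unfolding \<phi>ss_def \<phi>tt_def by (simp add: algebra_simps power2_eq_square)
    then show ?thesis using sub by simp
  qed
  have contE: "continuous_on A (\<lambda>z. E k (f z) (g z))" if "continuous_on A f" "continuous_on A g"
    for A :: "(real \<times> real) set" and f g k
    unfolding E_def by (intro continuous_intros that)
  have contE1: "continuous_on A (\<lambda>z. E k (f z) (g z))" if "continuous_on A f" "continuous_on A g"
    for A :: "real set" and f g k
    unfolding E_def by (intro continuous_intros that)
  have cc: "continuous_on A (\<lambda>z. G (f z) (g z))"
    if "continuous_on UNIV (\<lambda>z. G (fst z) (snd z))" "continuous_on A f" "continuous_on A g"
    for A :: "'z::topological_space set" and f g and G :: "real \<Rightarrow> real \<Rightarrow> real"
    using continuous_on_compose2[OF that(1) continuous_on_Pair[OF that(2,3)]] by simp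
  note ccs = cc[OF cont(1)] cc[OF cont(2)] cc[OF cont(3)] cc[OF cont(4)] cc[OF cont(5)] cc[OF cont(6)]
  have c\<phi>: "continuous_on {0..T} (\<phi> s)" for s T
    unfolding \<phi>_def X_def Y_def by (intro ccs continuous_intros contE1)
  have c\<phi>s: "continuous_on {0..T} (\<phi>s s)" for s T
    unfolding \<phi>s_def X_def Y_def P_def Q_def by (intro ccs continuous_intros contE1)
  have c\<phi>ss: "continuous_on {0..T} (\<phi>ss s)" for s T
    unfolding \<phi>ss_def X_def Y_def P_def Q_def R_def S_def by (intro ccs continuous_intros contE1)
  have c2\<phi>s: "continuous_on (UNIV \<times> cbox 0 T) (\<lambda>(s, t). \<phi>s s t)" for T
    unfolding \<phi>s_def X_def Y_def P_def Q_def split_beta by (intro ccs continuous_intros contE)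
  have c2\<phi>ss: "continuous_on (UNIV \<times> cbox 0 T) (\<lambda>(s, t). \<phi>ss s t)" for T
    unfolding \<phi>ss_def X_def Y_def P_def Q_def R_def S_def split_beta by (intro ccs continuous_intros contE)
  have Eb: "norm (E k s t) \<le> B k" if "s \<ge> 0" for k s t
    unfolding E_def B_def
  proof (rule sum_norm_le)
    fix j assume j: "j \<in> J"
    have "exp (- (\<nu> j * s)) \<le> 1" using J(2)[OF j] that by simp
    then show "norm ((- of_real (\<nu> j)) ^ k * a j * exp (- of_real (\<nu> j) * (of_real s + \<i> * of_real t))) \<le> \<nu> j ^ k * norm (a j)"
      using J(2)[OF j] by (auto simp: norm_mult norm_power mult_left_le)
  qed
  have bdd: "\<exists>K\<ge>0. \<forall>x y. \<bar>x\<bar> \<le> B 0 \<and> \<bar>y\<bar> \<le> B 0 \<longrightarrow> \<bar>G x y\<bar> \<le> K"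
    if "continuous_on UNIV (\<lambda>z. G (fst z) (snd z))" for G :: "real \<Rightarrow> real \<Rightarrow> real"
  proof -
    have "compact ((\<lambda>z. G (fst z) (snd z)) ` ({- B 0..B 0} \<times> {- B 0..B 0}))"
      by (intro compact_continuous_image compact_Times) (auto intro: continuous_on_subset[OF that])
    then have "bounded ((\<lambda>z. G (fst z) (snd z)) ` ({- B 0..B 0} \<times> {- B 0..B 0}))" by (rule compact_imp_bounded)
    then obtain K where K: "K > 0" "\<And>z. z \<in> {- B 0..B 0} \<times> {- B 0..B 0} \<Longrightarrow> \<bar>G (fst z) (snd z)\<bar> \<le> K"
      unfolding bounded_pos by (auto simp del: mem_Times_iff)
    have "\<bar>G x y\<bar> \<le> K" if "\<bar>x\<bar> \<le> B 0" "\<bar>y\<bar> \<le> B 0" for x y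
      using K(2)[of "(x, y)"] that by (auto simp: abs_le_iff)
    then show ?thesis using K(1) by (intro exI[of _ K]) auto
  qed
  obtain K1 where K1: "K1 \<ge> 0" "\<And>x y. \<bar>x\<bar> \<le> B 0 \<Longrightarrow> \<bar>y\<bar> \<le> B 0 \<Longrightarrow> \<bar>\<Phi>x x y\<bar> \<le> K1" using bdd[OF cont(2)] by blast
  obtain K2 where K2: "K2 \<ge> 0" "\<And>x y. \<bar>x\<bar> \<le> B 0 \<Longrightarrow> \<bar>y\<bar> \<le> B 0 \<Longrightarrow> \<bar>\<Phi>y x y\<bar> \<le> K2" using bdd[OF cont(3)] by blast
  define C where "C = (K1 + K2) * B 1"
  have B0: "B k \<ge> 0" for k unfolding B_def using J(2) by (intro sum_nonneg mult_nonneg_nonneg zero_le_power) (auto simp: less_imp_le)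
  have C0: "C \<ge> 0" unfolding C_def using K1 K2 B0 by simp
  have \<phi>tb: "\<bar>\<phi>t s t\<bar> \<le> C" if "s \<ge> 0" for s t
  proof -
    have b: "\<bar>X s t\<bar> \<le> B 0" "\<bar>Y s t\<bar> \<le> B 0" "\<bar>P s t\<bar> \<le> B 1" "\<bar>Q s t\<bar> \<le> B 1"
      unfolding X_def Y_def P_def Q_def
      using order_trans[OF abs_Re_le_cmod Eb[OF that]] order_trans[OF abs_Im_le_cmod Eb[OF that]] by auto
    have "\<bar>\<phi>t s t\<bar> \<le> \<bar>\<Phi>x (X s t) (Y s t)\<bar> * \<bar>Q s t\<bar> + \<bar>\<Phi>y (X s t) (Y s t)\<bar> * \<bar>P s t\<bar>"
      unfolding \<phi>t_def by (rule order_trans[OF abs_triangle_ineq]) (simp add: abs_mult)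
    also have "\<dots> \<le> K1 * B 1 + K2 * B 1"
      using b K1 K2 by (intro add_mono mult_mono) auto
    finally show ?thesis by (simp add: C_def algebra_simps)
  qed
  define g where "g = (\<lambda>T s. integral {0..T} (\<phi> s))"
  have conv: "2 * g T L \<le> g T 0 + g T (2 * L) + 2 * C * L ^ 2" if T: "T \<ge> 0" and L: "L > 0" for T L
  proof -
    define h where "h = (\<lambda>s. g T s + C * s ^ 2)"
    have dg: "(g T has_real_derivative integral {0..T} (\<phi>s s)) (at s)" for s
      unfolding g_def using leibniz_rule_field_derivative[of UNIV 0 T \<phi> \<phi>s s] d\<phi> c2\<phi>s c\<phi>
      by (auto simp: integrable_continuous_real)
    have dg2: "((\<lambda>s. integral {0..T} (\<phi>s s)) has_real_derivative integral {0..T} (\<phi>ss s)) (at s)" for s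
      using leibniz_rule_field_derivative[of UNIV 0 T \<phi>s \<phi>ss s] d\<phi>s c2\<phi>ss c\<phi>s
      by (auto simp: integrable_continuous_real)
    have g2: "integral {0..T} (\<phi>ss s) \<ge> - 2 * C" if "s \<ge> 0" for s
    proof -
      have i: "(\<phi>tt s has_integral (\<phi>t s T - \<phi>t s 0)) {0..T}"
        using T d\<phi>t by (intro fundamental_theorem_of_calculus)
          (auto simp: has_real_derivative_iff_has_vector_derivative[symmetric] intro: has_field_derivative_at_within)
      have "integral {0..T} (\<lambda>t. - \<phi>tt s t) \<le> integral {0..T} (\<phi>ss s)"
      proof (rule integral_le)
        show "(\<lambda>t. - \<phi>tt s t) integrable_on {0..T}" using i by (auto intro: integrable_neg has_integral_integrable)
        show "\<phi>ss s integrable_on {0..T}" using c\<phi>ss by (rule integrable_continuous_real)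
        show "- \<phi>tt s t \<le> \<phi>ss s t" for t using lap[of s t] by linarith
      qed
      moreover have "integral {0..T} (\<lambda>t. - \<phi>tt s t) = - (\<phi>t s T - \<phi>t s 0)"
        using has_integral_neg[OF i] by (rule integral_unique)
      ultimately show ?thesis using \<phi>tb[OF that, of T] \<phi>tb[OF that, of 0] by linarith
    qed
    \<comment> \<open>\<open>h\<close> corrects the defect \<open>g'' \<ge> - 2 C\<close> of convexity.\<close>
    have "convex_on {0..2 * L} h"
    proof (rule f''_ge0_imp_convex)
      show "(h has_real_derivative (integral {0..T} (\<phi>s s) + 2 * C * s)) (at s)" for s
        unfolding h_def by (auto intro!: derivative_eq_intros dg)
      show "((\<lambda>s. integral {0..T} (\<phi>s s) + 2 * C * s) has_real_derivative (integral {0..T} (\<phi>ss s) + 2 * C)) (at s)" for s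
        by (auto intro!: derivative_eq_intros dg2)
      show "0 \<le> integral {0..T} (\<phi>ss s) + 2 * C" if "s \<in> {0..2 * L}" for s
        using g2[of s] that by simp
    qed simp
    from convex_onD[OF this, of "1 / 2" 0 "2 * L"] L
    have "h L \<le> (h 0 + h (2 * L)) / 2" by simp
    then show ?thesis unfolding h_def by (simp add: power_mult_distrib field_simps)
  qed
  have lim: "\<forall>\<^sub>F L in at_top. \<forall>t. \<bar>\<phi> L t - \<Phi> 0 0\<bar> \<le> \<epsilon> / 6"
  proof -
    have "continuous (at (0, 0)) (\<lambda>z. \<Phi> (fst z) (snd z))"
      using cont(1) by (simp add: continuous_on_eq_continuous_at)
    then obtain \<delta> where \<delta>: "\<delta> > 0" "\<And>z. dist z (0, 0) < \<delta> \<Longrightarrow> dist (\<Phi> (fst z) (snd z)) (\<Phi> 0 0) < \<epsilon> / 6"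
      unfolding continuous_at_eps_delta using \<open>\<epsilon> > 0\<close> by (metis divide_pos_pos fst_conv snd_conv zero_less_numeral)
    have "((\<lambda>L. \<Sum>j\<in>J. norm (a j) * exp (- (\<nu> j * L))) \<longlongrightarrow> (\<Sum>j\<in>J. norm (a j) * 0)) at_top"
    proof (intro tendsto_sum tendsto_mult tendsto_const)
      fix j assume "j \<in> J"
      then have "\<nu> j > 0" by (rule J)
      then show "((\<lambda>L. exp (- (\<nu> j * L))) \<longlongrightarrow> 0) at_top"
        by (intro filterlim_compose[OF exp_at_bot] filterlim_compose[OF filterlim_uminus_at_bot_at_top]
             filterlim_tendsto_pos_mult_at_top[OF tendsto_const] filterlim_ident)
    qed
    then have "\<forall>\<^sub>F L in at_top. (\<Sum>j\<in>J. norm (a j) * exp (- (\<nu> j * L))) < \<delta>"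
      using \<delta>(1) by (auto dest: order_tendstoD(2))
    then show ?thesis
    proof eventually_elim
      case (elim L)
      show ?case
      proof
        fix t
        have "norm (E 0 L t) \<le> (\<Sum>j\<in>J. norm (a j) * exp (- (\<nu> j * L)))"
          unfolding E_def by (rule sum_norm_le) (simp add: norm_mult)
        then have "dist (X L t, Y L t) (0, 0) < \<delta>"
          using elim by (simp add: dist_norm norm_Pair X_def Y_def cmod_def)
        from \<delta>(2)[OF this] show "\<bar>\<phi> L t - \<Phi> 0 0\<bar> \<le> \<epsilon> / 6" by (simp add: \<phi>_def dist_norm)
      qed
    qed
  qed
  then obtain L0 where L0: "\<And>L t. L \<ge> L0 \<Longrightarrow> \<bar>\<phi> L t - \<Phi> 0 0\<bar> \<le> \<epsilon> / 6"
    unfolding eventually_at_top_linorder by blast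
  define L where "L = max L0 1"
  have L: "L > 0" "L \<ge> L0" "2 * L \<ge> L0" unfolding L_def by auto
  have gL: "g T M \<le> T * (\<Phi> 0 0 + \<epsilon> / 6)" "T * (\<Phi> 0 0 - \<epsilon> / 6) \<le> g T M" if "M \<ge> L0" "T \<ge> 0" for M T
  proof -
    have i: "\<phi> M integrable_on {0..T}" by (rule integrable_continuous_real[OF c\<phi>])
    have "\<phi> M t \<le> \<Phi> 0 0 + \<epsilon> / 6" "\<Phi> 0 0 - \<epsilon> / 6 \<le> \<phi> M t" for t
      using L0[OF that(1), of t] by linarith+
    then have "integral {0..T} (\<phi> M) \<le> integral {0..T} (\<lambda>t. \<Phi> 0 0 + \<epsilon> / 6)"
      "integral {0..T} (\<lambda>t. \<Phi> 0 0 - \<epsilon> / 6) \<le> integral {0..T} (\<phi> M)"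
      by (intro integral_le i integrable_const_ivl; simp)+
    then show "g T M \<le> T * (\<Phi> 0 0 + \<epsilon> / 6)" "T * (\<Phi> 0 0 - \<epsilon> / 6) \<le> g T M"
      unfolding g_def using that by auto
  qed
  have F: "g T 0 = integral {0..T} (\<lambda>t. \<Phi> (Re (F t)) (Im (F t)))" for T
    unfolding g_def \<phi>_def X_def Y_def E_def F_def by simp
  have "\<forall>\<^sub>F T in at_top. T \<ge> max 0 (4 * C * L ^ 2 / \<epsilon>)" by (rule eventually_ge_at_top)
  then show ?thesis
  proof eventually_elim
    case (elim T)
    then have T: "T \<ge> 0" "4 * C * L ^ 2 \<le> T * \<epsilon>" using \<open>\<epsilon> > 0\<close> by (auto simp: field_simps)
    have "2 * g T L \<le> g T 0 + g T (2 * L) + 2 * C * L ^ 2" by (rule conv[OF T(1) L(1)])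
    moreover have "g T (2 * L) \<le> T * (\<Phi> 0 0 + \<epsilon> / 6)" "T * (\<Phi> 0 0 - \<epsilon> / 6) \<le> g T L"
      using gL L T by auto
    ultimately have "g T 0 \<ge> T * (\<Phi> 0 0 - \<epsilon>)" using T by (simp add: algebra_simps)
    then show ?case by (simp add: F)
  qed
qed

lemma C2_partials_diff:
  assumes "C2_partials \<Phi> \<Phi>x \<Phi>y \<Phi>xx \<Phi>xy \<Phi>yy" "C2_partials \<Psi> \<Psi>x \<Psi>y \<Psi>xx \<Psi>xy \<Psi>yy"
  shows "C2_partials (\<lambda>x y. c * \<Phi> x y - \<Psi> x y) (\<lambda>x y. c * \<Phi>x x y - \<Psi>x x y) (\<lambda>x y. c * \<Phi>y x y - \<Psi>y x y)
    (\<lambda>x y. c * \<Phi>xx x y - \<Psi>xx x y) (\<lambda>x y. c * \<Phi>xy x y - \<Psi>xy x y) (\<lambda>x y. c * \<Phi>yy x y - \<Psi>yy x y)"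
proof -
  have *: "((\<lambda>z. c * f z - g z) has_derivative (\<lambda>h. (c * A - A') * fst h + (c * B - B') * snd h)) (at z)"
    if "(f has_derivative (\<lambda>h. A * fst h + B * snd h)) (at z)" "(g has_derivative (\<lambda>h. A' * fst h + B' * snd h)) (at z)"
    for f g :: "real \<times> real \<Rightarrow> real" and A B A' B' z
    using has_derivative_diff[OF has_derivative_mult_right[OF that(1), of c] that(2)]
    by (simp add: algebra_simps)
  show ?thesis
    using assms unfolding C2_partials_def
    by (intro conjI allI * continuous_intros) blast+
qed

lemma C2_partials_square_mult:
  assumes "C2_partials \<Phi> \<Phi>x \<Phi>y \<Phi>xx \<Phi>xy \<Phi>yy"
  shows "C2_partials (\<lambda>x y. x\<^sup>2 * \<Phi> x y) (\<lambda>x y. 2 * x * \<Phi> x y + x\<^sup>2 * \<Phi>x x y) (\<lambda>x y. x\<^sup>2 * \<Phi>y x y)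
    (\<lambda>x y. 2 * \<Phi> x y + 4 * x * \<Phi>x x y + x\<^sup>2 * \<Phi>xx x y) (\<lambda>x y. 2 * x * \<Phi>y x y + x\<^sup>2 * \<Phi>xy x y)
    (\<lambda>x y. x\<^sup>2 * \<Phi>yy x y)"
proof -
  note d = assms[unfolded C2_partials_def]
  have d0: "((\<lambda>z. \<Phi> (fst z) (snd z)) has_derivative (\<lambda>h. \<Phi>x x y * fst h + \<Phi>y x y * snd h)) (at (x, y))"
   and dx: "((\<lambda>z. \<Phi>x (fst z) (snd z)) has_derivative (\<lambda>h. \<Phi>xx x y * fst h + \<Phi>xy x y * snd h)) (at (x, y))"
   and dy: "((\<lambda>z. \<Phi>y (fst z) (snd z)) has_derivative (\<lambda>h. \<Phi>xy x y * fst h + \<Phi>yy x y * snd h)) (at (x, y))" for x y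
    using d by auto
  have c: "continuous_on UNIV (\<lambda>z. \<Phi> (fst z) (snd z))" "continuous_on UNIV (\<lambda>z. \<Phi>x (fst z) (snd z))"
    "continuous_on UNIV (\<lambda>z. \<Phi>y (fst z) (snd z))"
    using has_derivative_imp_continuous_on_pair[OF d0] has_derivative_imp_continuous_on_pair[OF dx]
      has_derivative_imp_continuous_on_pair[OF dy] by auto
  have sq: "((\<lambda>z. (fst z)\<^sup>2) has_derivative (\<lambda>h. 2 * x * fst h)) (at (x, y))" for x y :: real
    by (auto intro!: derivative_eq_intros)
  have lin: "((\<lambda>z. 2 * fst z) has_derivative (\<lambda>h. 2 * fst h)) (at (x, y))" for x y :: real
    by (auto intro!: derivative_eq_intros)
  show ?thesis
    unfolding C2_partials_def
  proof (intro conjI allI)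
    fix x y
    show "((\<lambda>z. (fst z)\<^sup>2 * \<Phi> (fst z) (snd z)) has_derivative
        (\<lambda>h. (2 * x * \<Phi> x y + x\<^sup>2 * \<Phi>x x y) * fst h + x\<^sup>2 * \<Phi>y x y * snd h)) (at (x, y))"
      using has_derivative_mult[OF sq d0] by (rule has_derivative_eq_rhs) (auto simp: algebra_simps)
    show "((\<lambda>z. 2 * fst z * \<Phi> (fst z) (snd z) + (fst z)\<^sup>2 * \<Phi>x (fst z) (snd z)) has_derivative
        (\<lambda>h. (2 * \<Phi> x y + 4 * x * \<Phi>x x y + x\<^sup>2 * \<Phi>xx x y) * fst h + (2 * x * \<Phi>y x y + x\<^sup>2 * \<Phi>xy x y) * snd h)) (at (x, y))"
      using has_derivative_add[OF has_derivative_mult[OF lin d0] has_derivative_mult[OF sq dx]]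
      by (rule has_derivative_eq_rhs) (auto simp: algebra_simps)
    show "((\<lambda>z. (fst z)\<^sup>2 * \<Phi>y (fst z) (snd z)) has_derivative
        (\<lambda>h. (2 * x * \<Phi>y x y + x\<^sup>2 * \<Phi>xy x y) * fst h + x\<^sup>2 * \<Phi>yy x y * snd h)) (at (x, y))"
      using has_derivative_mult[OF sq dy] by (rule has_derivative_eq_rhs) (auto simp: algebra_simps)
  qed (use d c in \<open>intro continuous_intros; blast\<close>)+
qed

lemma C2_partials_powr:
  fixes c n :: real
  assumes "c \<ge> 0"
  defines "\<rho> \<equiv> \<lambda>x y. 1 + x\<^sup>2 + c * y\<^sup>2"
  shows "C2_partials (\<lambda>x y. \<rho> x y powr n) (\<lambda>x y. 2 * n * x * \<rho> x y powr (n - 1)) (\<lambda>x y. 2 * n * c * y * \<rho> x y powr (n - 1))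
    (\<lambda>x y. 2 * n * \<rho> x y powr (n - 1) + 4 * n * (n - 1) * x\<^sup>2 * \<rho> x y powr (n - 2))
    (\<lambda>x y. 4 * n * (n - 1) * c * x * y * \<rho> x y powr (n - 2))
    (\<lambda>x y. 2 * n * c * \<rho> x y powr (n - 1) + 4 * n * (n - 1) * c\<^sup>2 * y\<^sup>2 * \<rho> x y powr (n - 2))"
proof -
  have pos: "\<rho> x y > 0" for x y using assms(1) by (simp add: \<rho>_def add_pos_nonneg)
  have d\<rho>: "((\<lambda>z. \<rho> (fst z) (snd z)) has_derivative (\<lambda>h. 2 * x * fst h + 2 * c * y * snd h)) (at (x, y))" for x y
    unfolding \<rho>_def by (auto intro!: derivative_eq_intros)
  have p: "((\<lambda>z. \<rho> (fst z) (snd z) powr m) has_derivative (\<lambda>h. (2 * x * fst h + 2 * c * y * snd h) * (m * \<rho> x y powr (m - 1)))) (at (x, y))" for m x y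
    using DERIV_compose_FDERIV[OF _ d\<rho>, of "\<lambda>w. w powr m" "m * \<rho> x y powr (m - 1)"] pos[of x y]
    by (auto intro!: has_real_derivative_powr)
  have lin: "((\<lambda>z. k * fst z) has_derivative (\<lambda>h. k * fst h)) (at (x, y))"
       "((\<lambda>z. k * snd z) has_derivative (\<lambda>h. k * snd h)) (at (x, y))" for x y k :: real
    by (auto intro!: derivative_eq_intros)
  have cont: "continuous_on UNIV (\<lambda>z. \<rho> (fst z) (snd z) powr m)" for m
    unfolding \<rho>_def using pos unfolding \<rho>_def
    by (intro continuous_intros) (metis less_irrefl)
  show ?thesis
    unfolding C2_partials_def
  proof (intro conjI allI)
    fix x y
    show "((\<lambda>z. \<rho> (fst z) (snd z) powr n) has_derivative
        (\<lambda>h. 2 * n * x * \<rho> x y powr (n - 1) * fst h + 2 * n * c * y * \<rho> x y powr (n - 1) * snd h)) (at (x, y))"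
      using p by (rule has_derivative_eq_rhs) (auto simp: algebra_simps)
    show "((\<lambda>z. 2 * n * fst z * \<rho> (fst z) (snd z) powr (n - 1)) has_derivative
        (\<lambda>h. (2 * n * \<rho> x y powr (n - 1) + 4 * n * (n - 1) * x\<^sup>2 * \<rho> x y powr (n - 2)) * fst h
           + 4 * n * (n - 1) * c * x * y * \<rho> x y powr (n - 2) * snd h)) (at (x, y))"
      using has_derivative_mult[OF lin(1) p] by (rule has_derivative_eq_rhs) (auto simp: algebra_simps power2_eq_square)
    show "((\<lambda>z. 2 * n * c * snd z * \<rho> (fst z) (snd z) powr (n - 1)) has_derivative
        (\<lambda>h. 4 * n * (n - 1) * c * x * y * \<rho> x y powr (n - 2) * fst h
           + (2 * n * c * \<rho> x y powr (n - 1) + 4 * n * (n - 1) * c\<^sup>2 * y\<^sup>2 * \<rho> x y powr (n - 2)) * snd h)) (at (x, y))"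
      using has_derivative_mult[OF lin(2) p] by (rule has_derivative_eq_rhs) (auto simp: algebra_simps power2_eq_square)
  qed (intro continuous_intros cont)+
qed

text \<open>
  Any subharmonic \<open>\<Phi>\<close> that separates \<open>|w|\<^sup>q\<close> from \<open>|Re w|\<^sup>q\<close> in this sense yields the bound: integrate the
  inequality along the line and use that the mean of \<open>\<Phi>(F)\<close> is eventually at least \<open>\<Phi>(0) - 1\<close>.
\<close>
lemma conjugate_function_boundI:
  fixes q K B :: real
  assumes C2: "C2_partials \<Phi> \<Phi>x \<Phi>y \<Phi>xx \<Phi>xy \<Phi>yy" and sub: "\<And>x y. \<Phi>xx x y + \<Phi>yy x y \<ge> 0"
    and q: "q > 0" and K: "K \<ge> 0" "B \<ge> 0"
    and pt: "\<And>w. norm w powr q + B * \<Phi> (Re w) (Im w) \<le> K * (\<bar>Re w\<bar> powr q + 1)"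
  shows "\<exists>C\<ge>0. conjugate_bound q C"
proof -
  define C where "C = K + B * \<bar>\<Phi> 0 0 - 1\<bar>"
  have C: "C \<ge> 0" using K by (simp add: C_def)
  have d0: "((\<lambda>z. \<Phi> (fst z) (snd z)) has_derivative (\<lambda>h. \<Phi>x x y * fst h + \<Phi>y x y * snd h)) (at (x, y))" for x y
    using C2 by (simp add: C2_partials_def)
  show ?thesis
  proof (intro exI[of _ C] conjI C allI impI)
    fix a :: "nat \<Rightarrow> complex" and \<nu> :: "nat \<Rightarrow> real" and J :: "nat set"
    assume J: "finite J" "\<forall>j\<in>J. \<nu> j > 0"
    define F where "F = frequency_sum a \<nu> J"
    have cF: "continuous_on S F" for S unfolding F_def by (intro continuous_intros)
    have "\<forall>\<^sub>F T in at_top. T * (\<Phi> 0 0 - 1) \<le> integral {0..T} (\<lambda>t. \<Phi> (Re (F t)) (Im (F t)))"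
      unfolding F_def by (rule subharmonic_mean_eventually_ge[OF C2 sub J(1)]) (use J(2) in auto)
    moreover have "\<forall>\<^sub>F T in at_top. (T :: real) \<ge> 0" by (rule eventually_ge_at_top)
    ultimately have "\<forall>\<^sub>F T in at_top. integral {0..T} (\<lambda>t. norm (F t) powr q)
       \<le> C * (integral {0..T} (\<lambda>t. \<bar>Re (F t)\<bar> powr q) + T)"
    proof eventually_elim
      case (elim T)
      have i1: "(\<lambda>t. norm (F t) powr q) integrable_on {0..T}"
        and i2: "(\<lambda>t. \<bar>Re (F t)\<bar> powr q) integrable_on {0..T}"
        using q by (intro integrable_continuous_real continuous_on_powr' continuous_intros cF; simp)+
      have i3: "(\<lambda>t. \<Phi> (Re (F t)) (Im (F t))) integrable_on {0..T}"
      proof -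
        have "continuous_on {0..T} (\<lambda>t. \<Phi> (fst (Re (F t), Im (F t))) (snd (Re (F t), Im (F t))))"
          by (rule continuous_on_compose2[OF has_derivative_imp_continuous_on_pair[OF d0]])
             (auto intro!: continuous_intros cF)
        then show ?thesis by (simp add: integrable_continuous_real)
      qed
      define I where "I = integral {0..T} (\<lambda>t. \<bar>Re (F t)\<bar> powr q)"
      define Y where "Y = integral {0..T} (\<lambda>t. \<Phi> (Re (F t)) (Im (F t)))"
      have I: "I \<ge> 0" unfolding I_def by (intro integral_nonneg i2) auto
      have "integral {0..T} (\<lambda>t. norm (F t) powr q + B * \<Phi> (Re (F t)) (Im (F t)))
        \<le> integral {0..T} (\<lambda>t. K * (\<bar>Re (F t)\<bar> powr q + 1))"
        by (intro integral_le integrable_add i1 i3 integrable_on_mult_right i2 integrable_const_ivl pt)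
      also have "\<dots> = K * (I + T)"
        using elim(2) by (simp add: I_def integral_add i2 integrable_const_ivl)
      finally have "integral {0..T} (\<lambda>t. norm (F t) powr q) + B * Y \<le> K * (I + T)"
        by (simp add: integral_add i1 i3 integrable_on_mult_right Y_def)
      moreover have "B * (T * (\<Phi> 0 0 - 1)) \<le> B * Y"
        using elim(1) K unfolding Y_def by (intro mult_left_mono)
      moreover have "- (B * (T * (\<Phi> 0 0 - 1))) \<le> B * \<bar>\<Phi> 0 0 - 1\<bar> * (I + T)"
      proof -
        have "T * - (\<Phi> 0 0 - 1) \<le> T * \<bar>\<Phi> 0 0 - 1\<bar>" using elim(2) by (intro mult_left_mono) auto
        also have "\<dots> \<le> (I + T) * \<bar>\<Phi> 0 0 - 1\<bar>" using I by (intro mult_right_mono) auto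
        finally have "B * (T * - (\<Phi> 0 0 - 1)) \<le> B * ((I + T) * \<bar>\<Phi> 0 0 - 1\<bar>)" using K by (intro mult_left_mono)
        then show ?thesis by (simp only: mult_minus_right mult.assoc mult.commute[of "I + T"])
      qed
      ultimately show ?case unfolding C_def I_def[symmetric] distrib_right by linarith
    qed
    then show "\<forall>\<^sub>F T in at_top. integral {0..T} (\<lambda>t. norm (frequency_sum a \<nu> J t) powr q)
       \<le> C * (integral {0..T} (\<lambda>t. \<bar>Re (frequency_sum a \<nu> J t)\<bar> powr q) + T)"
      unfolding F_def .
  qed
qed

text \<open>
  For \<open>1 < q \<le> 2\<close> take \<open>\<Phi> = A |x|\<^sup>q - |w|\<^sup>q\<close>. It is subharmonic for large \<open>A\<close> because the Laplacians are \<open>q (q - 1) |x|\<^bsup>q-2\<^esup>\<close> and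
  \<open>q\<^sup>2 |w|\<^bsup>q-2\<^esup>\<close>, and \<open>|x| \<le> |w|\<close> with \<open>q - 2 \<le> 0\<close>. Adding \<open>1\<close> to \<open>x\<^sup>2\<close> and \<open>|w|\<^sup>2\<close> makes
  \<open>\<Phi>\<close> smooth at the price of the additive term \<open>T\<close>.
\<close>
lemma conjugate_function_bound_small:
  fixes q :: real
  assumes q: "1 < q" "q \<le> 2"
  shows "\<exists>C\<ge>0. conjugate_bound q C"
proof -
  define m where "m = q / 2"
  have m: "1 / 2 < m" "m \<le> 1" using q by (auto simp: m_def)
  \<comment> \<open>This makes the Laplacian of the first term at least \<open>4 m u\<^bsup>m-1\<^esup>\<close>, and that of the second is at most
    \<open>4 m r\<^bsup>m-1\<^esup>\<close>.\<close>
  define A where "A = 2 / (2 * m - 1)"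
  have A: "A \<ge> 2" "A * (2 * m - 1) = 2" using m by (auto simp: A_def field_simps)
  define \<Phi> where "\<Phi> = (\<lambda>x y :: real. A * (1 + x\<^sup>2 + 0 * y\<^sup>2) powr m - (1 + x\<^sup>2 + 1 * y\<^sup>2) powr m)"
  note C2 = C2_partials_diff[OF C2_partials_powr[of 0 m] C2_partials_powr[of 1 m], of A, folded \<Phi>_def, simplified]
  have sub: "A * (2 * m * (1 + x\<^sup>2) powr (m - 1) + 4 * m * (m - 1) * x\<^sup>2 * (1 + x\<^sup>2) powr (m - 2)) -
        (2 * m * (1 + x\<^sup>2 + y\<^sup>2) powr (m - 1) + 4 * m * (m - 1) * x\<^sup>2 * (1 + x\<^sup>2 + y\<^sup>2) powr (m - 2)) +
       (- (2 * m * (1 + x\<^sup>2 + y\<^sup>2) powr (m - 1)) - 4 * m * (m - 1) * y\<^sup>2 * (1 + x\<^sup>2 + y\<^sup>2) powr (m - 2)) \<ge> 0" for x y :: real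
  proof -
    define u where "u = 1 + x\<^sup>2"
    define r where "r = 1 + x\<^sup>2 + y\<^sup>2"
    have u: "u > 0" "u \<le> r" "x\<^sup>2 \<le> u" by (auto simp: u_def r_def add_pos_nonneg)
    have r: "r > 0" using u by simp
    have pu: "u powr (m - 1) = u * u powr (m - 2)" using u powr_add[of u 1 "m - 2"] by simp
    have ru: "r powr (m - 1) \<le> u powr (m - 1)" using u m by (intro powr_mono2') auto
    define u1 u2 r1 r2 where "u1 = u powr (m - 1)" and "u2 = u powr (m - 2)"
      and "r1 = r powr (m - 1)" and "r2 = r powr (m - 2)"
    have "x\<^sup>2 * u2 \<le> u1" unfolding u1_def u2_def pu using u by (intro mult_right_mono) auto
    then have "4 * m * (1 - m) * (x\<^sup>2 * u2) \<le> 4 * m * (1 - m) * u1"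
      using m by (intro mult_left_mono) auto
    then have "2 * m * u1 - 4 * m * (1 - m) * u1 \<le> 2 * m * u1 - 4 * m * (1 - m) * (x\<^sup>2 * u2)" by linarith
    then have "A * (2 * m * u1 - 4 * m * (1 - m) * u1) \<le> A * (2 * m * u1 - 4 * m * (1 - m) * (x\<^sup>2 * u2))"
      using A by (intro mult_left_mono) auto
    also have "2 * m * u1 - 4 * m * (1 - m) * (x\<^sup>2 * u2) = 2 * m * u1 + 4 * m * (m - 1) * x\<^sup>2 * u2"
      by (simp add: left_diff_distrib right_diff_distrib)
    finally have 1: "A * (2 * m * u1 - 4 * m * (1 - m) * u1) \<le> A * (2 * m * u1 + 4 * m * (m - 1) * x\<^sup>2 * u2)" .
    have "A * (2 * m * u1 - 4 * m * (1 - m) * u1) = A * (2 * m - 1) * (2 * m * u1)"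
      by (simp add: left_diff_distrib right_diff_distrib)
    also have "\<dots> = 4 * m * u1" using A(2) by simp
    finally have 2: "A * (2 * m * u1 - 4 * m * (1 - m) * u1) = 4 * m * u1" .
    have 3: "4 * m * r1 \<le> 4 * m * u1" using ru m unfolding u1_def r1_def by (intro mult_left_mono) auto
    have "0 \<le> 4 * m * (1 - m) * ((x\<^sup>2 + y\<^sup>2) * r2)" using m by (simp add: r2_def)
    also have "4 * m * (1 - m) * ((x\<^sup>2 + y\<^sup>2) * r2) = - (4 * m * (m - 1) * x\<^sup>2 * r2) - 4 * m * (m - 1) * y\<^sup>2 * r2"
      by (simp add: left_diff_distrib right_diff_distrib distrib_left distrib_right)
    finally have 4: "0 \<le> - (4 * m * (m - 1) * x\<^sup>2 * r2) - 4 * m * (m - 1) * y\<^sup>2 * r2" .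
    have ry: "u + y\<^sup>2 = r" by (simp add: u_def r_def)
    show ?thesis using 1 2 3 4
      unfolding u_def[symmetric] ry unfolding u1_def[symmetric] u2_def[symmetric] r1_def[symmetric] r2_def[symmetric]
      by linarith
  qed
  have pt: "norm w powr q + 1 * \<Phi> (Re w) (Im w) \<le> A * 2 powr m * (\<bar>Re w\<bar> powr q + 1)" for w
  proof -
    define x y where "x = Re w" and "y = Im w"
    have "norm w powr q = (x\<^sup>2 + y\<^sup>2) powr m"
      using square_powr_half[of "norm w" q] by (simp add: cmod_power2 x_def y_def m_def)
    also have "\<dots> \<le> (1 + x\<^sup>2 + y\<^sup>2) powr m" using m by (intro powr_mono2) auto
    finally have 1: "norm w powr q \<le> (1 + x\<^sup>2 + y\<^sup>2) powr m" .
    have "(1 + x\<^sup>2) powr m \<le> (2 * max 1 (x\<^sup>2)) powr m" using m by (intro powr_mono2) auto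
    also have "\<dots> = 2 powr m * max 1 (x\<^sup>2) powr m" by (rule powr_mult)
    also have "max 1 (x\<^sup>2) powr m \<le> (x\<^sup>2) powr m + 1" by (simp add: max_def)
    also have "(x\<^sup>2) powr m = \<bar>x\<bar> powr q"
      using square_powr_half[of "\<bar>x\<bar>" q] by (simp add: m_def)
    finally have "(1 + x\<^sup>2) powr m \<le> 2 powr m * (\<bar>x\<bar> powr q + 1)" by simp
    then have "A * (1 + x\<^sup>2) powr m \<le> A * (2 powr m * (\<bar>x\<bar> powr q + 1))" using A by (intro mult_left_mono) auto
    then show ?thesis using 1 unfolding \<Phi>_def x_def[symmetric] y_def[symmetric] by (simp add: mult.assoc)
  qed
  show ?thesis
    by (rule conjugate_function_boundI[OF C2 sub _ _ _ pt]) (use q A in auto)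
qed

text \<open>
  For \<open>q \<ge> 2\<close> the previous choice fails, but \<open>x\<^sup>2 \<rho>\<^bsup>q/2-1\<^esup>\<close> with \<open>\<rho> = 1 + |w|\<^sup>2\<close> has Laplacian at least
  \<open>2 \<rho>\<^bsup>q/2-1\<^esup>\<close>, so a multiple of it dominates the Laplacian of \<open>\<rho>\<^bsup>q/2\<^esup>\<close>. Where \<open>x\<^sup>2\<close> is small compared with \<open>\<rho>\<close> that multiple
  is at most half of \<open>\<rho>\<^bsup>q/2\<^esup>\<close>, and elsewhere it is at most a constant times \<open>|x|\<^sup>q\<close>.
\<close>
lemma conjugate_function_bound_large:
  fixes q :: real
  assumes q: "q \<ge> 2"
  shows "\<exists>C\<ge>0. conjugate_bound q C"
proof -
  let ?r = "\<lambda>x y :: real. 1 + x\<^sup>2 + y\<^sup>2"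
  define m where "m = q / 2"
  have m: "1 \<le> m" using q by (auto simp: m_def)
  define \<Phi> where "\<Phi> = (\<lambda>x y :: real. 2 * m\<^sup>2 * (x\<^sup>2 * (1 + x\<^sup>2 + 1 * y\<^sup>2) powr (m - 1)) - (1 + x\<^sup>2 + 1 * y\<^sup>2) powr m)"
  note C2 = C2_partials_diff[OF C2_partials_square_mult[OF C2_partials_powr[of 1 "m - 1"]] C2_partials_powr[of 1 m],
     of "2 * m\<^sup>2", folded \<Phi>_def]
  have e: "m - 1 - 1 = m - 2" "m - 1 - 2 = m - 3" by auto
  have C2': "C2_partials \<Phi>
   (\<lambda>x y. 2 * m\<^sup>2 * (2 * x * ?r x y powr (m - 1) + x\<^sup>2 * (2 * (m - 1) * x * ?r x y powr (m - 2))) - 2 * m * x * ?r x y powr (m - 1))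
   (\<lambda>x y. 2 * m\<^sup>2 * (x\<^sup>2 * (2 * (m - 1) * y * ?r x y powr (m - 2))) - 2 * m * y * ?r x y powr (m - 1))
   (\<lambda>x y. 2 * m\<^sup>2 * (2 * ?r x y powr (m - 1) + 4 * x * (2 * (m - 1) * x * ?r x y powr (m - 2))
        + x\<^sup>2 * (2 * (m - 1) * ?r x y powr (m - 2) + 4 * (m - 1) * (m - 2) * x\<^sup>2 * ?r x y powr (m - 3)))
      - (2 * m * ?r x y powr (m - 1) + 4 * m * (m - 1) * x\<^sup>2 * ?r x y powr (m - 2)))
   (\<lambda>x y. 2 * m\<^sup>2 * (2 * x * (2 * (m - 1) * y * ?r x y powr (m - 2)) + x\<^sup>2 * (4 * (m - 1) * (m - 2) * x * y * ?r x y powr (m - 3)))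
      - 4 * m * (m - 1) * x * y * ?r x y powr (m - 2))
   (\<lambda>x y. 2 * m\<^sup>2 * (x\<^sup>2 * (2 * (m - 1) * ?r x y powr (m - 2) + 4 * (m - 1) * (m - 2) * y\<^sup>2 * ?r x y powr (m - 3)))
      - (2 * m * ?r x y powr (m - 1) + 4 * m * (m - 1) * y\<^sup>2 * ?r x y powr (m - 2)))"
    using C2 by (simp add: e)
  have sub: "(2 * m\<^sup>2 * (2 * ?r x y powr (m - 1) + 4 * x * (2 * (m - 1) * x * ?r x y powr (m - 2))
        + x\<^sup>2 * (2 * (m - 1) * ?r x y powr (m - 2) + 4 * (m - 1) * (m - 2) * x\<^sup>2 * ?r x y powr (m - 3)))
      - (2 * m * ?r x y powr (m - 1) + 4 * m * (m - 1) * x\<^sup>2 * ?r x y powr (m - 2)))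
    + (2 * m\<^sup>2 * (x\<^sup>2 * (2 * (m - 1) * ?r x y powr (m - 2) + 4 * (m - 1) * (m - 2) * y\<^sup>2 * ?r x y powr (m - 3)))
      - (2 * m * ?r x y powr (m - 1) + 4 * m * (m - 1) * y\<^sup>2 * ?r x y powr (m - 2))) \<ge> 0"
    (is "?L \<ge> 0") for x y :: real
  proof -
    define r where "r = 1 + x\<^sup>2 + y\<^sup>2"
    define p where "p = r powr (m - 3)"
    have r: "r \<ge> 1" "r > 0" by (auto simp: r_def add_pos_nonneg)
    have p2: "r powr (m - 2) = r * p" using r powr_add[of r 1 "m - 3"] by (simp add: p_def)
    have p1: "r powr (m - 1) = r\<^sup>2 * p" using r powr_add[of r 2 "m - 3"] by (simp add: p_def powr_numeral)
    have w: "x\<^sup>2 + y\<^sup>2 = r - 1" by (simp add: r_def)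
    have "?L = 2 * m\<^sup>2 * (2 * (r\<^sup>2 * p) + 8 * (m - 1) * x\<^sup>2 * (r * p)
         + 4 * (m - 1) * x\<^sup>2 * (r * p) + 4 * (m - 1) * (m - 2) * x\<^sup>2 * (x\<^sup>2 + y\<^sup>2) * p)
         - 4 * m * (r\<^sup>2 * p) - 4 * m * (m - 1) * (x\<^sup>2 + y\<^sup>2) * (r * p)"
      unfolding r_def[symmetric] p_def[symmetric] p1 p2 by (simp add: algebra_simps power2_eq_square)
    also have "\<dots> = p * (4 * m * r * (m - 1) + 8 * m\<^sup>2 * (m - 1) * x\<^sup>2 * (m * r + r + 2 - m))"
      unfolding w by (simp add: algebra_simps power2_eq_square)
    finally have L: "?L = p * (4 * m * r * (m - 1) + 8 * m\<^sup>2 * (m - 1) * x\<^sup>2 * (m * r + r + 2 - m))" .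
    have "m * 1 \<le> m * r" using r m by (intro mult_left_mono) auto
    then have "m * r + r + 2 - m \<ge> 0" using r by simp
    then show ?thesis unfolding L using m r by (intro mult_nonneg_nonneg add_nonneg_nonneg) (auto simp: p_def)
  qed
  define K where "K = (4 * m\<^sup>2) powr m"
  have K: "K \<ge> 0" by (simp add: K_def)
  have pt: "norm w powr q + 2 * \<Phi> (Re w) (Im w) \<le> K * (\<bar>Re w\<bar> powr q + 1)" for w
  proof -
    define x y where "x = Re w" and "y = Im w"
    define r where "r = 1 + x\<^sup>2 + y\<^sup>2"
    have r: "r > 0" "r \<ge> 1" by (auto simp: r_def add_pos_nonneg)
    have "norm w powr q = (x\<^sup>2 + y\<^sup>2) powr m"
      using square_powr_half[of "norm w" q] by (simp add: cmod_power2 x_def y_def m_def)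
    also have "\<dots> \<le> r powr m" using m unfolding r_def by (intro powr_mono2) auto
    finally have 1: "norm w powr q \<le> r powr m" .
    have xq: "(x\<^sup>2) powr m = \<bar>x\<bar> powr q"
      using square_powr_half[of "\<bar>x\<bar>" q] by (simp add: m_def)
    have rm: "r powr m = r * r powr (m - 1)" using r powr_add[of r 1 "m - 1"] by simp
    have "4 * m\<^sup>2 * x\<^sup>2 * r powr (m - 1) \<le> r powr m + K * \<bar>x\<bar> powr q"
    proof (cases "4 * m\<^sup>2 * x\<^sup>2 \<le> r")
      case True
      then have "4 * m\<^sup>2 * x\<^sup>2 * r powr (m - 1) \<le> r * r powr (m - 1)" by (intro mult_right_mono) auto
      then show ?thesis using rm K by (simp add: add_increasing2)
    next
      case False
      define v where "v = 4 * m\<^sup>2 * x\<^sup>2"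
      have v: "r \<le> v" "v > 0" using False r by (auto simp: v_def)
      have "v * r powr (m - 1) \<le> v * v powr (m - 1)" using v r m by (intro mult_left_mono powr_mono2) auto
      also have "\<dots> = v powr m" using v powr_add[of v 1 "m - 1"] by simp
      also have "\<dots> = K * \<bar>x\<bar> powr q" unfolding v_def K_def xq[symmetric] by (simp add: powr_mult)
      finally show ?thesis by (simp add: v_def add_increasing)
    qed
    then have "2 * \<Phi> x y \<le> K * \<bar>x\<bar> powr q - r powr m"
      unfolding \<Phi>_def r_def by (simp add: algebra_simps)
    then show ?thesis using 1 K unfolding x_def[symmetric] y_def[symmetric] distrib_left by linarith
  qed
  show ?thesis
    by (rule conjugate_function_boundI[OF C2' sub _ _ _ pt]) (use q K in auto)
qed

section \<open>Moments of the local Euler factors\<close>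

lemma powr_one_plus_taylor:
  fixes m :: real
  obtains C where "C \<ge> 0" "\<And>x. \<bar>x\<bar> \<le> 3 / 4 \<Longrightarrow> \<bar>(1 + x) powr m - (1 + m * x + m * (m - 1) / 2 * x\<^sup>2)\<bar> \<le> C * \<bar>x\<bar> ^ 3"
proof -
  define d where "d = (\<lambda>k::nat. \<lambda>x. (\<Prod>j<k. m - real j) * (1 + x) powr (m - real k))"
  define C where "C = \<bar>m * (m - 1) * (m - 2)\<bar> * (4 powr \<bar>m - 3\<bar>) / 6"
  have dd: "(d k has_real_derivative d (Suc k) x) (at x)" if "\<bar>x\<bar> \<le> 3 / 4" for k x
  proof -
    have "1 + x > 0" using that by linarith
    then show ?thesis unfolding d_def
      by (auto intro!: derivative_eq_intros simp: algebra_simps diff_diff_eq)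
  qed
  have "\<bar>(1 + x) powr m - (1 + m * x + m * (m - 1) / 2 * x\<^sup>2)\<bar> \<le> C * \<bar>x\<bar> ^ 3" if x: "\<bar>x\<bar> \<le> 3 / 4" for x
  proof (cases "x = 0")
    case False
    have "\<exists>t. (if x < 0 then x < t \<and> t < 0 else 0 < t \<and> t < x) \<and>
        d 0 x = (\<Sum>k<3. d k 0 / fact k * (x - 0) ^ k) + d 3 t / fact 3 * (x - 0) ^ 3"
      using x False dd
      by (intro Taylor[of 3 d "d 0" "-3/4" "3/4" 0 x]) (auto simp: abs_le_iff)
    then obtain t where t0: "if x < 0 then x < t \<and> t < 0 else 0 < t \<and> t < x"
      and t2: "d 0 x = (\<Sum>k<3. d k 0 / fact k * x ^ k) + d 3 t / fact 3 * x ^ 3"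
      by auto
    have "\<bar>t\<bar> \<le> 3 / 4" using t0 x by (cases "x < 0") auto
    note t = this t2
    have s: "(\<Sum>k<3. d k 0 / fact k * x ^ k) = 1 + m * x + m * (m - 1) / 2 * x\<^sup>2"
      by (simp add: d_def numeral_3_eq_3 fact_numeral power2_eq_square)
    have d3: "d 3 t = m * (m - 1) * (m - 2) * (1 + t) powr (m - 3)"
      by (simp add: d_def numeral_3_eq_3)
    have tp: "1 / 4 \<le> 1 + t" "1 + t \<le> 4" using t(1) by linarith+
    have "(1 + t) powr (m - 3) = exp ((m - 3) * ln (1 + t))" using tp by (simp add: powr_def)
    also have "(m - 3) * ln (1 + t) \<le> \<bar>m - 3\<bar> * ln 4"
    proof -
      have "ln (1 / 4) \<le> ln (1 + t)" using tp by (subst ln_le_cancel_iff) auto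
      moreover have "ln (1 + t) \<le> ln 4" using tp by (subst ln_le_cancel_iff) auto
      ultimately have "\<bar>ln (1 + t)\<bar> \<le> ln 4" by (simp add: ln_div abs_le_iff)
      then have "\<bar>m - 3\<bar> * \<bar>ln (1 + t)\<bar> \<le> \<bar>m - 3\<bar> * ln 4" by (intro mult_left_mono) auto
      then show ?thesis using abs_ge_self[of "(m - 3) * ln (1 + t)"] by (simp add: abs_mult)
    qed
    then have "exp ((m - 3) * ln (1 + t)) \<le> 4 powr \<bar>m - 3\<bar>" by (simp add: powr_def)
    finally have "\<bar>d 3 t\<bar> \<le> \<bar>m * (m - 1) * (m - 2)\<bar> * 4 powr \<bar>m - 3\<bar>"
      unfolding d3 abs_mult by (intro mult_mono) auto
    then have "\<bar>d 3 t\<bar> / 6 * \<bar>x\<bar> ^ 3 \<le> C * \<bar>x\<bar> ^ 3" unfolding C_def by (intro mult_right_mono divide_right_mono) auto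
    moreover have "d 0 x = (1 + x) powr m" by (simp add: d_def)
    ultimately have "(1 + x) powr m - (1 + m * x + m * (m - 1) / 2 * x\<^sup>2) = d 3 t / 6 * x ^ 3"
      using t(2) unfolding s by (simp add: fact_numeral)
    then have "\<bar>(1 + x) powr m - (1 + m * x + m * (m - 1) / 2 * x\<^sup>2)\<bar> = \<bar>d 3 t\<bar> / 6 * \<bar>x\<bar> ^ 3"
      by (simp only: abs_mult power_abs abs_divide abs_numeral)
    then show ?thesis using \<open>\<bar>d 3 t\<bar> / 6 * \<bar>x\<bar> ^ 3 \<le> C * \<bar>x\<bar> ^ 3\<close> by simp
  qed simp
  moreover have "C \<ge> 0" by (simp add: C_def)
  ultimately show ?thesis using that by blast
qed

text \<open>
  Expand \<open>|1 + w|\<^sup>q = (1 + 2 Re w + |w|\<^sup>2)\<^bsup>q/2\<^esup>\<close> to second order and write \<open>2 (Re w)\<^sup>2 = |w|\<^sup>2 + Re w\<^sup>2\<close>; the terms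
  \<open>Re w\<close> and \<open>Re w\<^sup>2\<close> have mean zero when \<open>w\<close> is a power series without constant term. Away from \<open>0\<close> the cubic term alone
  dominates, once its constant is large enough.
\<close>
lemma norm_one_plus_powr_le:
  fixes q M :: real
  assumes q: "q > 0" and M: "M \<ge> 0"
  obtains C where "C \<ge> 0"
    "\<And>w. norm w \<le> M \<Longrightarrow> norm (1 + w) powr q \<le> 1 + q * Re w + q\<^sup>2 / 4 * (norm w)\<^sup>2 + q / 2 * (q / 2 - 1) * Re (w\<^sup>2) + C * norm w ^ 3"
proof -
  define m where "m = q / 2"
  obtain C1 where C1: "C1 \<ge> 0" "\<And>x. \<bar>x\<bar> \<le> 3 / 4 \<Longrightarrow> \<bar>(1 + x) powr m - (1 + m * x + m * (m - 1) / 2 * x\<^sup>2)\<bar> \<le> C1 * \<bar>x\<bar> ^ 3"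
    using powr_one_plus_taylor by blast
  define C2 where "C2 = 27 * C1 + 3 * \<bar>m * (m - 1)\<bar>"
  define C3 where "C3 = 64 * ((1 + M) powr q + q * M + \<bar>m * (m - 1)\<bar> * M\<^sup>2)"
  define C where "C = C2 + C3"
  have C2: "C2 \<ge> 0" using C1 by (simp add: C2_def)
  have C3: "C3 \<ge> 0" using q M by (simp add: C3_def)
  have main: "norm (1 + w) powr q \<le> 1 + q * Re w + q\<^sup>2 / 4 * (norm w)\<^sup>2 + q / 2 * (q / 2 - 1) * Re (w\<^sup>2) + C * norm w ^ 3"
    if w: "norm w \<le> M" for w
  proof (cases "norm w \<le> 1 / 4")
    case True
    define r where "r = norm w"
    define u where "u = Re w"
    have r: "0 \<le> r" "r \<le> 1 / 4" using True by (auto simp: r_def)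
    have u: "\<bar>u\<bar> \<le> r" unfolding u_def r_def by (rule abs_Re_le_cmod)
    define x where "x = 2 * u + r\<^sup>2"
    have rr: "r\<^sup>2 \<le> r / 4" using mult_right_mono[of r "1 / 4" r] r by (simp add: power2_eq_square)
    have x: "\<bar>x\<bar> \<le> 3 * r" "\<bar>x\<bar> \<le> 3 / 4" using u r rr zero_le_power2[of r] unfolding x_def abs_le_iff by linarith+
    have sq: "(norm (1 + w))\<^sup>2 = 1 + x"
      unfolding cmod_power2 x_def u_def r_def by (simp add: cmod_power2 power2_eq_square algebra_simps)
    have "norm (1 + w) powr q = ((norm (1 + w))\<^sup>2) powr m"
      using square_powr_half[of "norm (1 + w)" q] by (simp add: m_def)
    also have "\<dots> = (1 + x) powr m" by (simp add: sq)
    also have "\<dots> \<le> 1 + m * x + m * (m - 1) / 2 * x\<^sup>2 + C1 * \<bar>x\<bar> ^ 3" using C1(2)[OF x(2)] by linarith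
    also have "C1 * \<bar>x\<bar> ^ 3 \<le> C1 * (3 * r) ^ 3" using x C1(1) by (intro mult_left_mono power_mono) auto
    also have "m * (m - 1) / 2 * x\<^sup>2 = m * (m - 1) * (2 * u\<^sup>2) + m * (m - 1) / 2 * (4 * u * r\<^sup>2 + r ^ 4)"
      unfolding x_def by (simp add: power2_eq_square algebra_simps numeral_eq_Suc add_divide_distrib diff_divide_distrib)
    also have "m * (m - 1) / 2 * (4 * u * r\<^sup>2 + r ^ 4) \<le> 3 * \<bar>m * (m - 1)\<bar> * r ^ 3"
    proof -
      have b: "\<bar>4 * u * r\<^sup>2 + r ^ 4\<bar> \<le> 6 * r ^ 3"
      proof -
        have "\<bar>4 * u * r\<^sup>2 + r ^ 4\<bar> \<le> 4 * \<bar>u\<bar> * r\<^sup>2 + r ^ 4"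
          using r by (intro order_trans[OF abs_triangle_ineq]) (simp add: abs_mult)
        also have "\<dots> \<le> 4 * r * r\<^sup>2 + 1 * r ^ 3"
          using u r by (intro add_mono mult_right_mono mult_left_mono) (auto simp: numeral_eq_Suc mult_left_le_one_le)
        also have "\<dots> = 5 * r ^ 3" by (simp add: numeral_eq_Suc)
        also have "\<dots> \<le> 6 * r ^ 3" using r by simp
        finally show ?thesis .
      qed
      have "m * (m - 1) / 2 * (4 * u * r\<^sup>2 + r ^ 4) \<le> \<bar>m * (m - 1) / 2\<bar> * \<bar>4 * u * r\<^sup>2 + r ^ 4\<bar>"
        using abs_ge_self[of "m * (m - 1) / 2 * (4 * u * r\<^sup>2 + r ^ 4)"] by (simp add: abs_mult)
      also have "\<dots> \<le> \<bar>m * (m - 1) / 2\<bar> * (6 * r ^ 3)" by (intro mult_left_mono b) auto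
      also have "\<dots> = 3 * \<bar>m * (m - 1)\<bar> * r ^ 3" by (simp add: abs_divide)
      finally show ?thesis .
    qed
    finally have A: "norm (1 + w) powr q \<le> 1 + m * x + (m * (m - 1) * (2 * u\<^sup>2) + 3 * \<bar>m * (m - 1)\<bar> * r ^ 3) + C1 * (3 * r) ^ 3"
      by linarith
    have re: "2 * u\<^sup>2 = r\<^sup>2 + Re (w\<^sup>2)"
      unfolding r_def u_def cmod_power2 by (simp add: power2_eq_square)
    have "1 + m * x + m * (m - 1) * (2 * u\<^sup>2) = 1 + q * u + q\<^sup>2 / 4 * r\<^sup>2 + q / 2 * (q / 2 - 1) * Re (w\<^sup>2)"
      unfolding re x_def m_def by (simp add: power2_eq_square algebra_simps add_divide_distrib diff_divide_distrib)
    moreover have "3 * \<bar>m * (m - 1)\<bar> * r ^ 3 + C1 * (3 * r) ^ 3 = C2 * r ^ 3"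
      by (simp add: C2_def power_mult_distrib algebra_simps)
    moreover have "C2 * r ^ 3 \<le> C * r ^ 3" unfolding C_def using C3 r by (intro mult_right_mono) auto
    ultimately show ?thesis using A unfolding r_def u_def by linarith
  next
    case False
    define r where "r = norm w"
    have r: "1 / 4 < r" "r \<le> M" using False w by (auto simp: r_def)
    have c: "1 \<le> 64 * r ^ 3" using power_mono[of "1/4" r 3] r by (simp add: power_divide)
    define A where "A = (1 + M) powr q + q * M + \<bar>m * (m - 1)\<bar> * M\<^sup>2"
    have A: "A \<ge> 0" using q M by (simp add: A_def)
    have "norm (1 + w) \<le> 1 + M" using norm_triangle_ineq[of 1 w] w by simp
    then have 1: "norm (1 + w) powr q \<le> (1 + M) powr q" using q by (intro powr_mono2) auto
    have "- Re w \<le> M" using abs_Re_le_cmod[of w] w by linarith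
    then have 2: "q * (- Re w) \<le> q * M" using q by (intro mult_left_mono) auto
    have "\<bar>Re (w\<^sup>2)\<bar> \<le> M\<^sup>2"
      using abs_Re_le_cmod[of "w\<^sup>2"] w power_mono[of "norm w" M 2] by (simp add: norm_power)
    then have "\<bar>m * (m - 1)\<bar> * \<bar>Re (w\<^sup>2)\<bar> \<le> \<bar>m * (m - 1)\<bar> * M\<^sup>2" by (intro mult_left_mono) auto
    then have 3: "- (m * (m - 1) * Re (w\<^sup>2)) \<le> \<bar>m * (m - 1)\<bar> * M\<^sup>2"
      using abs_ge_minus_self[of "m * (m - 1) * Re (w\<^sup>2)"] by (simp add: abs_mult)
    have "A * 1 \<le> A * (64 * r ^ 3)" using A c by (intro mult_left_mono)
    also have "\<dots> \<le> C * r ^ 3" unfolding C_def C3_def A_def[symmetric] using C2 r by (simp add: algebra_simps)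
    finally have "A \<le> C * r ^ 3" by simp
    moreover have "q\<^sup>2 / 4 * r\<^sup>2 \<ge> 0" by simp
    ultimately show ?thesis using 1 2 3 unfolding r_def A_def m_def by linarith
  qed
  show ?thesis using that[of C] main C2 C3 by (simp add: C_def)
qed

section \<open>The upper bound\<close>

lemma conjugate_function_bound:
  fixes q :: real
  assumes q: "q > 1"
  shows "\<exists>C\<ge>0. conjugate_bound q C"
proof (cases "q \<le> 2")
  case True
  show ?thesis by (rule conjugate_function_bound_small[OF q True])
next
  case False
  then show ?thesis by (intro conjugate_function_bound_large) simp
qed

lemma powr_sum3_le:
  fixes a b c q :: real
  assumes "a \<ge> 0" "b \<ge> 0" "c \<ge> 0" "q > 0"
  shows "(a + b + c) powr q \<le> 3 powr q * (a powr q + b powr q + c powr q)"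
proof -
  have "(a + b + c) powr q \<le> (3 * max a (max b c)) powr q" using assms by (intro powr_mono2) auto
  also have "\<dots> = 3 powr q * max a (max b c) powr q" by (rule powr_mult)
  also have "max a (max b c) powr q \<le> a powr q + b powr q + c powr q"
    unfolding max_def by (auto simp: add_nonneg_nonneg)
  finally show ?thesis by simp
qed

abbreviation cis_sum :: "(nat \<Rightarrow> real) \<Rightarrow> nat set \<Rightarrow> real \<Rightarrow> complex" where
  "cis_sum c A t \<equiv> \<Sum>n\<in>A. of_real (c n) * cis (- (t * ln (real n)))"

text \<open>
  Multiplying by \<open>N\<^bsup>it\<^esup>\<close> moves the cut to frequency \<open>0\<close>. The sum then becomes \<open>G = U + V + d\<close>, where \<open>U\<close> has the
  terms \<open>n > N\<close> and \<open>V\<close> the terms \<open>n < N\<close>, and it suffices to bound \<open>U\<close>. As the coefficients are real, both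
  \<open>F1 = U + cnj V\<close> and \<open>F2 = -i (U - cnj V)\<close> have positive frequencies only, their real parts are
  \<open>Re G - d\<close> and \<open>Im G\<close>, and \<open>2 U = F1 + i F2\<close>.
\<close>
lemma partial_sum_bound:
  fixes q :: real
  assumes q: "q > 1"
  shows "\<exists>C\<ge>0. \<forall>(c :: nat \<Rightarrow> real) A N. finite A \<longrightarrow> (\<forall>n\<in>A. n > 0) \<longrightarrow> N > 0 \<longrightarrow> \<bar>c N\<bar> \<le> 1 \<longrightarrow>
      (\<forall>\<^sub>F T in at_top. integral {0..T} (\<lambda>t. norm (cis_sum c {n \<in> A. n \<le> N} t) powr q)
        \<le> C * (integral {0..T} (\<lambda>t. norm (cis_sum c A t) powr q) + T))"
proof -
  obtain C0 where C0: "C0 \<ge> 0" and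
    ex_bound: "conjugate_bound q C0"
    using conjugate_function_bound[OF q] by (elim exE conjE)
  note bound = ex_bound[rule_format]
  define C where "C = 3 powr q * (1 + C0 * (3 powr q + 1) + C0 * 2)"
  have C: "C \<ge> 0" using C0 by (simp add: C_def)
  have main: "\<forall>\<^sub>F T in at_top. integral {0..T} (\<lambda>t. norm (cis_sum c {n \<in> A. n \<le> N} t) powr q)
        \<le> C * (integral {0..T} (\<lambda>t. norm (cis_sum c A t) powr q) + T)"
    if A: "finite A" "\<forall>n\<in>A. n > 0" "N > 0" "\<bar>c N\<bar> \<le> 1" for c :: "nat \<Rightarrow> real" and A N
  proof -
    define J where "J = A - {N}"
    define \<nu> where "\<nu> = (\<lambda>j. \<bar>ln (real j) - ln (real N)\<bar>)"
    have finJ: "finite J" using A by (simp add: J_def)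
    have \<nu>: "\<nu> j > 0" if "j \<in> J" for j
    proof -
      have "real j > 0" "j \<noteq> N" using that A(2) by (auto simp: J_def)
      then show ?thesis using A(3) by (simp add: \<nu>_def)
    qed
    define y where "y = (\<lambda>n t. cis (- (t * (ln (real n) - ln (real N)))))"
    define U where "U = (\<lambda>t. \<Sum>j\<in>J. if N < j then of_real (c j) * y j t else 0)"
    define V where "V = (\<lambda>t. \<Sum>j\<in>J. if N < j then 0 else of_real (c j) * y j t)"
    define d where "d = (if N \<in> A then c N else 0)"
    have d: "\<bar>d\<bar> \<le> 1" using A(4) by (simp add: d_def)
    define G where "G = (\<lambda>t. \<Sum>n\<in>A. of_real (c n) * y n t)"
    have yN: "y N t = 1" for t by (simp add: y_def)
    have G: "G t = U t + V t + of_real d" for t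
    proof -
      have "G t = (\<Sum>j\<in>J. of_real (c j) * y j t) + of_real d"
        unfolding G_def J_def d_def using A(1) yN by (simp add: sum.remove[of A N] add.commute)
      also have "(\<Sum>j\<in>J. of_real (c j) * y j t) = U t + V t"
        unfolding U_def V_def sum.distrib[symmetric] by (rule sum.cong) auto
      finally show ?thesis .
    qed
    define a1 where "a1 = (\<lambda>j. complex_of_real (c j))"
    define a2 where "a2 = (\<lambda>j. if N < j then - \<i> * of_real (c j) else \<i> * of_real (c j))"
    have ex: "exp (- of_real (\<nu> j) * (\<i> * of_real t)) = (if N < j then y j t else cnj (y j t))" if "j \<in> J" for j t
    proof -
      have j: "real j > 0" "j \<noteq> N" using that A(2) by (auto simp: J_def)
      have "exp (- of_real (\<nu> j) * (\<i> * of_real t)) = cis (- (t * \<nu> j))"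
        by (simp add: cis_conv_exp mult_ac)
      moreover have "ln (real N) < ln (real j)" if "N < j" using that A(3) by (subst ln_less_cancel_iff) auto
      moreover have "ln (real j) < ln (real N)" if "\<not> N < j" using that j A(3) by (subst ln_less_cancel_iff) auto
      ultimately show ?thesis by (auto simp: \<nu>_def y_def cis_cnj algebra_simps)
    qed
    define F1 where "F1 = frequency_sum a1 \<nu> J"
    define F2 where "F2 = frequency_sum a2 \<nu> J"
    have F1: "F1 t = U t + cnj (V t)" for t
      unfolding F1_def U_def V_def cnj_sum sum.distrib[symmetric]
    proof (rule sum.cong)
      fix j assume j: "j \<in> J"
      show "a1 j * exp (- of_real (\<nu> j) * (\<i> * of_real t))
        = (if N < j then of_real (c j) * y j t else 0) + cnj (if N < j then 0 else of_real (c j) * y j t)"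
        unfolding ex[OF j] by (simp add: a1_def)
    qed simp
    have F2: "F2 t = - \<i> * U t + \<i> * cnj (V t)" for t
      unfolding F2_def U_def V_def cnj_sum sum_distrib_left sum.distrib[symmetric]
    proof (rule sum.cong)
      fix j assume j: "j \<in> J"
      show "a2 j * exp (- of_real (\<nu> j) * (\<i> * of_real t))
        = - \<i> * (if N < j then of_real (c j) * y j t else 0) + \<i> * cnj (if N < j then 0 else of_real (c j) * y j t)"
        unfolding ex[OF j] by (simp add: a2_def)
    qed simp
    have R1: "\<bar>Re (F1 t)\<bar> \<le> norm (G t) + 1" for t
    proof -
      have "Re (F1 t) = Re (G t) - d" by (simp add: F1 G)
      then show ?thesis using abs_Re_le_cmod[of "G t"] d by linarith
    qed
    have R2: "\<bar>Re (F2 t)\<bar> \<le> norm (G t)" for t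
    proof -
      have "Re (F2 t) = Im (G t)" by (simp add: F2 G)
      then show ?thesis using abs_Im_le_cmod[of "G t"] by simp
    qed
    define S where "S = cis_sum c {n \<in> A. n \<le> N}"
    define E where "E = (\<lambda>t. cis (- (t * ln (real N))))"
    have nE: "norm (E t) = 1" for t by (simp add: E_def)
    have sh: "cis (- (t * ln (real n))) = E t * y n t" for n t
      by (simp add: E_def y_def cis_mult algebra_simps)
    have S: "S t = E t * (G t - U t)" for t
    proof -
      have "(\<Sum>n | n \<in> A \<and> n \<le> N. of_real (c n) * y n t) = V t + of_real d"
      proof -
        have "(\<Sum>n | n \<in> A \<and> n \<le> N. of_real (c n) * y n t) = (\<Sum>n\<in>A. if N < n then 0 else of_real (c n) * y n t)"
          using A(1) by (simp add: sum.If_cases Int_def not_less)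
        also have "\<dots> = V t + of_real d"
          unfolding V_def J_def d_def using A(1) yN by (simp add: sum.remove[of A N] add.commute)
        finally show ?thesis .
      qed
      then show ?thesis
        unfolding S_def sh G mult.left_commute[of _ "E t"] sum_distrib_left[symmetric] by (simp add: algebra_simps)
    qed
    have nG: "norm (cis_sum c A t) = norm (G t)" for t
      unfolding sh G_def mult.left_commute[of _ "E t"] sum_distrib_left[symmetric] by (simp add: norm_mult nE)
    have nS: "norm (S t) \<le> norm (G t) + norm (F1 t) + norm (F2 t)" for t
    proof -
      have "norm (S t) = norm (G t - U t)" by (simp add: S norm_mult nE)
      also have "U t = (F1 t + \<i> * F2 t) / 2" by (simp add: F1 F2 algebra_simps)
      also have "norm (G t - (F1 t + \<i> * F2 t) / 2) \<le> norm (G t) + (norm (F1 t) + norm (F2 t)) / 2"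
      proof -
        define X where "X = F1 t + \<i> * F2 t"
        have X: "norm X \<le> norm (F1 t) + norm (F2 t)"
          using norm_triangle_ineq[of "F1 t" "\<i> * F2 t"] by (simp add: X_def norm_mult)
        show ?thesis unfolding X_def[symmetric]
          by (rule order_trans[OF norm_triangle_ineq4 add_left_mono])
             (simp add: norm_divide divide_right_mono X)
      qed
      also have "\<dots> \<le> norm (G t) + norm (F1 t) + norm (F2 t)"
      proof -
        have "0 \<le> norm (F1 t) + norm (F2 t)" by simp
        then show ?thesis by simp
      qed
      finally show ?thesis .
    qed
    have cont: "continuous_on X G" "continuous_on X F1" "continuous_on X F2" "continuous_on X S" for X
      unfolding G_def F1_def F2_def S_def y_def by (intro continuous_intros)+
    have int: "(\<lambda>t. norm (f t) powr q) integrable_on {0..T}" if "\<And>X. continuous_on X f" for f :: "real \<Rightarrow> complex" and T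
      using q that by (intro integrable_continuous_real continuous_on_powr' continuous_intros) auto
    have intR: "(\<lambda>t. \<bar>Re (f t)\<bar> powr q) integrable_on {0..T}" if "\<And>X. continuous_on X f" for f :: "real \<Rightarrow> complex" and T
      using q that by (intro integrable_continuous_real continuous_on_powr' continuous_intros) auto
    have "\<forall>\<^sub>F T in at_top. integral {0..T} (\<lambda>t. norm (F1 t) powr q) \<le> C0 * (integral {0..T} (\<lambda>t. \<bar>Re (F1 t)\<bar> powr q) + T)"
      unfolding F1_def by (rule bound[OF finJ \<nu>])
    moreover have "\<forall>\<^sub>F T in at_top. integral {0..T} (\<lambda>t. norm (F2 t) powr q) \<le> C0 * (integral {0..T} (\<lambda>t. \<bar>Re (F2 t)\<bar> powr q) + T)"
      unfolding F2_def by (rule bound[OF finJ \<nu>])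
    moreover have "\<forall>\<^sub>F T in at_top. (0 :: real) \<le> T" by (rule eventually_ge_at_top)
    ultimately have "\<forall>\<^sub>F T in at_top. integral {0..T} (\<lambda>t. norm (S t) powr q) \<le> C * (integral {0..T} (\<lambda>t. norm (G t) powr q) + T)"
    proof eventually_elim
      case (elim T)
      define I where "I = integral {0..T} (\<lambda>t. norm (G t) powr q)"
      have I: "I \<ge> 0" unfolding I_def by (intro integral_nonneg int cont) auto
      have "integral {0..T} (\<lambda>t. \<bar>Re (F1 t)\<bar> powr q) \<le> integral {0..T} (\<lambda>t. 3 powr q * (norm (G t) powr q + 1))"
      proof (rule integral_le[OF intR[OF cont(2)]])
        show "(\<lambda>t. 3 powr q * (norm (G t) powr q + 1)) integrable_on {0..T}"
          by (intro integrable_on_mult_right integrable_add int cont integrable_const_ivl)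
        fix t
        have "\<bar>Re (F1 t)\<bar> powr q \<le> (norm (G t) + 1 + 0) powr q" using R1[of t] q by (intro powr_mono2) auto
        also have "\<dots> \<le> 3 powr q * (norm (G t) powr q + 1 powr q + 0 powr q)" using q by (intro powr_sum3_le) auto
        finally show "\<bar>Re (F1 t)\<bar> powr q \<le> 3 powr q * (norm (G t) powr q + 1)" by simp
      qed
      also have "\<dots> = 3 powr q * (I + T)"
        using elim(3) int[OF cont(1)] by (simp add: I_def integral_add integrable_const_ivl)
      finally have 1: "integral {0..T} (\<lambda>t. norm (F1 t) powr q) \<le> C0 * (3 powr q * (I + T) + T)"
        using elim(1) C0 by (smt (verit) mult_left_mono)
      have "integral {0..T} (\<lambda>t. \<bar>Re (F2 t)\<bar> powr q) \<le> I"
        unfolding I_def using R2 q by (intro integral_le intR int cont powr_mono2) auto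
      then have 2: "integral {0..T} (\<lambda>t. norm (F2 t) powr q) \<le> C0 * (I + T)"
        using elim(2) C0 by (smt (verit) mult_left_mono)
      have "integral {0..T} (\<lambda>t. norm (S t) powr q)
          \<le> integral {0..T} (\<lambda>t. 3 powr q * (norm (G t) powr q + norm (F1 t) powr q + norm (F2 t) powr q))"
      proof (rule integral_le[OF int[OF cont(4)]])
        show "(\<lambda>t. 3 powr q * (norm (G t) powr q + norm (F1 t) powr q + norm (F2 t) powr q)) integrable_on {0..T}"
          by (intro integrable_on_mult_right integrable_add int cont)
        fix t
        have "norm (S t) powr q \<le> (norm (G t) + norm (F1 t) + norm (F2 t)) powr q" using nS[of t] q by (intro powr_mono2) auto
        also have "\<dots> \<le> 3 powr q * (norm (G t) powr q + norm (F1 t) powr q + norm (F2 t) powr q)" using q by (intro powr_sum3_le) auto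
        finally show "norm (S t) powr q \<le> 3 powr q * (norm (G t) powr q + norm (F1 t) powr q + norm (F2 t) powr q)" .
      qed
      also have "\<dots> = 3 powr q * (I + integral {0..T} (\<lambda>t. norm (F1 t) powr q) + integral {0..T} (\<lambda>t. norm (F2 t) powr q))"
        using int[OF cont(1)] int[OF cont(2)] int[OF cont(3)] by (simp add: I_def integral_add integrable_add)
      also have "\<dots> \<le> 3 powr q * ((I + T) + C0 * (3 powr q + 1) * (I + T) + C0 * 2 * (I + T))"
      proof (rule mult_left_mono)
        have "C0 * (3 powr q * (I + T) + T) \<le> C0 * (3 powr q * (I + T) + (I + T))"
          using C0 I by (intro mult_left_mono) auto
        also have "\<dots> = C0 * (3 powr q + 1) * (I + T)" by (simp add: algebra_simps)
        finally have "C0 * (3 powr q * (I + T) + T) \<le> C0 * (3 powr q + 1) * (I + T)" .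
        moreover have "C0 * (I + T) \<le> C0 * 2 * (I + T)" using C0 I elim(3) by (simp add: mult_left_mono)
        ultimately show "I + integral {0..T} (\<lambda>t. norm (F1 t) powr q) + integral {0..T} (\<lambda>t. norm (F2 t) powr q)
           \<le> (I + T) + C0 * (3 powr q + 1) * (I + T) + C0 * 2 * (I + T)"
          using 1 2 elim(3) by linarith
      qed simp
      also have "\<dots> = C * (I + T)" by (simp add: C_def algebra_simps)
      finally show ?case unfolding I_def .
    qed
    then show ?thesis unfolding nG S_def .
  qed
  show ?thesis by (intro exI[of _ C] conjI C allI impI main)
qed

lemma sum_geometric_le:
  fixes x :: real
  assumes "0 \<le> x" "x < 1"
  shows "(\<Sum>j=1..K. x ^ j) \<le> x / (1 - x)"
proof -
  have "(1 - x) * (\<Sum>j=1..K. x ^ j) = x - x ^ Suc K"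
  proof (induction K)
    case (Suc K)
    have "(1 - x) * (\<Sum>j=1..Suc K. x ^ j) = (1 - x) * (\<Sum>j=1..K. x ^ j) + (1 - x) * x ^ Suc K"
      by (simp add: distrib_left)
    also have "\<dots> = (x - x ^ Suc K) + (1 - x) * x ^ Suc K" by (simp only: Suc.IH)
    also have "\<dots> = x - x ^ Suc (Suc K)" by (simp add: algebra_simps)
    finally show ?case .
  qed simp
  then have "(\<Sum>j=1..K. x ^ j) = (x - x ^ Suc K) / (1 - x)"
    using assms by (simp add: field_simps)
  also have "\<dots> \<le> x / (1 - x)" using assms by (intro divide_right_mono) auto
  finally show ?thesis .
qed

text \<open>
  The sum is \<open>1 + w\<close> with \<open>w\<close> a power series in \<open>z\<close> without constant term. By orthogonality \<open>w\<close> and \<open>w\<^sup>2\<close> have mean zero,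
  and the mean of \<open>|w|\<^sup>2\<close> is \<open>b\<^sup>2 + b\<^sup>4 + \<dots>\<close>.
\<close>
lemma local_factor_moment:
  fixes q :: real
  assumes q: "q > 0"
  obtains C where "C \<ge> 0"
    "\<And>b K. \<lbrakk>0 \<le> b; b \<le> 3 / 4\<rbrakk> \<Longrightarrow>
      (\<integral>\<theta>. norm (\<Sum>k\<le>K. (of_real b * cis (2 * pi * \<theta>)) ^ k) powr q \<partial>circle_measure) \<le> 1 + q\<^sup>2 / 4 * b\<^sup>2 + C * b ^ 3"
proof -
  interpret prob_space circle_measure by (rule prob_space_circle_measure)
  obtain C1 where C1: "C1 \<ge> 0" "\<And>w. norm w \<le> 4 \<Longrightarrow>
    norm (1 + w) powr q \<le> 1 + q * Re w + q\<^sup>2 / 4 * (norm w)\<^sup>2 + q / 2 * (q / 2 - 1) * Re (w\<^sup>2) + C1 * norm w ^ 3"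
    using norm_one_plus_powr_le[OF q, of 4] by auto
  define C where "C = q\<^sup>2 / 4 * 3 + C1 * 64"
  have C: "C \<ge> 0" using C1 by (simp add: C_def)
  have main: "(\<integral>\<theta>. norm (\<Sum>k\<le>K. (of_real b * cis (2 * pi * \<theta>)) ^ k) powr q \<partial>circle_measure) \<le> 1 + q\<^sup>2 / 4 * b\<^sup>2 + C * b ^ 3"
    if b: "0 \<le> b" "b \<le> 3 / 4" for b K
  proof -
    define e where "e = (\<lambda>\<theta>. cis (2 * pi * \<theta>))"
    define w where "w = (\<lambda>\<theta>. \<Sum>k=1..K. of_real (b ^ k) * e \<theta> ^ k)"
    have s: "(\<Sum>k\<le>K. (of_real b * cis (2 * pi * \<theta>)) ^ k) = 1 + w \<theta>" for \<theta>
    proof -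
      have "{..K} = insert 0 {1..K}" by auto
      then show ?thesis by (simp add: w_def e_def power_mult_distrib)
    qed
    have nw: "norm (w \<theta>) \<le> 4 * b" for \<theta>
    proof -
      have "norm (w \<theta>) \<le> (\<Sum>k=1..K. b ^ k)"
        unfolding w_def e_def using b by (intro sum_norm_le) (simp add: norm_mult norm_power)
      also have "\<dots> \<le> b / (1 - b)" using b by (intro sum_geometric_le) auto
      also have "\<dots> \<le> 4 * b" using b mult_left_mono[of b "3 / 4" b] by (simp add: field_simps)
      finally show ?thesis .
    qed
    have cm: "continuous_on UNIV (\<lambda>\<theta>. e \<theta> ^ u * cnj (e \<theta>) ^ v)" for u v unfolding e_def by (intro continuous_intros)
    have im: "integrable circle_measure (\<lambda>\<theta>. e \<theta> ^ u * cnj (e \<theta>) ^ v)" for u v by (rule circle_integral(1)[OF cm])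
    have Im: "(\<integral>\<theta>. e \<theta> ^ u * cnj (e \<theta>) ^ v \<partial>circle_measure) = (if u = v then 1 else 0)" for u v
      unfolding e_def by (rule circle_integral_monomial)
    have Im0: "(\<integral>\<theta>. e \<theta> ^ u \<partial>circle_measure) = (if u = 0 then 1 else 0)" "integrable circle_measure (\<lambda>\<theta>. e \<theta> ^ u)" for u
      using Im[of u 0] im[of u 0] by simp_all
    have I1: "(\<integral>\<theta>. w \<theta> \<partial>circle_measure) = 0"
      unfolding w_def using Im0 by simp
    have "(\<lambda>\<theta>. (w \<theta>)\<^sup>2) = (\<lambda>\<theta>. \<Sum>j=1..K. \<Sum>k=1..K. of_real (b ^ j * b ^ k) * e \<theta> ^ (j + k))"
      unfolding w_def power2_eq_square sum_product by (simp add: power_add mult_ac)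
    then have I2: "(\<integral>\<theta>. (w \<theta>)\<^sup>2 \<partial>circle_measure) = 0"
      using Im0 by (simp del: of_real_mult of_real_power)
    have wc: "(\<lambda>\<theta>. w \<theta> * cnj (w \<theta>)) = (\<lambda>\<theta>. \<Sum>j=1..K. \<Sum>k=1..K. of_real (b ^ j * b ^ k) * (e \<theta> ^ j * cnj (e \<theta>) ^ k))"
      unfolding w_def cnj_sum sum_product by (simp add: mult_ac)
    have "(\<integral>\<theta>. w \<theta> * cnj (w \<theta>) \<partial>circle_measure) = (\<Sum>j=1..K. \<Sum>k=1..K. of_real (b ^ j * b ^ k) * (if j = k then 1 else 0))"
      unfolding wc using Im im by (simp del: of_real_mult of_real_power)
    also have "\<dots> = of_real (\<Sum>j=1..K. (b\<^sup>2) ^ j)"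
      by (simp add: if_distrib[of "(*) _"] sum.delta power2_eq_square power_mult_distrib cong: if_cong)
    finally have I3: "(\<integral>\<theta>. w \<theta> * cnj (w \<theta>) \<partial>circle_measure) = of_real (\<Sum>j=1..K. (b\<^sup>2) ^ j)" .
    have cw: "continuous_on UNIV w" unfolding w_def e_def by (intro continuous_intros)
    have i1: "integrable circle_measure w" by (rule circle_integral(1)[OF cw])
    have i2: "integrable circle_measure (\<lambda>\<theta>. (w \<theta>)\<^sup>2)" by (intro circle_integral(1) continuous_intros cw)
    have i3: "integrable circle_measure (\<lambda>\<theta>. w \<theta> * cnj (w \<theta>))" by (intro circle_integral(1) continuous_intros cw)
    have sqn: "(norm (w \<theta>))\<^sup>2 = Re (w \<theta> * cnj (w \<theta>))" for \<theta>
      by (metis Re_complex_of_real complex_norm_square)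
    have i4: "integrable circle_measure (\<lambda>\<theta>. (norm (w \<theta>))\<^sup>2)" by (intro circle_integral(1) continuous_intros cw)
    have i0: "integrable circle_measure (\<lambda>\<theta>. norm (1 + w \<theta>) powr q)"
      using q by (intro circle_integral(1) continuous_on_powr' continuous_intros cw) auto
    have "(\<integral>\<theta>. norm (1 + w \<theta>) powr q \<partial>circle_measure)
       \<le> (\<integral>\<theta>. (1 + C1 * (64 * b ^ 3)) + q * Re (w \<theta>) + q\<^sup>2 / 4 * (norm (w \<theta>))\<^sup>2 + q / 2 * (q / 2 - 1) * Re ((w \<theta>)\<^sup>2) \<partial>circle_measure)"
    proof (rule Bochner_Integration.integral_mono[OF i0])
      show "integrable circle_measure (\<lambda>\<theta>. (1 + C1 * (64 * b ^ 3)) + q * Re (w \<theta>) + q\<^sup>2 / 4 * (norm (w \<theta>))\<^sup>2 + q / 2 * (q / 2 - 1) * Re ((w \<theta>)\<^sup>2))"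
        by (intro circle_integral(1) continuous_intros cw)
      fix \<theta>
      have "norm (w \<theta>) \<le> 4" using nw[of \<theta>] b by linarith
      moreover have "C1 * norm (w \<theta>) ^ 3 \<le> C1 * (4 * b) ^ 3" using nw[of \<theta>] C1(1) by (intro mult_left_mono power_mono) auto
      moreover have "(4 * b) ^ 3 = 64 * b ^ 3" by (simp add: power_mult_distrib)
      ultimately show "norm (1 + w \<theta>) powr q \<le> (1 + C1 * (64 * b ^ 3)) + q * Re (w \<theta>) + q\<^sup>2 / 4 * (norm (w \<theta>))\<^sup>2 + q / 2 * (q / 2 - 1) * Re ((w \<theta>)\<^sup>2)"
        using C1(2)[of "w \<theta>"] by simp
    qed
    also have "\<dots> = (1 + C1 * (64 * b ^ 3)) + q * Re (\<integral>\<theta>. w \<theta> \<partial>circle_measure) + q\<^sup>2 / 4 * Re (\<integral>\<theta>. w \<theta> * cnj (w \<theta>) \<partial>circle_measure)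
        + q / 2 * (q / 2 - 1) * Re (\<integral>\<theta>. (w \<theta>)\<^sup>2 \<partial>circle_measure)"
    proof -
      have "(\<integral>\<theta>. A + B * Re (f1 \<theta>) + B' * Re (f2 \<theta>) + B'' * Re (f3 \<theta>) \<partial>circle_measure)
          = A + B * Re (integral\<^sup>L circle_measure f1) + B' * Re (integral\<^sup>L circle_measure f2) + B'' * Re (integral\<^sup>L circle_measure f3)"
        if "integrable circle_measure f1" "integrable circle_measure f2" "integrable circle_measure f3"
        for A B B' B'' :: real and f1 f2 f3 :: "real \<Rightarrow> complex"
        using that prob_space by simp
      from this[OF i1 i3 i2] show ?thesis unfolding sqn .
    qed
    also have "\<dots> = 1 + C1 * (64 * b ^ 3) + q\<^sup>2 / 4 * (\<Sum>j=1..K. (b\<^sup>2) ^ j)" by (simp add: I1 I2 I3 del: of_real_sum)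
    also have "(\<Sum>j=1..K. (b\<^sup>2) ^ j) \<le> b\<^sup>2 + 3 * b ^ 3"
    proof -
      have b2: "b\<^sup>2 \<le> 9 / 16" using power_mono[OF b(2) b(1), of 2] by (simp add: power_divide)
      have "(\<Sum>j=1..K. (b\<^sup>2) ^ j) \<le> b\<^sup>2 / (1 - b\<^sup>2)" using b2 by (intro sum_geometric_le) auto
      also have "\<dots> = b\<^sup>2 + b ^ 4 / (1 - b\<^sup>2)" using b2 by (simp add: field_simps power2_eq_square numeral_eq_Suc)
      also have "b ^ 4 / (1 - b\<^sup>2) \<le> b ^ 4 / (7 / 16)" using b2 by (intro divide_left_mono) auto
      also have "b ^ 4 = b * b ^ 3" by (simp add: numeral_eq_Suc)
      also have "b * b ^ 3 / (7 / 16) \<le> 3 / 4 * b ^ 3 / (7 / 16)" using b by (intro divide_right_mono mult_right_mono) auto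
      also have "\<dots> \<le> 3 * b ^ 3" using b by simp
      finally show ?thesis by simp
    qed
    finally have "(\<integral>\<theta>. norm (1 + w \<theta>) powr q \<partial>circle_measure) \<le> 1 + C1 * (64 * b ^ 3) + q\<^sup>2 / 4 * (b\<^sup>2 + 3 * b ^ 3)"
      by (simp add: mult_left_mono)
    then show ?thesis unfolding s by (simp add: C_def algebra_simps)
  qed
  show ?thesis by (rule that[OF C main])
qed

definition euler_lift :: "nat \<Rightarrow> (nat \<Rightarrow> complex) \<Rightarrow> complex" where
  "euler_lift N z = (\<Prod>p\<in>primes_upto N. \<Sum>k\<le>N. (of_real (real p powr (- 1 / 2)) * z p) ^ k)"

lemma trig_poly_euler_lift: "trig_poly (primes_upto N) (euler_lift N)"
  unfolding euler_lift_def
  by (intro trig_poly_sum trig_poly_mult trig_poly_const trig_poly_prod trig_poly_power trig_poly_coordinate) auto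

lemma euler_lift_flow:
  "euler_lift N (kronecker_flow t)
     = (\<Sum>n\<in>smooth_numbers (primes_upto N) N. of_real (real n powr (- 1 / 2)) * cis (- (t * ln (real n))))"
  unfolding euler_lift_def kronecker_flow_def
  by (rule prod_geometric_eq_sum_smooth)
     (auto dest: primes_uptoD simp: powr_mult ln_mult_pos cis_mult algebra_simps)

lemma euler_lift_moment:
  fixes q :: real
  assumes q: "q > 0"
  obtains C where "C \<ge> 0" "\<And>N. N \<ge> 2 \<Longrightarrow>
    lift_moment q N (euler_lift N) \<le> C * ln (real N) powr (q\<^sup>2 / 4)"
proof -
  interpret product_prob_space "\<lambda>_ :: nat. circle_measure" by (rule product_prob_space_circle)
  obtain C0 where C0: "C0 \<ge> 0" "\<And>N. N \<ge> 2 \<Longrightarrow> (\<Sum>p\<in>primes_upto N. 1 / real p) \<le> ln (ln (real N)) + C0"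
    using mertens_upper by blast
  obtain C1 where C1: "C1 \<ge> 0" "\<And>b K. \<lbrakk>0 \<le> b; b \<le> 3 / 4\<rbrakk> \<Longrightarrow>
      (\<integral>\<theta>. norm (\<Sum>k\<le>K. (of_real b * cis (2 * pi * \<theta>)) ^ k) powr q \<partial>circle_measure) \<le> 1 + q\<^sup>2 / 4 * b\<^sup>2 + C1 * b ^ 3"
    using local_factor_moment[OF q] by blast
  define C where "C = exp (q\<^sup>2 / 4 * C0 + C1 * 3)"
  have main: "lift_moment q N (euler_lift N) \<le> C * ln (real N) powr (q\<^sup>2 / 4)"
    if N: "N \<ge> 2" for N
  proof -
    define f where "f = (\<lambda>p \<theta>. norm (\<Sum>k\<le>N. (of_real (real p powr (- 1 / 2)) * cis (2 * pi * \<theta>)) ^ k) powr q)"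
    have f: "integrable circle_measure (f p)" for p
      unfolding f_def using q by (intro circle_integral(1) continuous_on_powr' continuous_intros) auto
    have "lift_moment q N (euler_lift N)
      = (\<integral>\<omega>. (\<Prod>p\<in>primes_upto N. f p (\<omega> p)) \<partial>torus (primes_upto N))"
      unfolding euler_lift_def f_def unit_point_def prod_norm[symmetric] by (subst prod_powr_distrib) auto
    also have "\<dots> = (\<Prod>p\<in>primes_upto N. integral\<^sup>L circle_measure (f p))"
      unfolding torus_def by (rule product_integral_prod) (auto intro: f)
    also have "\<dots> \<le> (\<Prod>p\<in>primes_upto N. exp (q\<^sup>2 / 4 * (1 / real p) + C1 * real p powr (- 1 - 1 / 2)))"
    proof (intro prod_mono conjI)
      fix p assume p: "p \<in> primes_upto N"
      then have p2: "real p \<ge> 2" using primes_uptoD(3) by fastforce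
      show "0 \<le> integral\<^sup>L circle_measure (f p)" by (intro integral_nonneg_AE) (simp add: f_def)
      define b where "b = real p powr (- 1 / 2)"
      have b2: "b\<^sup>2 = 1 / real p" unfolding b_def using p2 by (intro powr_minus_half_square) simp
      have "b ^ 3 = b\<^sup>2 * b" by (simp add: numeral_eq_Suc)
      also have "\<dots> = real p powr (- 1) * real p powr (- 1 / 2)"
        unfolding b2 using p2 by (simp add: b_def powr_minus_divide)
      also have "\<dots> = real p powr (- 1 - 1 / 2)" unfolding powr_add[symmetric] by simp
      finally have b3: "b ^ 3 = real p powr (- 1 - 1 / 2)" .
      have "b\<^sup>2 \<le> (3 / 4)\<^sup>2" unfolding b2 using p2 by (simp add: field_simps power2_eq_square)
      then have "b \<le> 3 / 4" by (rule power2_le_imp_le) simp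
      then have "integral\<^sup>L circle_measure (f p) \<le> 1 + q\<^sup>2 / 4 * b\<^sup>2 + C1 * b ^ 3"
        unfolding f_def b_def[symmetric] by (intro C1(2)) (simp_all add: b_def)
      also have "\<dots> \<le> exp (q\<^sup>2 / 4 * b\<^sup>2 + C1 * b ^ 3)" using exp_ge_add_one_self[of "q\<^sup>2 / 4 * b\<^sup>2 + C1 * b ^ 3"] by (simp only: add.assoc)
      finally show "integral\<^sup>L circle_measure (f p) \<le> exp (q\<^sup>2 / 4 * (1 / real p) + C1 * real p powr (- 1 - 1 / 2))"
        unfolding b2 b3 .
    qed
    also have "\<dots> = exp (q\<^sup>2 / 4 * (\<Sum>p\<in>primes_upto N. 1 / real p) + C1 * (\<Sum>p\<in>primes_upto N. real p powr (- 1 - 1 / 2)))"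
      by (simp add: exp_sum[symmetric] sum.distrib sum_distrib_left)
    also have "\<dots> \<le> exp (q\<^sup>2 / 4 * (ln (ln (real N)) + C0) + C1 * 3)"
    proof -
      have "(\<Sum>p\<in>primes_upto N. real p powr (- 1 - 1 / 2)) \<le> (\<Sum>n=1..N. real n powr (- 1 - 1 / 2))"
        by (rule sum_mono2) (auto simp: primes_upto_def Suc_le_eq prime_gt_0_nat)
      also have "\<dots> \<le> 3" using sum_powr_le[of "1 / 2" N] by simp
      finally show ?thesis using C0(2)[OF N] C1(1) by (simp add: add_mono mult_left_mono)
    qed
    also have "\<dots> = C * ln (real N) powr (q\<^sup>2 / 4)"
      using N by (simp add: C_def powr_def algebra_simps flip: exp_add)
    finally show ?thesis .
  qed
  show ?thesis by (rule that[OF _ main]) (simp_all add: C_def)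
qed

lemma dirichlet_norm_upper_bound:
  fixes q :: real
  assumes q: "q > 1"
  shows "\<exists>K>0. \<forall>N\<ge>2. dirichlet_norm q (D N) \<le> K * ln (real N) powr (q / 4)"
proof -
  have q0: "q > 0" using q by simp
  obtain C where C: "C \<ge> 0"
    "\<forall>(c :: nat \<Rightarrow> real) A N. finite A \<longrightarrow> (\<forall>n\<in>A. n > 0) \<longrightarrow> N > 0 \<longrightarrow> \<bar>c N\<bar> \<le> 1 \<longrightarrow>
      (\<forall>\<^sub>F T in at_top. integral {0..T} (\<lambda>t. norm (cis_sum c {n \<in> A. n \<le> N} t) powr q)
        \<le> C * (integral {0..T} (\<lambda>t. norm (cis_sum c A t) powr q) + T))"
    using partial_sum_bound[OF q] by (elim exE conjE)
  obtain C' where C': "C' \<ge> 0" "\<And>N. N \<ge> 2 \<Longrightarrow>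
    lift_moment q N (euler_lift N) \<le> C' * ln (real N) powr (q\<^sup>2 / 4)"
    using euler_lift_moment[OF q0] by blast
  define M where "M = C * (C' + 1 / ln 2 powr (q\<^sup>2 / 4)) + 1"
  have M: "M > 0" using C C' by (simp add: M_def add_nonneg_pos)
  show ?thesis
  proof (intro exI[of _ "M powr (1 / q)"] conjI allI impI)
    show "M powr (1 / q) > 0" using M by simp
    fix N :: nat assume N: "N \<ge> 2"
    define I where "I = lift_moment q N (dirichlet_lift N)"
    define E where "E = lift_moment q N (euler_lift N)"
    define A where "A = smooth_numbers (primes_upto N) N"
    have A: "finite A" "\<And>n. n \<in> A \<Longrightarrow> n > 0" "{n. n \<in> A \<and> n \<le> N} = {1..N}"
      using interval_subset_smooth_numbers[of N] smooth_numbers_pos[of "primes_upto N"] primes_uptoD(1)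
      unfolding A_def by (auto simp: Suc_le_eq)
    have lim1: "((\<lambda>T. integral {0..T} (\<lambda>t. norm (dirichlet_lift N (kronecker_flow t)) powr q) / T) \<longlongrightarrow> I) at_top"
      unfolding I_def by (rule torus_moment(2)[OF _ _ trig_poly_dirichlet_lift q0]) (auto dest: primes_uptoD)
    have "((\<lambda>T. integral {0..T} (\<lambda>t. norm (euler_lift N (kronecker_flow t)) powr q) / T) \<longlongrightarrow> E) at_top"
      unfolding E_def by (rule torus_moment(2)[OF _ _ trig_poly_euler_lift q0]) (auto dest: primes_uptoD)
    then have lim2: "((\<lambda>T. C * (integral {0..T} (\<lambda>t. norm (euler_lift N (kronecker_flow t)) powr q) / T + 1)) \<longlongrightarrow> C * (E + 1)) at_top"
      by (intro tendsto_intros)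
    have dl: "dirichlet_lift N (kronecker_flow t) = (\<Sum>n | n \<in> A \<and> n \<le> N. of_real (real n powr (- 1 / 2)) * cis (- (t * ln (real n))))" for t
      unfolding dirichlet_lift_flow D_def A(3) by (intro sum.cong refl nat_powr_half_line) auto
    have "real N powr (- 1 / 2) \<le> real N powr 0" using N by (intro powr_mono) auto
    then have "\<bar>real N powr (- 1 / 2)\<bar> \<le> 1" using N by simp
    from C(2)[rule_format, of A N "\<lambda>n. real n powr (- 1 / 2)", OF A(1,2) _ this] N
    have "\<forall>\<^sub>F T in at_top. integral {0..T} (\<lambda>t. norm (dirichlet_lift N (kronecker_flow t)) powr q)
        \<le> C * (integral {0..T} (\<lambda>t. norm (euler_lift N (kronecker_flow t)) powr q) + T)"
      unfolding dl euler_lift_flow A_def[symmetric] by simp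
    moreover have "\<forall>\<^sub>F T in at_top. (0 :: real) < T" by (rule eventually_gt_at_top)
    ultimately have "\<forall>\<^sub>F T in at_top. integral {0..T} (\<lambda>t. norm (dirichlet_lift N (kronecker_flow t)) powr q) / T
        \<le> C * (integral {0..T} (\<lambda>t. norm (euler_lift N (kronecker_flow t)) powr q) / T + 1)"
      by eventually_elim (simp add: field_simps)
    then have "I \<le> C * (E + 1)" by (rule tendsto_le[OF trivial_limit_at_top_linorder lim2 lim1])
    also have "\<dots> \<le> C * ((C' + 1 / ln 2 powr (q\<^sup>2 / 4)) * ln (real N) powr (q\<^sup>2 / 4))"
    proof (rule mult_left_mono[OF _ C(1)])
      have "ln 2 powr (q\<^sup>2 / 4) \<le> ln (real N) powr (q\<^sup>2 / 4)" using N by (intro powr_mono2) auto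
      then have "1 \<le> 1 / ln 2 powr (q\<^sup>2 / 4) * ln (real N) powr (q\<^sup>2 / 4)" by (simp add: field_simps)
      then show "E + 1 \<le> (C' + 1 / ln 2 powr (q\<^sup>2 / 4)) * ln (real N) powr (q\<^sup>2 / 4)"
        using C'(2)[OF N] unfolding E_def[symmetric] distrib_right by linarith
    qed
    also have "\<dots> \<le> M * ln (real N) powr (q\<^sup>2 / 4)"
      unfolding M_def by (simp add: distrib_right mult.assoc)
    finally have "I \<le> M * ln (real N) powr (q\<^sup>2 / 4)" .
    moreover have "I \<ge> 0" unfolding I_def by (intro integral_nonneg_AE) auto
    ultimately have "I powr (1 / q) \<le> (M * ln (real N) powr (q\<^sup>2 / 4)) powr (1 / q)"
      using q0 by (intro powr_mono2) auto
    also have "\<dots> = M powr (1 / q) * ln (real N) powr (q / 4)"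
      using q0 by (simp add: powr_mult powr_powr power2_eq_square)
    finally show "dirichlet_norm q (D N) \<le> M powr (1 / q) * ln (real N) powr (q / 4)"
      unfolding dirichlet_norm_eq_torus[OF q0] I_def .
  qed
qed

theorem mainTheorem3:
  "(\<forall>q::real. 0 < q \<longrightarrow>
      (\<exists>K::real. K > 0 \<and>
        (\<forall>N::nat. N \<ge> 2 \<longrightarrow>
          ln (real N) powr (q / 4) \<le> K * dirichlet_norm q (D N)))) \<and>
   (\<forall>q::real. 1 < q \<longrightarrow>
      (\<exists>K::real. K > 0 \<and>
        (\<forall>N::nat. N \<ge> 2 \<longrightarrow>
          dirichlet_norm q (D N) \<le> K * ln (real N) powr (q / 4))))"
  using dirichlet_norm_lower_bound dirichlet_norm_upper_bound by blast

end
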